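(* (i) For every finite group $G$, the classes $\{\mathcal{M} \in \mathbf{S} : G \cong \mathrm{Aut}(\mathcal{M})\}$ and $\{\mathcal{M} \in \mathbf{S} : G \leq \mathrm{Aut}(\mathcal{M})\}$ have a limit law. (ii) For every integer $m \geq 2$, the classes $\mathbf{S}(\mathrm{spt}^* = m)$, $\mathbf{S}(\mathrm{spt} \geq m)$ and $\mathbf{S}(\mathrm{spt}^* \geq m)$ have a limit law. (iii) In each case of (i) and (ii) there is a finite set $A \subseteq \mathbb{Q}$ such that, for every first-order sentence $\varphi$, the proportion of structures of the kind considered with universe $[n]$ that satisfy $\varphi$ converges to some $a \in A$ as $n \to \infty$.
   Context: Fix a finite relational vocabulary $\{R_1,\dots,R_\rho\}$, $R_i$ of arity $r_i$, with maximal arity $r=\max_i r_i \geq 2$. $\mathbf{S}_n$ is the set of all structures for this vocabulary with universe $[n]=\{1,\dots,n\}$ and $\mathbf{S}=\bigcup_{n\ge1}\mathbf{S}_n$. For permutations $f_1,\dots,f_k$ of a set $A$, $\mathrm{Spt}(f_1,\dots,f_k)=\{a\in A: g(a)\neq a \text{ for some } g\in\langle f_1,\dots,f_k\rangle\}$ and $\mathrm{spt}(f_1,\dots,f_k)=|\mathrm{Spt}(f_1,\dots,f_k)|$. For a finite structure $\mathcal{M}$: $\mathrm{spt}(\mathcal{M})=\max\{\mathrm{spt}(f): f\in \mathrm{Aut}(\mathcal{M})\}$; $\mathrm{Spt}^*(\mathcal{M})=\{a\in M: a\in\mathrm{Spt}(f) \text{ for some } f\in\mathrm{Aut}(\mathcal{M})\}$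 and $\mathrm{spt}^*(\mathcal{M})=|\mathrm{Spt}^*(\mathcal{M})|$. $\mathbf{S}_n(\mathrm{spt}^*=m)=\{\mathcal{M}\in\mathbf{S}_n:\mathrm{spt}^*(\mathcal{M})=m\}$, and similarly for $\mathrm{spt}\geq m$, $\mathrm{spt}^*\geq m$; for any such family, $\mathbf{S}'=\bigcup_n \mathbf{S}'_n$. $G\cong H$ means isomorphic as groups, $G\le H$ means $G$ is isomorphic to a subgroup of $H$. A class $\mathbf{S}'=\bigcup_n \mathbf{S}'_n$ with $\mathbf{S}'_n\subseteq\mathbf{S}_n$ has a limit law if for every first-order sentence $\varphi$ of the vocabulary, the proportion of $\mathcal{M}\in\mathbf{S}'_n$ satisfying $\varphi$ converges as $n\to\infty$ (a zero-one law if the limit is always $0$ or $1$). *)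

theory Defs
  imports Complex_Main "HOL-Algebra.Bij" "HOL-Algebra.Generated_Groups"
begin

section \<open>Finite relational structures\<close>

text \<open>A finite relational vocabulary is a finite type \<open>'r\<close> of relation symbols together with
  an arity function \<open>ar\<close>. Relations are sets of tuples, and tuples are lists.\<close>

record ('a, 'r) rel_structure =
  universe :: "'a set"
  interp :: "'r \<Rightarrow> 'a list set"

definition Structures_on :: "('r \<Rightarrow> nat) \<Rightarrow> nat \<Rightarrow> (nat, 'r) rel_structure set" where
  "Structures_on ar n =
     {M. universe M = {1..n} \<and>
         (\<forall>R. interp M R \<subseteq> {t. length t = ar R \<and> set t \<subseteq> universe M})}"

definition Structures :: "('r \<Rightarrow> nat) \<Rightarrow> (nat, 'r) rel_structure set" where
  "Structures ar = (\<Union>n\<in>{1..}. Structures_on ar n)"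

section \<open>First-order logic with equality\<close>

datatype 'r formula =
    Eq nat nat
  | Rel 'r "nat list"
  | Neg "'r formula"
  | Conj "'r formula" "'r formula"
  | Ex nat "'r formula"

primrec well_formed :: "('r \<Rightarrow> nat) \<Rightarrow> 'r formula \<Rightarrow> bool" where
  "well_formed ar (Eq x y) \<longleftrightarrow> True"
| "well_formed ar (Rel R xs) \<longleftrightarrow> length xs = ar R"
| "well_formed ar (Neg p) \<longleftrightarrow> well_formed ar p"
| "well_formed ar (Conj p q) \<longleftrightarrow> well_formed ar p \<and> well_formed ar q"
| "well_formed ar (Ex x p) \<longleftrightarrow> well_formed ar p"

primrec free_vars :: "'r formula \<Rightarrow> nat set" where
  "free_vars (Eq x y) = {x, y}"
| "free_vars (Rel R xs) = set xs"
| "free_vars (Neg p) = free_vars p"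
| "free_vars (Conj p q) = free_vars p \<union> free_vars q"
| "free_vars (Ex x p) = free_vars p - {x}"

definition sentence :: "('r \<Rightarrow> nat) \<Rightarrow> 'r formula \<Rightarrow> bool" where
  "sentence ar p \<longleftrightarrow> well_formed ar p \<and> free_vars p = {}"

primrec sat :: "('a, 'r) rel_structure \<Rightarrow> (nat \<Rightarrow> 'a) \<Rightarrow> 'r formula \<Rightarrow> bool" where
  "sat M e (Eq x y) \<longleftrightarrow> e x = e y"
| "sat M e (Rel R xs) \<longleftrightarrow> map e xs \<in> interp M R"
| "sat M e (Neg p) \<longleftrightarrow> \<not> sat M e p"
| "sat M e (Conj p q) \<longleftrightarrow> sat M e p \<and> sat M e q"
| "sat M e (Ex x p) \<longleftrightarrow> (\<exists>a\<in>universe M. sat M (e(x := a)) p)"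

definition models :: "('a, 'r) rel_structure \<Rightarrow> 'r formula \<Rightarrow> bool" (infix "\<Turnstile>" 50) where
  "M \<Turnstile> p \<longleftrightarrow> (\<forall>e. range e \<subseteq> universe M \<longrightarrow> sat M e p)"

section \<open>Automorphisms and supports\<close>

definition automorphisms :: "('r \<Rightarrow> nat) \<Rightarrow> ('a, 'r) rel_structure \<Rightarrow> ('a \<Rightarrow> 'a) set" where
  "automorphisms ar M =
     {f \<in> Bij (universe M).
        \<forall>R t. length t = ar R \<and> set t \<subseteq> universe M \<longrightarrow>
          (t \<in> interp M R \<longleftrightarrow> map f t \<in> interp M R)}"

definition Aut :: "('r \<Rightarrow> nat) \<Rightarrow> ('a, 'r) rel_structure \<Rightarrow> ('a \<Rightarrow> 'a) monoid" where
  "Aut ar M = (BijGroup (universe M))\<lparr>carrier := automorphisms ar M\<rparr>"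

lemma subgroup_automorphisms:
  "subgroup (automorphisms ar M) (BijGroup (universe M))"
proof (rule subgroup.intro)
  let ?A = "universe M"
  have bij: "f \<in> Bij ?A" if "f \<in> automorphisms ar M" for f
    using that by (simp add: automorphisms_def)
  have pres: "t \<in> interp M R \<longleftrightarrow> map f t \<in> interp M R"
    if "f \<in> automorphisms ar M" "length t = ar R" "set t \<subseteq> ?A" for f t R
    using that by (simp add: automorphisms_def)
  have closed: "set (map f t) \<subseteq> ?A" if "f \<in> Bij ?A" "set t \<subseteq> ?A" for f t
    using that Bij_imp_funcset by fastforce
  show "automorphisms ar M \<subseteq> carrier (BijGroup ?A)"
    by (auto simp: automorphisms_def BijGroup_def)
  have "map (\<lambda>x\<in>?A. x) t = t" if "set t \<subseteq> ?A" for t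
    using that by (intro map_idI) auto
  then show "\<one>\<^bsub>BijGroup ?A\<^esub> \<in> automorphisms ar M"
    by (auto simp: automorphisms_def BijGroup_def id_Bij)
  show "f \<otimes>\<^bsub>BijGroup ?A\<^esub> g \<in> automorphisms ar M"
    if f: "f \<in> automorphisms ar M" and g: "g \<in> automorphisms ar M" for f g
  proof -
    have "t \<in> interp M R \<longleftrightarrow> map (compose ?A f g) t \<in> interp M R"
      if t: "length t = ar R" "set t \<subseteq> ?A" for t R
    proof -
      have "map (compose ?A f g) t = map f (map g t)"
        using t by (auto simp: compose_def)
      then show ?thesis
        using pres[OF g t] pres[OF f, of "map g t" R] closed[OF bij[OF g] t(2)] t
        by (metis length_map)
    qed
    then have "compose ?A f g \<in> automorphisms ar M"
      using bij[OF f] bij[OF g] by (simp add: automorphisms_def compose_Bij)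
    then show ?thesis
      using bij[OF f] bij[OF g] by (simp add: BijGroup_def)
  qed
  show "inv\<^bsub>BijGroup ?A\<^esub> f \<in> automorphisms ar M" if f: "f \<in> automorphisms ar M" for f
  proof -
    let ?h = "\<lambda>x\<in>?A. inv_into ?A f x"
    have h: "?h \<in> Bij ?A" by (rule restrict_inv_into_Bij[OF bij[OF f]])
    have "f ` ?A = ?A" using bij[OF f] by (simp add: Bij_def bij_betw_def)
    then have fh: "f (?h x) = x" if "x \<in> ?A" for x
      using that by (simp add: f_inv_into_f)
    have "t \<in> interp M R \<longleftrightarrow> map ?h t \<in> interp M R"
      if t: "length t = ar R" "set t \<subseteq> ?A" for t R
    proof -
      have "map f (map ?h t) = t"
        unfolding map_map by (rule map_idI) (use t fh in auto)
      then show ?thesis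
        using pres[OF f, of "map ?h t" R] closed[OF h t(2)] t by (metis length_map)
    qed
    with h have "?h \<in> automorphisms ar M"
      unfolding automorphisms_def by blast
    then show ?thesis
      by (simp add: inv_BijGroup[OF bij[OF f]])
  qed
qed

lemma group_Aut: "group (Aut ar M)"
  unfolding Aut_def
  by (rule subgroup.subgroup_is_group[OF subgroup_automorphisms group_BijGroup])

definition embeds_in :: "('g, 'c) monoid_scheme \<Rightarrow> ('h, 'd) monoid_scheme \<Rightarrow> bool"
    (infix "\<lesssim>\<^sub>g" 50) where
  "G \<lesssim>\<^sub>g H \<longleftrightarrow> (\<exists>K. subgroup K H \<and> G \<cong> H\<lparr>carrier := K\<rparr>)"

text \<open>The support of a set \<open>F\<close> of permutations of \<open>A\<close>, elements of \<open>Bij A\<close>.\<close>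

definition Spt :: "'a set \<Rightarrow> ('a \<Rightarrow> 'a) set \<Rightarrow> 'a set" where
  "Spt A F = {a \<in> A. \<exists>g\<in>generate (BijGroup A) F. g a \<noteq> a}"

definition spt :: "('r \<Rightarrow> nat) \<Rightarrow> ('a, 'r) rel_structure \<Rightarrow> nat" where
  "spt ar M = Max {card (Spt (universe M) {f}) | f. f \<in> automorphisms ar M}"

definition Spt_star :: "('r \<Rightarrow> nat) \<Rightarrow> ('a, 'r) rel_structure \<Rightarrow> 'a set" where
  "Spt_star ar M = {a \<in> universe M. \<exists>f\<in>automorphisms ar M. a \<in> Spt (universe M) {f}}"

definition spt_star :: "('r \<Rightarrow> nat) \<Rightarrow> ('a, 'r) rel_structure \<Rightarrow> nat" where
  "spt_star ar M = card (Spt_star ar M)"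

section \<open>Limit laws\<close>

text \<open>For a class \<open>C\<close> of structures, the members with universe \<open>{1..n}\<close> are
  \<open>C \<inter> Structures_on ar n\<close>. If there are none for some \<open>n\<close>, the proportion is \<open>0\<close>
  by the convention \<open>x / 0 = 0\<close>.\<close>

definition proportion ::
    "('r \<Rightarrow> nat) \<Rightarrow> (nat, 'r) rel_structure set \<Rightarrow> 'r formula \<Rightarrow> nat \<Rightarrow> real" where
  "proportion ar C p n =
     real (card {M \<in> C \<inter> Structures_on ar n. M \<Turnstile> p}) / real (card (C \<inter> Structures_on ar n))"

definition limit_law :: "('r \<Rightarrow> nat) \<Rightarrow> (nat, 'r) rel_structure set \<Rightarrow> bool" where
  "limit_law ar C \<longleftrightarrow> (\<forall>p. sentence ar p \<longrightarrow> convergent (proportion ar C p))"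

lemma finite_Structures_on:
  fixes ar :: "'r::finite \<Rightarrow> nat"
  shows "finite (Structures_on ar n)"
proof -
  let ?T = "\<lambda>R. Pow {t. set t \<subseteq> {1..n} \<and> length t = ar R}"
  have "finite (PiE UNIV ?T)"
    by (intro finite_PiE) (auto intro: finite_lists_length_eq)
  moreover have "Structures_on ar n \<subseteq>
      (\<lambda>I. \<lparr>universe = {1..n}, interp = I\<rparr>) ` PiE UNIV ?T"
  proof
    fix M assume "M \<in> Structures_on ar n"
    then have "M = \<lparr>universe = {1..n}, interp = interp M\<rparr>" "interp M \<in> PiE UNIV ?T"
      by (auto simp: Structures_on_def)
    then show "M \<in> (\<lambda>I. \<lparr>universe = {1..n}, interp = I\<rparr>) ` PiE UNIV ?T"
      by blast
  qed
  ultimately show ?thesis by (meson finite_imageI finite_subset)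
qed

end

theory Submission
  imports Defs "HOL-Combinatorics.Permutations" "HOL-Computational_Algebra.Polynomial"
    "HOL-Real_Asymp.Real_Asymp"
begin

text \<open>All five classes consist of the structures whose automorphism group, as a permutation group,
  has a property \<open>P\<close> invariant under conjugation, and the theorem holds for every such \<open>P\<close>.

  Fix a group \<open>H\<close> of permutations of \<open>A = {1..a}\<close> that moves every point of \<open>A\<close>. A structure on
  \<open>{1..n}\<close> invariant under \<open>H\<close> is a free choice on the \<open>H\<close>-orbits of tuples, whose number is a
  polynomial in \<open>n\<close> by Burnside's lemma. In almost all such structures no automorphism moves a
  point outside \<open>A\<close>, the permutations of \<open>A\<close> that are automorphisms are determined by the substructure
  \<open>N\<close> on \<open>A\<close>, and the extension axioms over \<open>A\<close> hold, so that a back-and-forth argument lets \<open>N\<close>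
  decide every first-order sentence. Hence the number of structures with automorphism group exactly
  \<open>H\<close> that satisfy a given sentence is asymptotically a rational multiple of \<open>2\<close> to that polynomial,
  where the multiplier counts certain \<open>N\<close>.

  A permutation moving \<open>s\<close> points costs about \<open>s n\<^sup>r\<^sup>-\<^sup>1 / 2\<close> binary choices (\<open>r\<close> the maximal arity), and
  some automorphism moves at least half of the points moved by the group. So once the class is
  nonempty, supports beyond some bound are negligible and finitely many \<open>H\<close> remain. Their
  contributions \<open>n\<^sup>a 2\<^sup>p\<^sup>(\<^sup>n\<^sup>)\<close> are pairwise comparable with rational limit quotients, which yields rational
  limits from a finite set.\<close>

unbundle no m_inv_syntax

section \<open>Counting families of subsets\<close>

text \<open>An atom with an entry outside \<open>A\<close> shows fewer than \<open>r\<close> points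
  of \<open>A\<close>, so invariance under \<open>H\<close> forces every permutation of
  \<open>A\<close> that agrees with elements of \<open>H\<close> on all shorter tuples, unless the
  structure \<open>N\<close> inside \<open>A\<close> breaks it. With one binary relation and
  \<open>H\<close> cyclic of order 3 on three points, all six permutations are forced outside
  \<open>A\<close>, and half of the eight invariant \<open>N\<close> leave only \<open>H\<close>.
  The alternating group on four points never survives, since every binary relation it preserves is
  preserved by all permutations. So the multiplier may lie strictly between 0 and 1, and it may be
  0. In the last case the count must vanish exactly, because the weight of such an \<open>H\<close>
  could exceed that of the groups that do occur. The multiplier is rational because the orbits
  inside \<open>A\<close> are chosen independently of the others, which makes \<open>N\<close>
  uniformly distributed among the invariant structures on \<open>A\<close>.\<close>

lemma card_subsets_with_twins:
  fixes \<Omega> :: "'x set"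
  assumes fin: "finite \<Omega>" and F: "F \<subseteq> Pow \<Omega>" and B: "B \<subseteq> \<Omega>"
    and twin: "\<And>c. c \<in> B \<Longrightarrow> \<exists>d\<in>\<Omega>. d \<noteq> c \<and> (\<forall>U\<in>F. c \<in> U \<longleftrightarrow> d \<in> U)"
  shows "real (card F) \<le> 2 ^ card \<Omega> * (1 / sqrt 2) ^ card B"
proof -
  define R where "R = {(c, d). c \<in> \<Omega> \<and> d \<in> \<Omega> \<and> (\<forall>U\<in>F. c \<in> U \<longleftrightarrow> d \<in> U)}"
  have eq: "equiv \<Omega> R"
    by (auto simp: R_def equiv_def refl_on_def sym_def trans_def)
  define Q where "Q = \<Omega> // R"
  have finQ: "finite Q" unfolding Q_def
    by (rule finite_quotient[OF fin]) (auto simp: R_def)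
  have UQ: "\<Union>Q = \<Omega>" unfolding Q_def by (rule Union_quotient[OF eq])
  have class_finite: "finite q" if "q \<in> Q" for q
    using that UQ fin by (meson Union_upper finite_subset)
  \<comment> \<open>A class meeting \<open>B\<close> contains a point and its twin, hence at least
    two elements. Summed over the classes this gives
    \<open>card Q \<le> card \<Omega> - card B / 2\<close>, and a member of \<open>F\<close> is a
    union of classes.\<close>
  have class_card: "2 + card (q \<inter> B) \<le> 2 * card q" if q: "q \<in> Q" for q
  proof -
    obtain c where c: "c \<in> \<Omega>" "q = R `` {c}" using q unfolding Q_def by (auto elim: quotientE)
    have cq: "c \<in> q" using c by (auto simp: R_def)
    have fq: "finite q" using class_finite q by blast
    show ?thesis
    proof (cases "q \<inter> B = {}")
      case True
      then show ?thesis using cq fq by (simp add: Suc_le_eq card_gt_0_iff) blast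
    next
      case False
      then obtain b where b: "b \<in> q" "b \<in> B" by blast
      obtain d where d: "d \<in> \<Omega>" "d \<noteq> b" "\<forall>U\<in>F. b \<in> U \<longleftrightarrow> d \<in> U" using twin[OF b(2)] by blast
      have "d \<in> q" using b d c by (auto simp: R_def)
      then have "card {b, d} \<le> card q" using b fq by (intro card_mono) auto
      moreover have "card {b, d} = 2" using d by auto
      moreover have "card (q \<inter> B) \<le> card q" using fq by (intro card_mono) auto
      ultimately show ?thesis by linarith
    qed
  qed
  have disj: "q \<inter> q' = {}" if "q \<in> Q" "q' \<in> Q" "q \<noteq> q'" for q q'
    using quotient_disj[OF eq, of q q'] that unfolding Q_def by blast
  have "card \<Omega> = (\<Sum>q\<in>Q. card q)"
    using card_Union_disjoint[of Q] disj class_finite UQ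
    by (simp add: pairwise_def disjnt_def)
  moreover have "card B = (\<Sum>q\<in>Q. card (q \<inter> B))"
  proof -
    have "B = (\<Union>q\<in>Q. q \<inter> B)" using UQ B by blast
    then have "card B = card (\<Union>q\<in>Q. q \<inter> B)" by simp
    also have "\<dots> = (\<Sum>q\<in>Q. card (q \<inter> B))"
      using finQ class_finite disj by (intro card_UN_disjoint) blast+
    finally show ?thesis .
  qed
  moreover have "(\<Sum>q\<in>Q. 2 + card (q \<inter> B)) \<le> (\<Sum>q\<in>Q. 2 * card q)"
    by (rule sum_mono) (rule class_card)
  then have "card Q * 2 + (\<Sum>q\<in>Q. card (q \<inter> B)) \<le> 2 * (\<Sum>q\<in>Q. card q)"
    by (simp only: sum.distrib sum_constant sum_distrib_left of_nat_id)
  ultimately have "2 * card Q + card B \<le> 2 * card \<Omega>" by simp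
  then have 1: "real (card Q) \<le> real (card \<Omega>) - real (card B) / 2" by linarith
  have "card F \<le> card (Pow Q)"
  proof (rule card_inj_on_le[where f = "\<lambda>U. {q \<in> Q. q \<subseteq> U}"])
    have "\<Union>{q \<in> Q. q \<subseteq> U} = U" if U: "U \<in> F" for U
    proof
      show "U \<subseteq> \<Union>{q \<in> Q. q \<subseteq> U}"
      proof
        fix c assume c: "c \<in> U"
        then have "c \<in> \<Omega>" using F U by blast
        moreover have "R `` {c} \<subseteq> U" using c U by (auto simp: R_def)
        ultimately show "c \<in> \<Union>{q \<in> Q. q \<subseteq> U}"
          unfolding Q_def using quotientI[of c \<Omega> R] by (auto simp: R_def)
      qed
    qed auto
    then show "inj_on (\<lambda>U. {q \<in> Q. q \<subseteq> U}) F" by (metis (no_types, lifting) inj_onI)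
  qed (use finQ in auto)
  then have "real (card F) \<le> 2 ^ card Q"
    using finQ by (simp add: card_Pow)
  also have "\<dots> = 2 powr real (card Q)" by (simp add: powr_realpow)
  also have "\<dots> \<le> 2 powr (real (card \<Omega>) - real (card B) / 2)" using 1 by simp
  also have "\<dots> = 2 ^ card \<Omega> * (1 / sqrt 2) ^ card B"
  proof -
    have "(2::real) powr (real (card B) / 2) = (2 powr (1/2)) powr real (card B)"
      by (simp add: powr_powr)
    also have "\<dots> = sqrt 2 ^ card B" by (simp add: powr_half_sqrt powr_realpow)
    finally have "(2::real) powr (real (card B) / 2) = sqrt 2 ^ card B" .
    then show ?thesis by (simp add: powr_diff powr_realpow power_divide)
  qed
  finally show ?thesis .
qed

text \<open>The traces on disjoint blocks are independent, and the block of \<open>y\<close> misses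
  its prescribed trace with proportion \<open>1 - 1 / 2 ^ card (D y)\<close>. The induction splits
  off one block at a time.\<close>

lemma card_subsets_avoiding_traces:
  fixes \<Omega> :: "'x set"
  assumes "finite Y" "finite \<Omega>" "\<And>y. y \<in> Y \<Longrightarrow> D y \<subseteq> \<Omega>" "\<And>y. y \<in> Y \<Longrightarrow> card (D y) \<le> L"
    "disjoint_family_on D Y" "\<And>y. y \<in> Y \<Longrightarrow> T y \<subseteq> D y"
  shows "real (card {U \<in> Pow \<Omega>. \<forall>y\<in>Y. U \<inter> D y \<noteq> T y}) \<le> 2 ^ card \<Omega> * (1 - 1 / 2 ^ L) ^ card Y"
  using assms
proof (induction Y arbitrary: \<Omega> rule: finite_induct)
  case empty
  then show ?case by (simp flip: Pow_def add: card_Pow)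
next
  case (insert y Y)
  define \<Omega>' where "\<Omega>' = \<Omega> - D y"
  have Dy: "D y \<subseteq> \<Omega>" "finite (D y)" "card (D y) \<le> L" "T y \<subseteq> D y"
    using insert.prems finite_subset[OF _ insert.prems(1)] by auto
  have disj: "D y \<inter> D z = {}" if "z \<in> Y" for z
    using insert.prems(4) insert.hyps that by (auto simp: disjoint_family_on_def)
  have sub: "D z \<subseteq> \<Omega>'" if "z \<in> Y" for z
    using insert.prems(2)[of z] that disj[OF that] by (auto simp: \<Omega>'_def)
  have IH: "real (card {U \<in> Pow \<Omega>'. \<forall>z\<in>Y. U \<inter> D z \<noteq> T z}) \<le> 2 ^ card \<Omega>' * (1 - 1 / 2 ^ L) ^ card Y"
    using insert.prems sub
    by (intro insert.IH) (auto simp: \<Omega>'_def disjoint_family_on_def)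
  have "card {U \<in> Pow \<Omega>. \<forall>z\<in>insert y Y. U \<inter> D z \<noteq> T z}
      \<le> card ((Pow (D y) - {T y}) \<times> {U \<in> Pow \<Omega>'. \<forall>z\<in>Y. U \<inter> D z \<noteq> T z})"
  proof (rule card_inj_on_le[where f = "\<lambda>U. (U \<inter> D y, U - D y)"])
    show "inj_on (\<lambda>U. (U \<inter> D y, U - D y)) {U \<in> Pow \<Omega>. \<forall>z\<in>insert y Y. U \<inter> D z \<noteq> T z}"
      by (rule inj_onI) blast
    have "(U - D y) \<inter> D z = U \<inter> D z" if "z \<in> Y" for U z using disj[OF that] by blast
    then show "(\<lambda>U. (U \<inter> D y, U - D y)) ` {U \<in> Pow \<Omega>. \<forall>z\<in>insert y Y. U \<inter> D z \<noteq> T z}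
      \<subseteq> (Pow (D y) - {T y}) \<times> {U \<in> Pow \<Omega>'. \<forall>z\<in>Y. U \<inter> D z \<noteq> T z}"
      by (auto simp: \<Omega>'_def)
    show "finite ((Pow (D y) - {T y}) \<times> {U \<in> Pow \<Omega>'. \<forall>z\<in>Y. U \<inter> D z \<noteq> T z})"
      using Dy insert.prems(1) by (auto simp: \<Omega>'_def)
  qed
  also have "\<dots> = (2 ^ card (D y) - 1) * card {U \<in> Pow \<Omega>'. \<forall>z\<in>Y. U \<inter> D z \<noteq> T z}"
    using Dy by (simp add: card_cartesian_product card_Diff_singleton card_Pow)
  finally have "real (card {U \<in> Pow \<Omega>. \<forall>z\<in>insert y Y. U \<inter> D z \<noteq> T z})
      \<le> real ((2 ^ card (D y) - 1) * card {U \<in> Pow \<Omega>'. \<forall>z\<in>Y. U \<inter> D z \<noteq> T z})"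
    using of_nat_le_iff by blast
  also have "\<dots> = (2 ^ card (D y) - 1) * real (card {U \<in> Pow \<Omega>'. \<forall>z\<in>Y. U \<inter> D z \<noteq> T z})"
    by (simp add: of_nat_diff)
  also have "\<dots> \<le> (2 ^ card (D y) - 1) * (2 ^ card \<Omega>' * (1 - 1 / 2 ^ L) ^ card Y)"
    using IH by (intro mult_left_mono) auto
  also have "\<dots> = (1 - 1 / 2 ^ card (D y)) * (2 ^ card \<Omega> * (1 - 1 / 2 ^ L) ^ card Y)"
  proof -
    have "card \<Omega> = card (D y) + card \<Omega>'"
      using Dy insert.prems(1) by (simp add: \<Omega>'_def card_Diff_subset card_mono)
    then show ?thesis by (simp add: power_add field_simps)
  qed
  also have "\<dots> \<le> (1 - 1 / 2 ^ L) * (2 ^ card \<Omega> * (1 - 1 / 2 ^ L) ^ card Y)"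
    using Dy(3) by (intro mult_right_mono) (auto intro!: frac_le power_increasing)
  also have "\<dots> = 2 ^ card \<Omega> * (1 - 1 / 2 ^ L) ^ card (insert y Y)"
    using insert.hyps by (simp add: mult_ac)
  finally show ?case .
qed

text \<open>A saturated set is the union of the blocks it contains. Applied to orbits, this turns
  invariant structures into arbitrary sets of orbits.\<close>

lemma bij_betw_saturated_subsets:
  fixes Q :: "'x set set"
  assumes disj: "\<And>c d. c \<in> Q \<Longrightarrow> d \<in> Q \<Longrightarrow> c \<inter> d \<noteq> {} \<Longrightarrow> c = d" and ne: "{} \<notin> Q"
  shows "bij_betw (\<lambda>S. {c \<in> Q. c \<subseteq> S}) {S. S \<subseteq> \<Union>Q \<and> (\<forall>c\<in>Q. c \<subseteq> S \<or> c \<inter> S = {})} (Pow Q)"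
proof (rule bij_betwI[where g = Union])
  show "\<Union> \<in> Pow Q \<rightarrow> {S. S \<subseteq> \<Union>Q \<and> (\<forall>c\<in>Q. c \<subseteq> S \<or> c \<inter> S = {})}"
  proof (intro funcsetI CollectI conjI ballI)
    fix V c assume V: "V \<in> Pow Q" and c: "c \<in> Q"
    show "c \<subseteq> \<Union>V \<or> c \<inter> \<Union>V = {}"
    proof (rule disjCI)
      assume "c \<inter> \<Union>V \<noteq> {}"
      then obtain d where d: "d \<in> V" "c \<inter> d \<noteq> {}" by blast
      then have "c = d" using V by (intro disj[OF c]) auto
      then show "c \<subseteq> \<Union>V" using d by blast
    qed
  qed auto
  show "{c \<in> Q. c \<subseteq> \<Union>V} = V" if V: "V \<in> Pow Q" for V
  proof
    show "{c \<in> Q. c \<subseteq> \<Union>V} \<subseteq> V"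
    proof
      fix c assume "c \<in> {c \<in> Q. c \<subseteq> \<Union>V}"
      then have c: "c \<in> Q" "c \<subseteq> \<Union>V" by auto
      then obtain x where x: "x \<in> c" using ne by fastforce
      then obtain d where d: "d \<in> V" "x \<in> d" using c by blast
      have "c = d" by (rule disj) (use c d V x in auto)
      then show "c \<in> V" using d by simp
    qed
  qed (use V in auto)
  show "\<Union>{c \<in> Q. c \<subseteq> S} = S" if "S \<in> {S. S \<subseteq> \<Union>Q \<and> (\<forall>c\<in>Q. c \<subseteq> S \<or> c \<inter> S = {})}" for S
  proof
    show "S \<subseteq> \<Union>{c \<in> Q. c \<subseteq> S}"
    proof
      fix x assume x: "x \<in> S"
      have "S \<subseteq> \<Union>Q" using that by simp
      then obtain c where "c \<in> Q" "x \<in> c" using x by blast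
      then show "x \<in> \<Union>{c \<in> Q. c \<subseteq> S}" using that x by blast
    qed
  qed auto
qed auto

section \<open>Structures invariant under a permutation group\<close>

text \<open>A structure on \<open>B\<close> is encoded as a set of pairs \<open>(R, t)\<close>, so
  that all structures on \<open>B\<close> are the subsets of one finite set. Two types of points are
  allowed because placeholders are substituted later.\<close>

definition act :: "('a \<Rightarrow> 'b) \<Rightarrow> 'r \<times> 'a list \<Rightarrow> 'r \<times> 'b list" where
  "act f p = (fst p, map f (snd p))"

definition atoms :: "('r \<Rightarrow> nat) \<Rightarrow> 'a set \<Rightarrow> ('r \<times> 'a list) set" where
  "atoms ar B = {(R, t). length t = ar R \<and> set t \<subseteq> B}"

text \<open>Elements are total functions that are the identity outside \<open>A\<close>, so the same
  \<open>H\<close> acts on every \<open>{1..n}\<close> containing \<open>A\<close> without any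
  transport.\<close>

definition perm_group :: "'a set \<Rightarrow> ('a \<Rightarrow> 'a) set \<Rightarrow> bool" where
  "perm_group A H \<longleftrightarrow> id \<in> H \<and> (\<forall>h\<in>H. h permutes A \<and> inv h \<in> H \<and> (\<forall>g\<in>H. g \<circ> h \<in> H))"

definition orb :: "('a \<Rightarrow> 'a) set \<Rightarrow> 'r \<times> 'a list \<Rightarrow> ('r \<times> 'a list) set" where
  "orb H p = (\<lambda>h. act h p) ` H"

definition orbits :: "('r \<Rightarrow> nat) \<Rightarrow> ('a \<Rightarrow> 'a) set \<Rightarrow> 'a set \<Rightarrow> ('r \<times> 'a list) set set" where
  "orbits ar H B = orb H ` atoms ar B"

text \<open>Quantifying over all pairs instead of the atoms over \<open>B\<close> is harmless: if
  \<open>f\<close> permutes \<open>B\<close> and \<open>S\<close> consists of atoms over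
  \<open>B\<close>, the other pairs lie outside \<open>S\<close> together with their images.\<close>

definition preserves :: "('a \<Rightarrow> 'a) \<Rightarrow> ('r \<times> 'a list) set \<Rightarrow> bool" where
  "preserves f S \<longleftrightarrow> (\<forall>p. act f p \<in> S \<longleftrightarrow> p \<in> S)"

definition Inv :: "('r \<Rightarrow> nat) \<Rightarrow> ('a \<Rightarrow> 'a) set \<Rightarrow> 'a set \<Rightarrow> ('r \<times> 'a list) set set" where
  "Inv ar H B = {S. S \<subseteq> atoms ar B \<and> (\<forall>h\<in>H. preserves h S)}"

definition auts :: "'a set \<Rightarrow> ('r \<times> 'a list) set \<Rightarrow> ('a \<Rightarrow> 'a) set" where
  "auts B S = {f. f permutes B \<and> preserves f S}"

definition moved :: "('a \<Rightarrow> 'a) set \<Rightarrow> 'a set" where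
  "moved H = {x. \<exists>h\<in>H. h x \<noteq> x}"

lemma act_id [simp]: "act id p = p" "act (\<lambda>x. x) p = p"
  by (simp_all add: act_def)

lemma act_comp: "act (f \<circ> g) p = act f (act g p)"
  by (simp add: act_def)

lemma fst_act [simp]: "fst (act f p) = fst p"
  and snd_act [simp]: "snd (act f p) = map f (snd p)"
  by (simp_all add: act_def)

lemma mem_atoms: "p \<in> atoms ar B \<longleftrightarrow> length (snd p) = ar (fst p) \<and> set (snd p) \<subseteq> B"
  by (cases p) (simp add: atoms_def)

lemma atoms_mono: "A \<subseteq> B \<Longrightarrow> atoms ar A \<subseteq> atoms ar B"
  by (auto simp: atoms_def)

lemma permutes_mem_iff: "f permutes B \<Longrightarrow> f x \<in> B \<longleftrightarrow> x \<in> B"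
  by (simp add: permutes_in_image)

lemma act_mem_atoms [simp]: "f permutes B \<Longrightarrow> act f p \<in> atoms ar B \<longleftrightarrow> p \<in> atoms ar B"
  by (auto simp: mem_atoms permutes_mem_iff subset_iff)

lemma act_inv: "f permutes B \<Longrightarrow> act (inv f) (act f p) = p" "f permutes B \<Longrightarrow> act f (act (inv f) p) = p"
  by (simp_all flip: act_comp add: permutes_inv_o)

lemma act_cong: "(\<And>x. x \<in> set (snd p) \<Longrightarrow> f x = g x) \<Longrightarrow> act f p = act g p"
  by (auto simp: act_def)

lemma card_atoms:
  fixes ar :: "'r::finite \<Rightarrow> nat"
  assumes "finite B"
  shows "finite (atoms ar B)" "card (atoms ar B) = (\<Sum>R\<in>UNIV. card B ^ ar R)"
proof -
  have eq: "atoms ar B = (SIGMA R:UNIV. {t. set t \<subseteq> B \<and> length t = ar R})"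
    by (auto simp: atoms_def)
  have fin: "finite {t. set t \<subseteq> B \<and> length t = k}" for k
    using finite_lists_length_eq[OF assms] .
  show "finite (atoms ar B)" unfolding eq using fin by (intro finite_SigmaI) auto
  show "card (atoms ar B) = (\<Sum>R\<in>UNIV. card B ^ ar R)"
    unfolding eq using fin by (simp add: card_lists_length_eq[OF assms])
qed

lemma perm_groupD:
  assumes "perm_group A H"
  shows "id \<in> H" "h \<in> H \<Longrightarrow> h permutes A" "h \<in> H \<Longrightarrow> inv h \<in> H"
    "g \<in> H \<Longrightarrow> h \<in> H \<Longrightarrow> g \<circ> h \<in> H"
  using assms by (auto simp: perm_group_def)

lemma perm_group_finite: "perm_group A H \<Longrightarrow> finite A \<Longrightarrow> finite H"
  by (rule finite_subset[of _ "{h. h permutes A}"]) (auto simp: perm_group_def finite_permutations)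

lemma perm_group_trivial: "perm_group A {id}"
  by (simp add: perm_group_def permutes_id)

lemma preservesD: "preserves f S \<Longrightarrow> act f p \<in> S \<longleftrightarrow> p \<in> S"
  unfolding preserves_def by blast

lemma preserves_id [simp]: "preserves id S"
  by (simp add: preserves_def)

lemma preserves_comp: "preserves f S \<Longrightarrow> preserves g S \<Longrightarrow> preserves (f \<circ> g) S"
  unfolding preserves_def act_comp by blast

lemma preserves_inv: "f permutes B \<Longrightarrow> preserves f S \<Longrightarrow> preserves (inv f) S"
  unfolding preserves_def by (metis act_inv(2))

lemma perm_group_auts: "perm_group B (auts B S)"
  by (auto simp: perm_group_def auts_def permutes_id preserves_comp permutes_compose
      permutes_inv intro: preserves_inv)

lemma perm_group_moved_subset: "perm_group A H \<Longrightarrow> moved H \<subseteq> A"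
  by (auto simp: moved_def perm_group_def permutes_def)

text \<open>The group, viewed on the points it moves, no longer remembers the universe; this is why
  one finite list of groups serves all \<open>n\<close>.\<close>

lemma perm_group_on_moved:
  assumes "perm_group B H"
  shows "perm_group (moved H) H"
proof -
  have "h permutes moved H" if h: "h \<in> H" for h
  proof -
    have b: "bij h" using perm_groupD(2)[OF assms h] permutes_bij by blast
    have "h x = x" if "x \<notin> moved H" for x using that h by (auto simp: moved_def)
    then show ?thesis using b by (simp add: permutes_def bij_iff)
  qed
  then show ?thesis using assms by (simp add: perm_group_def)
qed

section \<open>Orbits of atoms as independent binary choices\<close>

locale perm_action =
  fixes ar :: "'r::finite \<Rightarrow> nat" and A B :: "'a set" and H :: "('a \<Rightarrow> 'a) set"
  assumes fin: "finite B" and sub: "A \<subseteq> B" and grp: "perm_group A H"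
begin

lemma finH: "finite H" using perm_group_finite[OF grp] fin sub finite_subset by blast

lemma permutes_B: "h \<in> H \<Longrightarrow> h permutes B"
  using perm_groupD(2)[OF grp] sub permutes_subset by blast

lemma self_mem_orb: "p \<in> orb H p"
  unfolding orb_def using perm_groupD(1)[OF grp] by force

lemma orb_act: "h \<in> H \<Longrightarrow> orb H (act h p) = orb H p"
proof -
  have 1: "orb H (act h p) \<subseteq> orb H p" if "h \<in> H" for h p
    using perm_groupD(4)[OF grp _ that] by (auto simp: orb_def act_comp[symmetric])
  assume h: "h \<in> H"
  have "orb H (act (inv h) (act h p)) \<subseteq> orb H (act h p)"
    using 1 perm_groupD(3)[OF grp h] by blast
  then show ?thesis using 1[OF h, of p] unfolding act_inv(1)[OF permutes_B[OF h]] by blast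
qed

lemma orb_eq: "q \<in> orb H p \<Longrightarrow> orb H q = orb H p"
  by (metis (no_types, lifting) imageE orb_act orb_def)

lemma orb_subset_atoms: "p \<in> atoms ar B \<Longrightarrow> orb H p \<subseteq> atoms ar B"
  unfolding orb_def using permutes_B by auto

lemma finite_orbits: "finite (orbits ar H B)"
  unfolding orbits_def using card_atoms(1)[OF fin] by (rule finite_imageI)

lemma Union_orbits: "\<Union>(orbits ar H B) = atoms ar B"
  unfolding orbits_def using orb_subset_atoms self_mem_orb by blast

lemma orb_subset_invariant: "S \<in> Inv ar H B \<Longrightarrow> orb H p \<subseteq> S \<longleftrightarrow> p \<in> S"
  using self_mem_orb[of p] unfolding Inv_def orb_def preserves_def by blast

lemma bij_betw_Inv: "bij_betw (\<lambda>S. {c \<in> orbits ar H B. c \<subseteq> S}) (Inv ar H B) (Pow (orbits ar H B))"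
proof -
  have "Inv ar H B = {S. S \<subseteq> \<Union>(orbits ar H B) \<and> (\<forall>c\<in>orbits ar H B. c \<subseteq> S \<or> c \<inter> S = {})}"
  proof (rule Set.set_eqI)
    fix S
    have "(\<forall>h\<in>H. preserves h S) \<longleftrightarrow> (\<forall>p\<in>atoms ar B. orb H p \<subseteq> S \<or> orb H p \<inter> S = {})"
      if S: "S \<subseteq> atoms ar B"
    proof
      assume "\<forall>h\<in>H. preserves h S"
      then show "\<forall>p\<in>atoms ar B. orb H p \<subseteq> S \<or> orb H p \<inter> S = {}"
        unfolding orb_def preserves_def by blast
    next
      assume *: "\<forall>p\<in>atoms ar B. orb H p \<subseteq> S \<or> orb H p \<inter> S = {}"
      have "act h p \<in> S \<longleftrightarrow> p \<in> S" if h: "h \<in> H" for h p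
      proof (cases "p \<in> atoms ar B")
        case True
        have "act h p \<in> orb H p" using h by (auto simp: orb_def)
        then show ?thesis using * True self_mem_orb by blast
      next
        case False
        then show ?thesis using S act_mem_atoms[OF permutes_B[OF h]] by blast
      qed
      then show "\<forall>h\<in>H. preserves h S" by (simp add: preserves_def)
    qed
    then show "S \<in> Inv ar H B \<longleftrightarrow>
        S \<in> {S. S \<subseteq> \<Union>(orbits ar H B) \<and> (\<forall>c\<in>orbits ar H B. c \<subseteq> S \<or> c \<inter> S = {})}"
      by (simp add: Inv_def Union_orbits) (auto simp: orbits_def)
  qed
  moreover have "bij_betw (\<lambda>S. {c \<in> orbits ar H B. c \<subseteq> S})
    {S. S \<subseteq> \<Union>(orbits ar H B) \<and> (\<forall>c\<in>orbits ar H B. c \<subseteq> S \<or> c \<inter> S = {})} (Pow (orbits ar H B))"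
  proof (rule bij_betw_saturated_subsets)
    show "c = d" if "c \<in> orbits ar H B" "d \<in> orbits ar H B" "c \<inter> d \<noteq> {}" for c d
      using that orb_eq unfolding orbits_def by blast
    show "{} \<notin> orbits ar H B" using self_mem_orb unfolding orbits_def by blast
  qed
  ultimately show ?thesis by simp
qed

lemma finite_Inv: "finite (Inv ar H B)"
  using bij_betw_finite[OF bij_betw_Inv] finite_orbits by simp

lemma card_Inv: "card (Inv ar H B) = 2 ^ card (orbits ar H B)"
  using bij_betw_same_card[OF bij_betw_Inv] by (simp add: card_Pow finite_orbits)

text \<open>Counting pairs \<open>(h, q)\<close> with \<open>q\<close> in a fixed orbit and \<open>act h q = q\<close> gives \<open>card H\<close>.\<close>

lemma card_orbits_burnside:
  "card (orbits ar H B) * card H = (\<Sum>h\<in>H. \<Sum>R\<in>UNIV. card {x \<in> B. h x = x} ^ ar R)"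
proof -
  have finat: "finite (atoms ar B)" using card_atoms(1)[OF fin] .
  \<comment> \<open>Composition with \<open>g\<close> carries the stabilizer of \<open>q\<close>
    onto the coset of the elements sending \<open>p\<close> to \<open>q\<close>; these cosets
    partition \<open>H\<close> as \<open>q\<close> runs through the orbit.\<close>
  have stab: "card {h \<in> H. act h q = q} = card {h \<in> H. act h p = q}" if q: "q \<in> orb H p" for p q
  proof -
    obtain g where g: "g \<in> H" "q = act g p" using q by (auto simp: orb_def)
    have gb: "g permutes B" using permutes_B g by blast
    have "bij_betw (\<lambda>h. h \<circ> g) {h \<in> H. act h q = q} {h \<in> H. act h p = q}"
    proof (rule bij_betwI[where g = "\<lambda>h. h \<circ> inv g"])
      show "(\<lambda>h. h \<circ> g) \<in> {h \<in> H. act h q = q} \<rightarrow> {h \<in> H. act h p = q}"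
        using g perm_groupD(4)[OF grp] by (auto simp: act_comp)
      show "(\<lambda>h. h \<circ> inv g) \<in> {h \<in> H. act h p = q} \<rightarrow> {h \<in> H. act h q = q}"
        using g perm_groupD(3,4)[OF grp] by (auto simp: act_comp act_inv(1)[OF gb])
    qed (use gb in \<open>simp_all add: o_assoc[symmetric] permutes_inv_o\<close>)
    then show ?thesis by (rule bij_betw_same_card)
  qed
  have orb_sum: "(\<Sum>q\<in>c. card {h \<in> H. act h q = q}) = card H" if c: "c \<in> orbits ar H B" for c
  proof -
    obtain p where p: "c = orb H p" using c by (auto simp: orbits_def)
    have "(\<Sum>q\<in>c. card {h \<in> H. act h q = q}) = (\<Sum>q\<in>c. card {h \<in> H. act h p = q})"
      by (rule sum.cong[OF refl]) (use stab p in blast)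
    also have "\<dots> = (\<Sum>q\<in>c. \<Sum>h\<in>{h \<in> H. act h p = q}. 1)" by simp
    also have "\<dots> = (\<Sum>h\<in>H. 1)"
      by (rule sum.group) (use finH p in \<open>auto simp: orb_def\<close>)
    finally show ?thesis by simp
  qed
  have "(\<Sum>h\<in>H. card {p \<in> atoms ar B. act h p = p}) = (\<Sum>h\<in>H. \<Sum>p\<in>{p \<in> atoms ar B. act h p = p}. 1)"
    by simp
  also have "\<dots> = (\<Sum>p\<in>atoms ar B. \<Sum>h\<in>{h \<in> H. act h p = p}. 1)"
    by (rule sum.swap_restrict[OF finH finat])
  also have "\<dots> = (\<Sum>p\<in>\<Union>(orbits ar H B). card {h \<in> H. act h p = p})"
    by (simp add: Union_orbits)
  also have "\<dots> = (\<Sum>c\<in>orbits ar H B. \<Sum>p\<in>c. card {h \<in> H. act h p = p})"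
  proof (subst sum.Union_disjoint)
    show "\<forall>c\<in>orbits ar H B. finite c" using finH by (auto simp: orbits_def orb_def)
    show "\<forall>c\<in>orbits ar H B. \<forall>d\<in>orbits ar H B. c \<noteq> d \<longrightarrow> c \<inter> d = {}"
      using orb_eq unfolding orbits_def by blast
  qed simp
  also have "\<dots> = card (orbits ar H B) * card H" by (simp add: orb_sum)
  finally have "card (orbits ar H B) * card H = (\<Sum>h\<in>H. card {p \<in> atoms ar B. act h p = p})" by simp
  \<comment> \<open>A tuple is fixed exactly when all its entries are, which turns the number of
    fixed atoms into powers of the number of fixed points.\<close>
  moreover have "{p \<in> atoms ar B. act h p = p} = atoms ar {x \<in> B. h x = x}" for h
  proof -
    have "map h t = t \<longleftrightarrow> (\<forall>x\<in>set t. h x = x)" for t by (induction t) auto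
    then show ?thesis by (auto simp: atoms_def act_def)
  qed
  ultimately show ?thesis using fin by (simp add: card_atoms)
qed

lemma perm_action_A: "perm_action A A H"
  using fin sub grp finite_subset by unfold_locales auto

lemma trace_Inv: "S \<in> Inv ar H B \<Longrightarrow> S \<inter> atoms ar A \<in> Inv ar H A"
  using perm_groupD(2)[OF grp] by (auto simp: Inv_def preserves_def)

text \<open>Orbits inside \<open>A\<close> and the remaining orbits are chosen independently, so the
  trace on \<open>A\<close> is uniform on \<open>Inv ar H A\<close>.\<close>

lemma card_Inv_with_trace:
  assumes Q: "Q \<subseteq> Inv ar H A"
  shows "real (card {S \<in> Inv ar H B. S \<inter> atoms ar A \<in> Q}) =
    real (card Q) / 2 ^ card (orbits ar H A) * 2 ^ card (orbits ar H B)"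
proof -
  interpret A: perm_action ar A A H by (rule perm_action_A)
  define Z where "Z = {S \<in> Inv ar H B. S \<inter> atoms ar A = {}}"
  have bij: "bij_betw (\<lambda>S. (S \<inter> atoms ar A, S - atoms ar A)) {S \<in> Inv ar H B. S \<inter> atoms ar A \<in> Q} (Q \<times> Z)"
    if Q: "Q \<subseteq> Inv ar H A" for Q
  proof (rule bij_betwI[where g = "\<lambda>(N, S). N \<union> S"])
    have "S - atoms ar A \<in> Inv ar H B" if "S \<in> Inv ar H B" for S
      using that perm_groupD(2)[OF grp] by (auto simp: Inv_def preserves_def)
    then show "(\<lambda>S. (S \<inter> atoms ar A, S - atoms ar A)) \<in> {S \<in> Inv ar H B. S \<inter> atoms ar A \<in> Q} \<rightarrow> Q \<times> Z"
      by (auto simp: Z_def)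
    have 1: "N \<union> S \<in> Inv ar H B \<and> (N \<union> S) \<inter> atoms ar A = N \<and> (N \<union> S) - atoms ar A = S"
      if "N \<in> Q" "S \<in> Z" for N S
      using that Q atoms_mono[OF sub, of ar] by (simp add: Z_def Inv_def preserves_def) blast
    then show "(\<lambda>(N, S). N \<union> S) \<in> Q \<times> Z \<rightarrow> {S \<in> Inv ar H B. S \<inter> atoms ar A \<in> Q}" by auto
    show "((case x of (N, S) \<Rightarrow> N \<union> S) \<inter> atoms ar A, (case x of (N, S) \<Rightarrow> N \<union> S) - atoms ar A) = x"
      if "x \<in> Q \<times> Z" for x using that 1 by auto
  qed auto
  have Qc: "card {S \<in> Inv ar H B. S \<inter> atoms ar A \<in> Q} = card Q * card Z" if "Q \<subseteq> Inv ar H A" for Q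
    using bij_betw_same_card[OF bij[OF that]] by (simp add: card_cartesian_product)
  \<comment> \<open>Letting \<open>Q\<close> consist of all traces determines \<open>card Z\<close>
    without counting the remaining orbits.\<close>
  have "{S \<in> Inv ar H B. S \<inter> atoms ar A \<in> Inv ar H A} = Inv ar H B" using trace_Inv by blast
  then have "2 ^ card (orbits ar H B) = (2::nat) ^ card (orbits ar H A) * card Z"
    using Qc[of "Inv ar H A"] by (simp add: card_Inv A.card_Inv)
  then have "(2::real) ^ card (orbits ar H B) = 2 ^ card (orbits ar H A) * real (card Z)"
    by (metis of_nat_mult of_nat_numeral of_nat_power)
  then show ?thesis using Qc[OF Q] by simp
qed

text \<open>Every orbit \<open>c\<close> in \<open>C\<close> is tied by \<open>f\<close> to a different orbit, so that the invariance under
  \<open>f\<close> at least halves the number of free binary choices made on \<open>C\<close>.\<close>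

lemma card_Inv_preserved:
  assumes f: "f permutes B" and C: "C \<subseteq> {p \<in> atoms ar B. act f p \<notin> orb H p}"
  shows "real (card {S \<in> Inv ar H B. preserves f S})
    \<le> 2 ^ card (orbits ar H B) * (1 / sqrt 2) ^ card (orb H ` C)"
proof -
  let ?F = "{S \<in> Inv ar H B. preserves f S}"
  let ?g = "\<lambda>S. {c \<in> orbits ar H B. c \<subseteq> S}"
  have inj: "inj_on ?g ?F" using bij_betw_Inv by (auto simp: bij_betw_def inj_on_def)
  have "real (card (?g ` ?F)) \<le> 2 ^ card (orbits ar H B) * (1 / sqrt 2) ^ card (orb H ` C)"
  proof (rule card_subsets_with_twins[OF finite_orbits])
    show "orb H ` C \<subseteq> orbits ar H B" using C by (auto simp: orbits_def)
    fix c assume "c \<in> orb H ` C"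
    then obtain p where p: "c = orb H p" "p \<in> atoms ar B" "act f p \<notin> orb H p" using C by blast
    have "orb H (act f p) \<noteq> c" using p self_mem_orb by blast
    moreover have "orb H (act f p) \<in> orbits ar H B" using f p by (auto simp: orbits_def)
    moreover have "c \<in> U \<longleftrightarrow> orb H (act f p) \<in> U" if U: "U \<in> ?g ` ?F" for U
    proof -
      obtain S where S: "U = {c \<in> orbits ar H B. c \<subseteq> S}" "S \<in> Inv ar H B" "preserves f S"
        using U by blast
      have "c \<in> U \<longleftrightarrow> p \<in> S" using S p orb_subset_invariant by (auto simp: orbits_def)
      moreover have "orb H (act f p) \<in> U \<longleftrightarrow> act f p \<in> S"
        using S orb_subset_invariant[of S] \<open>orb H (act f p) \<in> orbits ar H B\<close> by auto
      ultimately show ?thesis using S(3) unfolding preserves_def by blast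
    qed
    ultimately show "\<exists>d\<in>orbits ar H B. d \<noteq> c \<and> (\<forall>U\<in>?g ` ?F. c \<in> U \<longleftrightarrow> d \<in> U)" by blast
  qed auto
  then show ?thesis using card_image[OF inj] by simp
qed

end

section \<open>Exceptional invariant structures\<close>

text \<open>If \<open>h\<close> agrees on every tuple over \<open>A\<close> of length less than \<open>k\<close> with some element of \<open>H\<close>, then
  invariance under \<open>H\<close> forces invariance under \<open>h\<close> of everything except the atoms lying inside \<open>A\<close>.\<close>

definition forced :: "nat \<Rightarrow> 'a set \<Rightarrow> ('a \<Rightarrow> 'a) set \<Rightarrow> ('a \<Rightarrow> 'a) \<Rightarrow> bool" where
  "forced k A H h \<longleftrightarrow> (\<forall>t. set t \<subseteq> A \<and> length t < k \<longrightarrow> (\<exists>g\<in>H. map h t = map g t))"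

text \<open>\<open>None\<close> is a placeholder for the point to be added, so that a type over
  \<open>Z\<close> can be described without mentioning its realization.\<close>

definition subst_new :: "'a \<Rightarrow> 'a option \<Rightarrow> 'a" where
  "subst_new y = case_option y id"

definition new_atoms :: "('r \<Rightarrow> nat) \<Rightarrow> 'a set \<Rightarrow> ('r \<times> 'a option list) set" where
  "new_atoms ar Z = {p \<in> atoms ar (insert None (Some ` Z)). None \<in> set (snd p)}"

lemma subst_new_simps [simp]: "subst_new y None = y" "subst_new y (Some x) = x"
  by (simp_all add: subst_new_def)

text \<open>A set \<open>T\<close> of atoms over \<open>Z\<close> and the placeholder \<open>None\<close>, all of which involve \<open>None\<close>, is
  a possible quantifier-free type over \<open>Z\<close> of a further element.\<close>

definition extendable ::
    "('r \<Rightarrow> nat) \<Rightarrow> 'a set \<Rightarrow> ('a \<Rightarrow> 'a) set \<Rightarrow> nat \<Rightarrow> 'a set \<Rightarrow> ('r \<times> 'a list) set \<Rightarrow> bool" where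
  "extendable ar A H k B S \<longleftrightarrow>
    (\<forall>xs T. xs \<subseteq> B - A \<and> card xs < k \<and> T \<subseteq> new_atoms ar (A \<union> xs) \<and>
        (\<forall>h\<in>H. \<forall>p\<in>new_atoms ar (A \<union> xs). act (map_option h) p \<in> T \<longleftrightarrow> p \<in> T) \<longrightarrow>
      (\<exists>y\<in>B - A - xs. \<forall>p\<in>new_atoms ar (A \<union> xs). act (subst_new y) p \<in> S \<longleftrightarrow> p \<in> T))"

lemma subst_new_atoms:
  assumes p: "p \<in> new_atoms ar Z"
  shows "act (subst_new y) p \<in> atoms ar (insert y Z)" "y \<in> set (snd (act (subst_new y) p))"
proof -
  have "set (snd p) \<subseteq> insert None (Some ` Z)" "None \<in> set (snd p)" "length (snd p) = ar (fst p)"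
    using p by (simp_all add: new_atoms_def mem_atoms)
  moreover from this(1) have "subst_new y ` set (snd p) \<subseteq> subst_new y ` insert None (Some ` Z)"
    by (rule image_mono)
  moreover have "subst_new y ` insert None (Some ` Z) = insert y Z"
    by (simp add: image_image)
  ultimately show "act (subst_new y) p \<in> atoms ar (insert y Z)" "y \<in> set (snd (act (subst_new y) p))"
    by (simp_all add: mem_atoms) (metis image_eqI subst_new_simps(1))
qed

section \<open>Union bounds for the three kinds of exceptional structures\<close>

lemma card_permutations_moving:
  assumes "finite B" "A \<subseteq> B"
  shows "card {f. f permutes B \<and> card {x \<in> B - A. f x \<noteq> x} = s} \<le> (card B * card B) ^ (card A + s)"
proof -
  define L where "L = {l. set l \<subseteq> B \<times> B \<and> length l = card A + s}"
  \<comment> \<open>The permutation is determined by its values on \<open>A\<close> and on the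
    \<open>s\<close> points it moves outside \<open>A\<close>. \<open>F\<close> decodes a list of
    such argument-value pairs, extended by the identity.\<close>
  define F where "F = (\<lambda>(l :: ('a \<times> 'a) list) x. case map_of l x of None \<Rightarrow> x | Some y \<Rightarrow> y)"
  have finL: "finite L" "card L = (card B * card B) ^ (card A + s)"
    using finite_lists_length_eq[of "B \<times> B" "card A + s"] card_lists_length_eq[of "B \<times> B" "card A + s"] assms
    by (simp_all add: L_def card_cartesian_product)
  have "{f. f permutes B \<and> card {x \<in> B - A. f x \<noteq> x} = s} \<subseteq> F ` L"
  proof clarify
    fix f assume f: "f permutes B" and s: "s = card {x \<in> B - A. f x \<noteq> x}"
    define M where "M = A \<union> {x \<in> B - A. f x \<noteq> x}"
    have M: "finite M" "card M = card A + s" "M \<subseteq> B"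
      using assms finite_subset[of A B] unfolding M_def s by (auto intro!: card_Un_disjoint)
    obtain m where m: "set m = M" "distinct m" using finite_distinct_list[OF M(1)] by blast
    let ?l = "map (\<lambda>x. (x, f x)) m"
    have "length m = card A + s" using m M distinct_card by fastforce
    moreover have "f x \<in> B" if "x \<in> B" for x using f that by (simp add: permutes_in_image)
    ultimately have "?l \<in> L" using m M by (auto simp: L_def)
    moreover have "F ?l = f"
    proof
      fix x
      have "f x = x" if "x \<notin> M" using that f by (cases "x \<in> B") (auto simp: M_def permutes_def)
      then show "F ?l x = f x"
        using m(1) by (auto simp: F_def map_of_map_restrict restrict_map_def)
    qed
    ultimately show "f \<in> F ` L" by (metis imageI)
  qed
  then have "card {f. f permutes B \<and> card {x \<in> B - A. f x \<noteq> x} = s} \<le> card (F ` L)"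
    by (rule card_mono[OF finite_imageI[OF finL(1)]])
  also have "\<dots> \<le> card L" by (rule card_image_le[OF finL(1)])
  finally show ?thesis unfolding finL(2) .
qed

lemma card_new_atoms:
  fixes ar :: "'r::finite \<Rightarrow> nat"
  assumes "finite Z" "card Z \<le> m"
  shows "finite (new_atoms ar Z)" "card (new_atoms ar Z) \<le> (\<Sum>R\<in>UNIV. Suc m ^ ar R)"
proof -
  have fin: "finite (insert None (Some ` Z))" using assms by simp
  have c: "card (insert None (Some ` Z)) = Suc (card Z)"
    using assms by (subst card_insert_disjoint) (auto simp: card_image)
  have sub: "new_atoms ar Z \<subseteq> atoms ar (insert None (Some ` Z))" by (auto simp: new_atoms_def)
  show "finite (new_atoms ar Z)" using finite_subset[OF sub card_atoms(1)[OF fin]] .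
  have "card (new_atoms ar Z) \<le> card (atoms ar (insert None (Some ` Z)))"
    by (rule card_mono[OF card_atoms(1)[OF fin] sub])
  also have "\<dots> = (\<Sum>R\<in>UNIV. Suc (card Z) ^ ar R)" unfolding card_atoms(2)[OF fin] c ..
  also have "\<dots> \<le> (\<Sum>R\<in>UNIV. Suc m ^ ar R)" using assms by (intro sum_mono power_mono) auto
  finally show "card (new_atoms ar Z) \<le> (\<Sum>R\<in>UNIV. Suc m ^ ar R)" .
qed

context perm_action
begin

lemma fixes_outside: "h \<in> H \<Longrightarrow> x \<notin> A \<Longrightarrow> h x = x"
  using perm_groupD(2)[OF grp] by (auto simp: permutes_def)

lemma finite_A: "finite A"
  using sub fin finite_subset by blast

text \<open>An atom \<open>(R, x # t)\<close> with all entries outside \<open>A\<close> is its own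
  orbit, and \<open>f\<close> moves it as soon as it moves \<open>x\<close>. Each moved
  \<open>x\<close> thus contributes \<open>card (B - A) ^ (ar R - 1)\<close> orbits that are tied to
  others.\<close>

lemma card_Inv_preserved_moving:
  assumes f: "f permutes B" and R: "0 < ar R"
  shows "real (card {S \<in> Inv ar H B. preserves f S}) \<le> 2 ^ card (orbits ar H B) *
    (1 / sqrt 2) ^ (card {x \<in> B - A. f x \<noteq> x} * card (B - A) ^ (ar R - 1))"
proof -
  define C where "C = {x \<in> B - A. f x \<noteq> x} \<times> {t. set t \<subseteq> B - A \<and> length t = ar R - 1}"
  define c where "c = (\<lambda>(x :: 'a, t). (R, x # t))"
  have outside: "orb H p = {p}" if "p \<in> c ` C" for p
  proof -
    have "set (snd p) \<subseteq> B - A" using that by (auto simp: c_def C_def)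
    then have "act h p = p" if "h \<in> H" for h
      using fixes_outside[OF that] by (auto simp: prod_eq_iff intro!: map_idI)
    then show ?thesis using self_mem_orb[of p] by (auto simp: orb_def)
  qed
  have "card (orb H ` c ` C) = card (c ` C)"
    by (rule card_image) (use outside in \<open>auto simp: inj_on_def\<close>)
  also have "\<dots> = card C"
    by (rule card_image) (auto simp: inj_on_def c_def)
  also have "\<dots> = card {x \<in> B - A. f x \<noteq> x} * card (B - A) ^ (ar R - 1)"
    using card_lists_length_eq[of "B - A"] fin by (simp add: C_def card_cartesian_product)
  finally have *: "card (orb H ` c ` C) = card {x \<in> B - A. f x \<noteq> x} * card (B - A) ^ (ar R - 1)" .
  have "c ` C \<subseteq> {p \<in> atoms ar B. act f p \<notin> orb H p}"
  proof
    fix p assume p: "p \<in> c ` C"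
    then show "p \<in> {p \<in> atoms ar B. act f p \<notin> orb H p}"
      unfolding mem_Collect_eq outside[OF p] using R by (auto simp: c_def C_def mem_atoms act_def)
  qed
  from card_Inv_preserved[OF f this] show ?thesis unfolding * .
qed

text \<open>A tuple \<open>t\<close> witnessing that \<open>h\<close> is not forced is padded by
  points outside \<open>A\<close>. As \<open>H\<close> fixes the padding, different paddings lie in
  different orbits, and no element of \<open>H\<close> maps the padded tuple as \<open>h\<close>
  does. Since \<open>length t < ar R\<close>, at least one coordinate is free.\<close>

lemma card_Inv_preserved_unforced:
  assumes h: "h permutes A" and "\<not> forced (ar R) A H h"
  shows "real (card {S \<in> Inv ar H B. preserves h S}) \<le>
    2 ^ card (orbits ar H B) * (1 / sqrt 2) ^ card (B - A)"
proof -
  obtain t where t: "set t \<subseteq> A" "length t < ar R" "\<And>g. g \<in> H \<Longrightarrow> map h t \<noteq> map g t"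
    using assms by (auto simp: forced_def)
  define C where "C = {ys. set ys \<subseteq> B - A \<and> length ys = ar R - length t}"
  define c where "c = (\<lambda>ys. (R, t @ ys))"
  have "inj_on (\<lambda>ys. orb H (c ys)) C"
  proof (rule inj_onI)
    fix ys zs assume *: "ys \<in> C" "zs \<in> C" "orb H (c ys) = orb H (c zs)"
    then have "c zs \<in> orb H (c ys)" using self_mem_orb by metis
    then obtain g where g: "g \<in> H" "t @ zs = map g t @ map g ys"
      by (auto simp: orb_def c_def act_def)
    then have "zs = map g ys" by simp
    also have "\<dots> = ys" using * fixes_outside[OF g(1)] by (intro map_idI) (auto simp: C_def)
    finally show "ys = zs" ..
  qed
  then have "card ((\<lambda>ys. orb H (c ys)) ` C) = card C" by (rule card_image)
  also have "\<dots> = card (B - A) ^ (ar R - length t)"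
    using card_lists_length_eq[of "B - A"] fin by (simp add: C_def)
  finally have *: "card (orb H ` c ` C) = card (B - A) ^ (ar R - length t)" by (simp add: image_image)
  have "c ` C \<subseteq> {p \<in> atoms ar B. act h p \<notin> orb H p}"
  proof
    fix p assume "p \<in> c ` C"
    then obtain ys where ys: "p = (R, t @ ys)" "set ys \<subseteq> B - A" "length ys = ar R - length t"
      by (auto simp: c_def C_def)
    have "act h p \<noteq> act g p" if "g \<in> H" for g using t(3)[OF that] by (auto simp: ys(1) act_def)
    then have "act h p \<notin> orb H p" by (auto simp: orb_def)
    moreover have "p \<in> atoms ar B" using ys t(1,2) sub by (auto simp: mem_atoms)
    ultimately show "p \<in> {p \<in> atoms ar B. act h p \<notin> orb H p}" by blast
  qed
  from card_Inv_preserved[OF permutes_subset[OF h sub] this]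
  have "real (card {S \<in> Inv ar H B. preserves h S}) \<le>
    2 ^ card (orbits ar H B) * (1 / sqrt 2) ^ (card (B - A) ^ (ar R - length t))" unfolding * .
  also have "\<dots> \<le> 2 ^ card (orbits ar H B) * (1 / sqrt 2) ^ card (B - A)"
  proof (intro mult_left_mono power_decreasing)
    show "card (B - A) \<le> card (B - A) ^ (ar R - length t)"
      using t(2) by (cases "card (B - A) = 0") (simp_all add: self_le_power Suc_le_eq)
  qed auto
  finally show ?thesis .
qed

text \<open>Union bound over the permutations moving exactly \<open>s \<ge> k\<close> points outside
  \<open>A\<close>. With \<open>n = card B\<close> there are at most
  \<open>n ^ (2 * (card A + s))\<close> of them, and their contributions add up to at most
  \<open>n ^ (2 * card A) * u ^ s\<close>: the square in \<open>u\<close> pays for the choice of a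
  moved point and its image. As \<open>u \<le> 1\<close>, each \<open>s\<close> may be replaced by
  \<open>k\<close>, and \<open>n + 1\<close> bounds the number of values of
  \<open>s\<close>.\<close>

lemma card_Inv_moving:
  assumes R: "0 < ar R" and u: "u = (real (card B))\<^sup>2 * (1 / sqrt 2) ^ (card (B - A) ^ (ar R - 1))"
    and u1: "u \<le> 1"
  shows "real (card {S \<in> Inv ar H B. \<exists>f\<in>auts B S. k \<le> card {x \<in> B - A. f x \<noteq> x}}) \<le>
    2 ^ card (orbits ar H B) * (real (card B) ^ (2 * card A) * (real (card B) + 1) * u ^ k)"
proof -
  let ?E = "2 ^ card (orbits ar H B) :: real" and ?n = "real (card B)" and ?d = "card (B - A) ^ (ar R - 1)"
  let ?P = "\<lambda>s. {f. f permutes B \<and> card {x \<in> B - A. f x \<noteq> x} = s}"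
  have finP: "finite (?P s)" for s using finite_permutations[OF fin] by simp
  have u0: "0 \<le> u" by (simp add: u)
  have "{S \<in> Inv ar H B. \<exists>f\<in>auts B S. k \<le> card {x \<in> B - A. f x \<noteq> x}}
    \<subseteq> (\<Union>s\<in>{k..card B}. \<Union>f\<in>?P s. {S \<in> Inv ar H B. preserves f S})" (is "?L \<subseteq> ?R")
  proof
    fix S assume "S \<in> ?L"
    then obtain f where f: "S \<in> Inv ar H B" "f permutes B" "preserves f S" "k \<le> card {x \<in> B - A. f x \<noteq> x}"
      by (auto simp: auts_def)
    moreover have "card {x \<in> B - A. f x \<noteq> x} \<le> card B" using fin by (intro card_mono) auto
    ultimately show "S \<in> ?R" by auto
  qed
  then have "card ?L \<le> card ?R" using finP finite_Inv by (intro card_mono) auto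
  also have "\<dots> \<le> (\<Sum>s\<in>{k..card B}. card (\<Union>f\<in>?P s. {S \<in> Inv ar H B. preserves f S}))"
    by (rule card_UN_le) simp
  also have "\<dots> \<le> (\<Sum>s\<in>{k..card B}. \<Sum>f\<in>?P s. card {S \<in> Inv ar H B. preserves f S})"
    by (intro sum_mono card_UN_le finP)
  finally have "real (card ?L) \<le> real (\<Sum>s\<in>{k..card B}. \<Sum>f\<in>?P s. card {S \<in> Inv ar H B. preserves f S})"
    by (simp only: of_nat_le_iff)
  also have "\<dots> = (\<Sum>s\<in>{k..card B}. \<Sum>f\<in>?P s. real (card {S \<in> Inv ar H B. preserves f S}))"
    by simp
  also have "\<dots> \<le> (\<Sum>s\<in>{k..card B}. \<Sum>f\<in>?P s. ?E * (1 / sqrt 2) ^ (s * ?d))"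
    using card_Inv_preserved_moving[where R = R] R by (intro sum_mono) auto
  also have "\<dots> = (\<Sum>s\<in>{k..card B}. ?E * (real (card (?P s)) * (1 / sqrt 2) ^ (s * ?d)))"
    by (simp add: mult_ac)
  also have "\<dots> \<le> (\<Sum>s\<in>{k..card B}. ?E * (?n ^ (2 * card A) * u ^ k))"
  proof (rule sum_mono, rule mult_left_mono)
    fix s assume s: "s \<in> {k..card B}"
    have "real (card (?P s)) \<le> real ((card B * card B) ^ (card A + s))"
      using card_permutations_moving[OF fin sub] by (simp only: of_nat_le_iff)
    also have "\<dots> = ?n ^ (2 * card A) * (?n\<^sup>2) ^ s"
      by (simp add: power_add power_mult power2_eq_square)
    finally have "real (card (?P s)) * (1 / sqrt 2) ^ (s * ?d) \<le> ?n ^ (2 * card A) * (?n\<^sup>2) ^ s * (1 / sqrt 2) ^ (s * ?d)"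
      by (rule mult_right_mono) simp
    also have "\<dots> = ?n ^ (2 * card A) * u ^ s"
      unfolding u power_mult_distrib power_mult[symmetric] by (simp add: mult_ac)
    also have "\<dots> \<le> ?n ^ (2 * card A) * u ^ k"
      using s u0 u1 by (intro mult_left_mono power_decreasing) auto
    finally show "real (card (?P s)) * (1 / sqrt 2) ^ (s * ?d) \<le> ?n ^ (2 * card A) * u ^ k" .
  qed simp
  also have "\<dots> = real (Suc (card B) - k) * (?E * (?n ^ (2 * card A) * u ^ k))" by simp
  also have "\<dots> \<le> (?n + 1) * (?E * (?n ^ (2 * card A) * u ^ k))"
    using u0 by (intro mult_right_mono) auto
  finally show ?thesis by (simp add: mult_ac)
qed

lemma card_Inv_unforced:
  "real (card {S \<in> Inv ar H B. \<exists>h. h permutes A \<and> \<not> forced (ar R) A H h \<and> preserves h S}) \<le>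
    2 ^ card (orbits ar H B) * (fact (card A) * (1 / sqrt 2) ^ card (B - A))"
proof -
  let ?P = "{h. h permutes A \<and> \<not> forced (ar R) A H h}"
  have finP: "finite ?P" using finite_permutations[OF finite_A] by simp
  have "card ?P \<le> card {h. h permutes A}" using finite_permutations[OF finite_A] by (intro card_mono) auto
  then have cP: "card ?P \<le> fact (card A)" using card_permutations[OF refl finite_A] by simp
  have "{S \<in> Inv ar H B. \<exists>h. h permutes A \<and> \<not> forced (ar R) A H h \<and> preserves h S} =
    (\<Union>h\<in>?P. {S \<in> Inv ar H B. preserves h S})" by auto
  then have "card {S \<in> Inv ar H B. \<exists>h. h permutes A \<and> \<not> forced (ar R) A H h \<and> preserves h S}
    \<le> (\<Sum>h\<in>?P. card {S \<in> Inv ar H B. preserves h S})" using card_UN_le[OF finP] by simp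
  then have "real (card {S \<in> Inv ar H B. \<exists>h. h permutes A \<and> \<not> forced (ar R) A H h \<and> preserves h S})
    \<le> real (\<Sum>h\<in>?P. card {S \<in> Inv ar H B. preserves h S})" by (simp only: of_nat_le_iff)
  also have "\<dots> = (\<Sum>h\<in>?P. real (card {S \<in> Inv ar H B. preserves h S}))" by simp
  also have "\<dots> \<le> (\<Sum>h\<in>?P. 2 ^ card (orbits ar H B) * (1 / sqrt 2) ^ card (B - A))"
    using card_Inv_preserved_unforced by (intro sum_mono) auto
  also have "\<dots> = real (card ?P) * (2 ^ card (orbits ar H B) * (1 / sqrt 2) ^ card (B - A))" by simp
  also have "\<dots> \<le> fact (card A) * (2 ^ card (orbits ar H B) * (1 / sqrt 2) ^ card (B - A))"
  proof (rule mult_right_mono)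
    have "real (card ?P) \<le> real (fact (card A))" using cP by (simp only: of_nat_le_iff)
    then show "real (card ?P) \<le> fact (card A)" by simp
  qed simp
  finally show ?thesis by (simp add: mult_ac)
qed

text \<open>\<open>H\<close> fixes the new point because it lies outside \<open>A\<close>. Hence
  only types invariant under \<open>H\<close> can be realized in an invariant structure.\<close>

lemma act_subst_new: "h \<in> H \<Longrightarrow> y \<notin> A \<Longrightarrow> act h (act (subst_new y) p) = act (subst_new y) (act (map_option h) p)"
  unfolding act_comp[symmetric]
  by (rule act_cong) (auto simp: subst_new_def fixes_outside split: option.split)

lemma new_atoms_H:
  assumes h: "h \<in> H" and xs: "xs \<subseteq> B - A" and p: "p \<in> new_atoms ar (A \<union> xs)"
  shows "act (map_option h) p \<in> new_atoms ar (A \<union> xs)"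
proof -
  have "h x \<in> A \<union> xs" if "x \<in> A \<union> xs" for x
    using that fixes_outside[OF h] perm_groupD(2)[OF grp h] by (cases "x \<in> A") (auto simp: permutes_in_image)
  then have "map_option h z \<in> insert None (Some ` (A \<union> xs))" if "z \<in> insert None (Some ` (A \<union> xs))" for z
    using that by auto
  moreover have "set (snd p) \<subseteq> insert None (Some ` (A \<union> xs))"
    using p by (simp add: new_atoms_def mem_atoms)
  ultimately have "set (snd (act (map_option h) p)) \<subseteq> insert None (Some ` (A \<union> xs))"
    unfolding snd_act set_map by blast
  moreover have "None \<in> set (snd (act (map_option h) p))"
    using p by (force simp: new_atoms_def)
  ultimately show ?thesis using p by (simp add: new_atoms_def mem_atoms)
qed

text \<open>Whether \<open>y\<close> realizes \<open>T\<close> depends only on the orbits of atoms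
  over \<open>A \<union> xs\<close> and \<open>y\<close> that contain \<open>y\<close>. For
  different candidates these sets of orbits are disjoint, so the failures are independent.\<close>

lemma card_Inv_missing_type:
  assumes xs: "xs \<subseteq> B - A" and T: "T \<subseteq> new_atoms ar (A \<union> xs)"
    and inv: "\<forall>h\<in>H. \<forall>p\<in>new_atoms ar (A \<union> xs). act (map_option h) p \<in> T \<longleftrightarrow> p \<in> T"
    and L: "card (new_atoms ar (A \<union> xs)) \<le> L"
  shows "real (card {S \<in> Inv ar H B. \<not> (\<exists>y\<in>B - A - xs. \<forall>p\<in>new_atoms ar (A \<union> xs).
      act (subst_new y) p \<in> S \<longleftrightarrow> p \<in> T)})
    \<le> 2 ^ card (orbits ar H B) * (1 - 1 / 2 ^ L) ^ card (B - A - xs)" (is "real (card ?F) \<le> _")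
proof -
  let ?D = "new_atoms ar (A \<union> xs)" and ?Y = "B - A - xs"
  let ?o = "\<lambda>y p. orb H (act (subst_new y) p)"
  let ?g = "\<lambda>S. {c \<in> orbits ar H B. c \<subseteq> S}"
  have finZ: "finite (A \<union> xs)" using finite_A xs fin finite_subset by blast
  have finD: "finite ?D" using card_new_atoms(1)[OF finZ order.refl] .
  have atom: "act (subst_new y) p \<in> atoms ar B" if "y \<in> ?Y" "p \<in> ?D" for y p
  proof -
    have "insert y (A \<union> xs) \<subseteq> B" using that xs sub by blast
    then show ?thesis using subst_new_atoms[OF that(2)] atoms_mono by blast
  qed
  \<comment> \<open>\<open>H\<close> fixes \<open>z\<close> and maps \<open>A \<union> xs\<close> to
    itself, so \<open>z\<close> is the only candidate occurring in any atom of the orbit; this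
    separates the blocks.\<close>
  have mem: "y \<in> set (snd q) \<longleftrightarrow> y = z" if "y \<in> ?Y" "z \<in> ?Y" "p \<in> ?D" and q: "q \<in> ?o z p" for y z p q
  proof -
    obtain h where h: "h \<in> H" "q = act h (act (subst_new z) p)" using q by (auto simp: orb_def)
    have "q = act (subst_new z) (act (map_option h) p)" using h act_subst_new that by blast
    moreover have "act (map_option h) p \<in> ?D" by (rule new_atoms_H[OF h(1) xs]) (rule that)
    ultimately have "q \<in> atoms ar (insert z (A \<union> xs))" "z \<in> set (snd q)"
      using subst_new_atoms[of "act (map_option h) p" ar "A \<union> xs" z] by simp_all
    then show ?thesis using that(1,2) by (auto simp: mem_atoms)
  qed
  have injS: "inj_on (act (subst_new y)) (atoms ar (insert None (Some ` (A \<union> xs))) :: ('r \<times> 'a option list) set)" if "y \<in> ?Y" for y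
  proof (rule inj_onI)
    fix p q :: "'r \<times> 'a option list" assume *: "p \<in> atoms ar (insert None (Some ` (A \<union> xs)))" "q \<in> atoms ar (insert None (Some ` (A \<union> xs)))"
      "act (subst_new y) p = act (subst_new y) q"
    have "inj_on (subst_new y) (insert None (Some ` (A \<union> xs)))"
      using that by (auto simp: inj_on_def)
    then have "inj_on (subst_new y) (set (snd p) \<union> set (snd q))"
      by (rule inj_on_subset) (use * in \<open>auto simp: mem_atoms\<close>)
    then show "p = q" using * by (auto simp: act_def prod_eq_iff dest: map_inj_on)
  qed
  have "inj_on ?g ?F" using bij_betw_Inv by (auto simp: bij_betw_def inj_on_def)
  then have "card ?F = card (?g ` ?F)" by (simp add: card_image)
  \<comment> \<open>Failure at \<open>y\<close> means missing the prescribed trace on the block of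
    \<open>y\<close>. Invariance of \<open>T\<close> enters here: it keeps an atom outside
    \<open>T\<close> from sharing an orbit with one in \<open>T\<close>.\<close>
  also have "\<dots> \<le> card {U \<in> Pow (orbits ar H B). \<forall>y\<in>?Y. U \<inter> ?o y ` ?D \<noteq> ?o y ` T}"
  proof (rule card_mono)
    show "finite {U \<in> Pow (orbits ar H B). \<forall>y\<in>?Y. U \<inter> ?o y ` ?D \<noteq> ?o y ` T}"
      using finite_orbits by simp
    show "?g ` ?F \<subseteq> {U \<in> Pow (orbits ar H B). \<forall>y\<in>?Y. U \<inter> ?o y ` ?D \<noteq> ?o y ` T}"
    proof (rule image_subsetI, rule CollectI, rule conjI)
      fix S assume S: "S \<in> ?F"
      show "\<forall>y\<in>?Y. ?g S \<inter> ?o y ` ?D \<noteq> ?o y ` T"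
      proof (intro ballI notI)
        fix y assume y: "y \<in> ?Y" and eq: "?g S \<inter> ?o y ` ?D = ?o y ` T"
        have in_g: "?o y p \<in> ?g S \<longleftrightarrow> act (subst_new y) p \<in> S" if "p \<in> ?D" for p
          using S atom[OF y that] orb_subset_invariant[of S] by (auto simp: orbits_def)
        have "act (subst_new y) p \<in> S \<longleftrightarrow> p \<in> T" if p: "p \<in> ?D" for p
        proof
          assume "p \<in> T"
          then show "act (subst_new y) p \<in> S" using eq in_g[OF p] by blast
        next
          assume "act (subst_new y) p \<in> S"
          then have "?o y p \<in> ?o y ` T" using eq in_g[OF p] p by blast
          then obtain q where q: "q \<in> T" "?o y p = ?o y q" by blast
          then obtain h where h: "h \<in> H" "act (subst_new y) p = act h (act (subst_new y) q)"
            using self_mem_orb[of "act (subst_new y) p"] by (auto simp: orb_def)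
          then have "act (subst_new y) p = act (subst_new y) (act (map_option h) q)"
            using act_subst_new[OF h(1), of y q] h(2) y by simp
          moreover have hq: "act (map_option h) q \<in> T" using inv h q T by blast
          ultimately have "p = act (map_option h) q"
            using injS[OF y] p T by (auto simp: inj_on_def new_atoms_def)
          then show "p \<in> T" using hq by simp
        qed
        then show False using S y by blast
      qed
    qed auto
  qed
  finally have "real (card ?F) \<le> real (card {U \<in> Pow (orbits ar H B). \<forall>y\<in>?Y. U \<inter> ?o y ` ?D \<noteq> ?o y ` T})"
    by simp
  also have "\<dots> \<le> 2 ^ card (orbits ar H B) * (1 - 1 / 2 ^ L) ^ card ?Y"
  proof (rule card_subsets_avoiding_traces)
    show "finite ?Y" using fin by simp
    show "finite (orbits ar H B)" by (rule finite_orbits)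
    show "?o y ` ?D \<subseteq> orbits ar H B" if "y \<in> ?Y" for y using atom[OF that] by (auto simp: orbits_def)
    show "card (?o y ` ?D) \<le> L" for y using card_image_le[OF finD, of "?o y"] L by linarith
    show "?o y ` T \<subseteq> ?o y ` ?D" for y using T by blast
    show "disjoint_family_on (\<lambda>y. ?o y ` ?D) ?Y"
      unfolding disjoint_family_on_def
    proof (intro ballI impI, rule ccontr)
      fix y z assume yz: "y \<in> ?Y" "z \<in> ?Y" "y \<noteq> z" "?o y ` ?D \<inter> ?o z ` ?D \<noteq> {}"
      then obtain p q where pq: "p \<in> ?D" "q \<in> ?D" "?o y p = ?o z q" by blast
      have "act (subst_new y) p \<in> ?o y p" by (rule self_mem_orb)
      then show False
        using mem[OF yz(1,1) pq(1)] mem[OF yz(1,2) pq(2)] yz(3) unfolding pq(3) by blast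
    qed
  qed
  finally show ?thesis .
qed

text \<open>Union bound over the parameters \<open>(xs, T)\<close>: polynomially many sets
  \<open>xs\<close>, at most \<open>2 ^ L\<close> types over each, and an exponentially small
  proportion for every pair.\<close>

lemma card_Inv_not_extendable:
  assumes L: "L = (\<Sum>R\<in>UNIV. Suc (card A + k) ^ ar R)"
  shows "real (card {S \<in> Inv ar H B. \<not> extendable ar A H k B S}) \<le> 2 ^ card (orbits ar H B) *
    (real (Suc (card B) ^ k) * 2 ^ L * (1 - 1 / 2 ^ L) ^ (card (B - A) - k))"
proof -
  let ?E = "2 ^ card (orbits ar H B) :: real"
  define I where "I = (SIGMA xs : {xs. xs \<subseteq> B - A \<and> card xs < k}. {T. T \<subseteq> new_atoms ar (A \<union> xs) \<and>
     (\<forall>h\<in>H. \<forall>p\<in>new_atoms ar (A \<union> xs). act (map_option h) p \<in> T \<longleftrightarrow> p \<in> T)})"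
  define F where "F = (\<lambda>(xs, T). {S \<in> Inv ar H B. \<not> (\<exists>y\<in>B - A - xs. \<forall>p\<in>new_atoms ar (A \<union> xs).
      act (subst_new y) p \<in> S \<longleftrightarrow> p \<in> T)})"
  have cD: "finite (new_atoms ar (A \<union> xs)) \<and> card (new_atoms ar (A \<union> xs)) \<le> L"
    if "xs \<subseteq> B - A" "card xs < k" for xs
  proof -
    have "finite (A \<union> xs)" using finite_A that fin finite_subset by blast
    moreover have "card (A \<union> xs) \<le> card A + k" using card_Un_le[of A xs] that by linarith
    ultimately show ?thesis using card_new_atoms[of "A \<union> xs" "card A + k" ar] L by blast
  qed
  have finX: "finite {xs. xs \<subseteq> B - A \<and> card xs < k}" using fin by simp
  have cX: "card {xs. xs \<subseteq> B - A \<and> card xs < k} \<le> Suc (card B) ^ k"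
  proof -
    \<comment> \<open>A set of fewer than \<open>k\<close> points is coded by a list of length
      \<open>k\<close> padded with \<open>None\<close>; the padding symbol accounts for the base
      \<open>Suc (card B)\<close>.\<close>
    let ?L = "{l. set l \<subseteq> insert None (Some ` B) \<and> length l = k}"
    have fL: "finite ?L" using finite_lists_length_eq[of "insert None (Some ` B)"] fin by simp
    have "{xs. xs \<subseteq> B - A \<and> card xs < k} \<subseteq> (\<lambda>l. {x. Some x \<in> set l}) ` ?L"
    proof clarify
      fix xs assume xs: "xs \<subseteq> B - A" "card xs < k"
      then obtain l where l: "set l = xs" "distinct l"
        using finite_distinct_list[of xs] fin finite_subset[of xs "B - A"] by auto
      have ll: "length l < k" using l xs distinct_card by metis
      have "map Some l @ replicate (k - length l) None \<in> ?L" using l xs ll by auto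
      moreover have "xs = {x. Some x \<in> set (map Some l @ replicate (k - length l) None)}"
        using l by auto
      ultimately show "xs \<in> (\<lambda>l. {x. Some x \<in> set l}) ` ?L" by blast
    qed
    then have "card {xs. xs \<subseteq> B - A \<and> card xs < k} \<le> card ((\<lambda>l. {x. Some x \<in> set l}) ` ?L)"
      by (rule card_mono[OF finite_imageI[OF fL]])
    also have "\<dots> \<le> card ?L" by (rule card_image_le[OF fL])
    also have "\<dots> = card (insert None (Some ` B)) ^ k"
      using fin by (intro card_lists_length_eq) simp
    also have "card (insert None (Some ` B)) = Suc (card B)"
      using fin by (subst card_insert_disjoint) (auto simp: card_image)
    finally show ?thesis .
  qed
  have cT: "finite {T. T \<subseteq> new_atoms ar (A \<union> xs) \<and>
     (\<forall>h\<in>H. \<forall>p\<in>new_atoms ar (A \<union> xs). act (map_option h) p \<in> T \<longleftrightarrow> p \<in> T)} \<and>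
     card {T. T \<subseteq> new_atoms ar (A \<union> xs) \<and>
     (\<forall>h\<in>H. \<forall>p\<in>new_atoms ar (A \<union> xs). act (map_option h) p \<in> T \<longleftrightarrow> p \<in> T)} \<le> 2 ^ L" (is "finite ?T \<and> card ?T \<le> _")
    if "xs \<subseteq> B - A" "card xs < k" for xs
  proof -
    have f: "finite (Pow (new_atoms ar (A \<union> xs)))" using cD[OF that] by simp
    have s: "?T \<subseteq> Pow (new_atoms ar (A \<union> xs))" by auto
    have "card ?T \<le> card (Pow (new_atoms ar (A \<union> xs)))" by (rule card_mono[OF f s])
    also have "\<dots> \<le> 2 ^ L" using cD[OF that] by (simp add: card_Pow power_increasing)
    finally show ?thesis using finite_subset[OF s f] by blast
  qed
  have finI: "finite I" unfolding I_def using finX cT by (intro finite_SigmaI) auto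
  have "card I = (\<Sum>xs\<in>{xs. xs \<subseteq> B - A \<and> card xs < k}. card {T. T \<subseteq> new_atoms ar (A \<union> xs) \<and>
     (\<forall>h\<in>H. \<forall>p\<in>new_atoms ar (A \<union> xs). act (map_option h) p \<in> T \<longleftrightarrow> p \<in> T)})"
    unfolding I_def using finX cT by (intro card_SigmaI) auto
  also have "\<dots> \<le> (\<Sum>xs\<in>{xs. xs \<subseteq> B - A \<and> card xs < k}. 2 ^ L)" using cT by (intro sum_mono) auto
  also have "\<dots> \<le> Suc (card B) ^ k * 2 ^ L" using cX by simp
  finally have "real (card I) \<le> real (Suc (card B) ^ k * 2 ^ L)" by (simp only: of_nat_le_iff)
  then have cI: "real (card I) \<le> real (Suc (card B) ^ k) * 2 ^ L" by simp
  have bound: "real (card (F i)) \<le> ?E * (1 - 1 / 2 ^ L) ^ (card (B - A) - k)" if "i \<in> I" for i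
  proof -
    obtain xs T where i: "i = (xs, T)" "xs \<subseteq> B - A" "card xs < k" "T \<subseteq> new_atoms ar (A \<union> xs)"
      "\<forall>h\<in>H. \<forall>p\<in>new_atoms ar (A \<union> xs). act (map_option h) p \<in> T \<longleftrightarrow> p \<in> T"
      using \<open>i \<in> I\<close> unfolding I_def by blast
    have "real (card (F i)) \<le> ?E * (1 - 1 / 2 ^ L) ^ card (B - A - xs)"
      unfolding F_def i(1) prod.case using card_Inv_missing_type[OF i(2,4,5)] cD i by blast
    also have "\<dots> \<le> ?E * (1 - 1 / 2 ^ L) ^ (card (B - A) - k)"
      using i(2,3) fin finite_subset[of xs "B - A"]
      by (intro mult_left_mono power_decreasing) (auto simp: card_Diff_subset)
    finally show ?thesis .
  qed
  have "{S \<in> Inv ar H B. \<not> extendable ar A H k B S} \<subseteq> (\<Union>i\<in>I. F i)"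
    unfolding extendable_def I_def F_def by auto
  then have "card {S \<in> Inv ar H B. \<not> extendable ar A H k B S} \<le> card (\<Union>i\<in>I. F i)"
    using finI finite_Inv by (intro card_mono) (auto simp: F_def)
  also have "\<dots> \<le> (\<Sum>i\<in>I. card (F i))" by (rule card_UN_le[OF finI])
  finally have "real (card {S \<in> Inv ar H B. \<not> extendable ar A H k B S}) \<le> real (\<Sum>i\<in>I. card (F i))"
    by (simp only: of_nat_le_iff)
  also have "\<dots> = (\<Sum>i\<in>I. real (card (F i)))" by simp
  also have "\<dots> \<le> (\<Sum>i\<in>I. ?E * (1 - 1 / 2 ^ L) ^ (card (B - A) - k))"
    by (rule sum_mono[OF bound])
  also have "\<dots> = real (card I) * (?E * (1 - 1 / 2 ^ L) ^ (card (B - A) - k))" by simp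
  also have "\<dots> \<le> real (Suc (card B) ^ k) * 2 ^ L * (?E * (1 - 1 / 2 ^ L) ^ (card (B - A) - k))"
    using cI by (intro mult_right_mono) auto
  finally show ?thesis by (simp add: mult_ac)
qed

end

section \<open>Back and forth over the support\<close>

primrec quantifier_rank :: "'r formula \<Rightarrow> nat" where
  "quantifier_rank (Eq x y) = 0"
| "quantifier_rank (Rel R xs) = 0"
| "quantifier_rank (Neg p) = quantifier_rank p"
| "quantifier_rank (Conj p q) = max (quantifier_rank p) (quantifier_rank q)"
| "quantifier_rank (Ex x p) = Suc (quantifier_rank p)"

definition structure_of :: "'a set \<Rightarrow> ('r \<times> 'a list) set \<Rightarrow> ('a, 'r) rel_structure" where
  "structure_of B S = \<lparr>universe = B, interp = (\<lambda>R. {t. (R, t) \<in> S})\<rparr>"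

lemma structure_of_simps [simp]:
  "universe (structure_of B S) = B" "t \<in> interp (structure_of B S) R \<longleftrightarrow> (R, t) \<in> S"
  by (simp_all add: structure_of_def)

text \<open>A position of the game: \<open>A\<close> plays the role of constants, \<open>xs\<close>
  and \<open>xs'\<close> hold the points chosen so far, and the values of \<open>g\<close> elsewhere
  are irrelevant.\<close>

definition partial_iso :: "('r \<Rightarrow> nat) \<Rightarrow> 'a set \<Rightarrow> 'a set \<Rightarrow> ('r \<times> 'a list) set \<Rightarrow> 'a set \<Rightarrow>
    ('r \<times> 'a list) set \<Rightarrow> 'a set \<Rightarrow> 'a set \<Rightarrow> ('a \<Rightarrow> 'a) \<Rightarrow> bool" where
  "partial_iso ar A B S B' S' xs xs' g \<longleftrightarrow> finite xs \<and> xs \<subseteq> B - A \<and> xs' \<subseteq> B' - A \<and>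
    bij_betw g xs xs' \<and> (\<forall>x\<in>A. g x = x) \<and> (\<forall>p\<in>atoms ar (A \<union> xs). act g p \<in> S' \<longleftrightarrow> p \<in> S)"

lemma partial_iso_bij:
  assumes "partial_iso ar A B S B' S' xs xs' g"
  shows "bij_betw g (A \<union> xs) (A \<union> xs')"
proof -
  have "bij_betw g A A" using assms by (auto simp: partial_iso_def bij_betw_def inj_on_def)
  then show ?thesis using assms by (intro bij_betw_combine) (auto simp: partial_iso_def)
qed

text \<open>Symmetry makes one extension lemma serve both directions of the game.\<close>

lemma partial_iso_sym:
  assumes pi: "partial_iso ar A B S B' S' xs xs' g"
  shows "partial_iso ar A B' S' B S xs' xs (inv_into (A \<union> xs) g)"
proof -
  let ?i = "inv_into (A \<union> xs) g"
  note bij = partial_iso_bij[OF pi]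
  have inj: "inj_on g (A \<union> xs)" and im: "g ` (A \<union> xs) = A \<union> xs'" using bij by (auto simp: bij_betw_def)
  have gxs: "g ` xs = xs'" using pi by (auto simp: partial_iso_def bij_betw_def)
  have i: "?i (g x) = x" if "x \<in> A \<union> xs" for x using inv_into_f_f[OF inj that] .
  have gi: "g (?i x) = x" "?i x \<in> A \<union> xs" if "x \<in> A \<union> xs'" for x
    using that im by (metis f_inv_into_f, metis inv_into_into)
  have "bij_betw ?i xs' xs"
    using i gxs by (intro bij_betwI[where g = g]) (auto simp: gi)
  moreover have "?i x = x" if "x \<in> A" for x using i[of x] that pi by (simp add: partial_iso_def)
  moreover have "act ?i p \<in> S \<longleftrightarrow> p \<in> S'" if p: "p \<in> atoms ar (A \<union> xs')" for p
  proof -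
    have "act ?i p \<in> atoms ar (A \<union> xs)" using p gi(2) by (auto simp: mem_atoms)
    moreover have "act g (act ?i p) = p"
      using p gi(1) by (auto simp: mem_atoms prod_eq_iff subset_iff intro!: map_idI)
    ultimately show ?thesis using pi unfolding partial_iso_def by metis
  qed
  ultimately show ?thesis using pi bij_betw_finite[of g xs xs'] by (auto simp: partial_iso_def)
qed

text \<open>The quantifier-free type of \<open>y\<close> over \<open>A \<union> xs\<close> is
  renamed along \<open>g\<close> to a type \<open>T\<close> over \<open>A \<union> xs'\<close>. A
  new \<open>y\<close> lies outside \<open>A\<close> and \<open>S\<close> is invariant under
  \<open>H\<close>, so \<open>T\<close> is invariant and the extension axiom for \<open>S'\<close>
  realizes it.\<close>

lemma partial_iso_extend:
  assumes pi: "partial_iso ar A B S B' S' xs xs' g" and k: "card xs < k"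
    and ext: "extendable ar A H k B' S'" and S: "S \<in> Inv ar H B" and grp: "perm_group A H" and y: "y \<in> B"
  shows "\<exists>ys ys' g'. partial_iso ar A B S B' S' ys ys' g' \<and> (\<forall>x\<in>A \<union> xs. g' x = g x) \<and>
    xs \<subseteq> ys \<and> card ys \<le> Suc (card xs) \<and> y \<in> A \<union> ys"
proof (cases "y \<in> A \<union> xs")
  case True
  then show ?thesis using pi by (intro exI[of _ xs] exI[of _ xs'] exI[of _ g]) auto
next
  case False
  note sym = partial_iso_sym[OF pi]
  define i where "i = inv_into (A \<union> xs) g"
  have bij: "bij_betw g (A \<union> xs) (A \<union> xs')" by (rule partial_iso_bij[OF pi])
  have ig: "i (g x) = x" if "x \<in> A \<union> xs" for x
    using bij that by (simp add: i_def bij_betw_def)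
  have gmem: "g x \<in> A \<union> xs'" if "x \<in> A \<union> xs" for x using bij that by (auto simp: bij_betw_def)
  have iA: "i x = x" if "x \<in> A" for x using sym that by (simp add: partial_iso_def i_def)
  have ixs: "i x \<in> xs" if "x \<in> xs'" for x using sym that by (auto simp: partial_iso_def i_def bij_betw_def)
  have xs: "xs \<subseteq> B - A" "xs' \<subseteq> B' - A" "finite xs" "card xs' = card xs"
    using pi bij_betw_same_card[of g xs xs'] by (auto simp: partial_iso_def)
  \<comment> \<open>\<open>w\<close> reads the placeholder as \<open>y\<close> and pulls the
    parameters back along \<open>g\<close>.\<close>
  define w where "w = case_option y i"
  define T where "T = {q \<in> new_atoms ar (A \<union> xs'). act w q \<in> S}"
  have "\<forall>h\<in>H. \<forall>q\<in>new_atoms ar (A \<union> xs'). act (map_option h) q \<in> T \<longleftrightarrow> q \<in> T"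
  proof (intro ballI)
    fix h q assume h: "h \<in> H" and q: "q \<in> new_atoms ar (A \<union> xs')"
    have hp: "h permutes A" using perm_groupD(2)[OF grp h] .
    have hx: "h x = x" if "x \<notin> A" for x using hp that by (simp add: permutes_def)
    have hA: "h x \<in> A" if "x \<in> A" for x using hp that by (simp add: permutes_in_image)
    have mem: "set (snd q) \<subseteq> insert None (Some ` (A \<union> xs'))" using q by (simp add: new_atoms_def mem_atoms)
    have "w (map_option h z) = h (w z)" if z: "z \<in> insert None (Some ` (A \<union> xs'))" for z
    proof -
      consider "z = None" | x where "z = Some x" "x \<in> A" | x where "z = Some x" "x \<in> xs'" using z by auto
      then show ?thesis
      proof cases
        case 1 then show ?thesis using False by (simp add: w_def hx)
      next
        case 2 then show ?thesis by (simp add: w_def iA hA)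
      next
        case 3
        then have "x \<notin> A" "i x \<notin> A" using xs ixs[of x] by auto
        then show ?thesis using 3 by (simp add: w_def hx)
      qed
    qed
    then have "act w (act (map_option h) q) = act h (act w q)"
      unfolding act_comp[symmetric] using mem by (intro act_cong) auto
    moreover have "act (map_option h) q \<in> new_atoms ar (A \<union> xs')"
    proof -
      have "h x \<in> A \<union> xs'" if "x \<in> A \<union> xs'" for x using that hA hx by (cases "x \<in> A") auto
      then have "map_option h ` insert None (Some ` (A \<union> xs')) \<subseteq> insert None (Some ` (A \<union> xs'))"
        by auto
      then have "set (snd (act (map_option h) q)) \<subseteq> insert None (Some ` (A \<union> xs'))"
        unfolding snd_act set_map using image_mono[OF mem, of "map_option h"] by order
      moreover have "None \<in> set (snd (act (map_option h) q))"
        using q by (force simp: new_atoms_def)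
      ultimately show ?thesis using q by (simp add: new_atoms_def mem_atoms)
    qed
    ultimately show "act (map_option h) q \<in> T \<longleftrightarrow> q \<in> T"
      using S h q preservesD[of h S "act w q"] by (simp add: T_def Inv_def)
  qed
  moreover have "T \<subseteq> new_atoms ar (A \<union> xs')" by (auto simp: T_def)
  ultimately have "\<exists>y'\<in>B' - A - xs'. \<forall>q\<in>new_atoms ar (A \<union> xs'). act (subst_new y') q \<in> S' \<longleftrightarrow> q \<in> T"
    using xs(2,4) k by (intro ext[unfolded extendable_def, rule_format]) auto
  then obtain y' where y': "y' \<in> B' - A - xs'"
    and type: "\<And>q. q \<in> new_atoms ar (A \<union> xs') \<Longrightarrow> act (subst_new y') q \<in> S' \<longleftrightarrow> q \<in> T"
    by blast
  define g' where "g' = g(y := y')"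
  have g': "g' x = g x" if "x \<in> A \<union> xs" for x using that False by (auto simp: g'_def)
  have "bij_betw g' xs xs'"
    using pi g' by (subst bij_betw_cong[of _ _ g]) (auto simp: partial_iso_def)
  then have "bij_betw g' (insert y xs) (insert y' xs')"
    using False y' by (intro bij_betw_combine[of _ "{y}" "{y'}", simplified, rotated]) (auto simp: g'_def)
  moreover have "act g' p \<in> S' \<longleftrightarrow> p \<in> S" if p: "p \<in> atoms ar (A \<union> insert y xs)" for p
  proof (cases "y \<in> set (snd p)")
    case False
    then have "p \<in> atoms ar (A \<union> xs)" using p by (auto simp: mem_atoms)
    moreover from this have "act g' p = act g p" by (intro act_cong g') (auto simp: mem_atoms)
    ultimately show ?thesis using pi by (simp add: partial_iso_def)
  next
    case True
    \<comment> \<open>The inverse renaming: followed by \<open>w\<close> it is the identity on the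
      entries of \<open>p\<close>, followed by \<open>subst_new y'\<close> it is
      \<open>g'\<close>.\<close>
    define u where "u = (\<lambda>x. if x = y then None else Some (g x))"
    define q where "q = act u p"
    have "u x \<in> insert None (Some ` (A \<union> xs'))" if "x \<in> A \<union> insert y xs" for x
      using that gmem[of x] by (auto simp: u_def)
    then have "set (snd q) \<subseteq> insert None (Some ` (A \<union> xs'))"
      using p by (auto simp: q_def mem_atoms)
    moreover have "None \<in> set (snd q)" using True by (force simp: q_def u_def)
    ultimately have q: "q \<in> new_atoms ar (A \<union> xs')"
      using p by (simp add: new_atoms_def mem_atoms q_def)
    have pm: "x \<in> A \<union> xs" if "x \<in> set (snd p)" "x \<noteq> y" for x using that p by (auto simp: mem_atoms)
    have "act w q = act id p" unfolding q_def act_comp[symmetric]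
      using pm ig by (intro act_cong) (auto simp: w_def u_def)
    moreover have "act (subst_new y') q = act g' p" unfolding q_def act_comp[symmetric]
      by (intro act_cong) (auto simp: u_def g'_def)
    ultimately show ?thesis using type[OF q] q by (simp add: T_def)
  qed
  ultimately have "partial_iso ar A B S B' S' (insert y xs) (insert y' xs') g'"
    using xs y y' False pi g' by (simp add: partial_iso_def)
  then show ?thesis using g' xs(3)
    by (intro exI[of _ "insert y xs"] exI[of _ "insert y' xs'"] exI[of _ g']) (auto simp: card_insert_if)
qed

text \<open>One implication for arbitrary pairs of structures suffices, since the negation case
  swaps the two sides. The bound on \<open>card xs\<close> plus the quantifier rank leaves room for
  one new point per remaining quantifier.\<close>

lemma partial_iso_sat:
  assumes "perm_group A H" "partial_iso ar A B S B' S' xs xs' g" "S \<in> Inv ar H B" "S' \<in> Inv ar H B'"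
    "extendable ar A H k B S" "extendable ar A H k B' S'" "A \<subseteq> B" "A \<subseteq> B'"
    "card xs + quantifier_rank \<phi> \<le> k" "\<And>v. v \<in> free_vars \<phi> \<Longrightarrow> e v \<in> A \<union> xs \<and> e' v = g (e v)"
    "well_formed ar \<phi>" "sat (structure_of B S) e \<phi>"
  shows "sat (structure_of B' S') e' \<phi>"
  using assms(2-)
proof (induction \<phi> arbitrary: B S B' S' xs xs' g e e')
  case (Eq x y)
  then show ?case by simp
next
  case (Rel R zs)
  have "(R, map e zs) \<in> atoms ar (A \<union> xs)" using Rel.prems(9,10) by (auto simp: atoms_def)
  moreover have "(R, map e zs) \<in> S" using Rel.prems(11) by simp
  moreover have "act g (R, map e zs) = (R, map e' zs)"
    using Rel.prems(9) by (auto simp: act_def)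
  ultimately have "(R, map e' zs) \<in> S'" using Rel.prems(1) unfolding partial_iso_def by metis
  then show ?case by simp
next
  case (Neg \<phi>)
  note bij = partial_iso_bij[OF Neg.prems(1)]
  have card: "card xs' = card xs" using Neg.prems(1) bij_betw_same_card[of g xs xs'] by (simp add: partial_iso_def)
  show ?case
  proof (simp, rule notI)
    assume sat': "sat (structure_of B' S') e' \<phi>"
    have "sat (structure_of B S) e \<phi>"
    proof (rule Neg.IH[OF partial_iso_sym[OF Neg.prems(1)]])
      show "e' v \<in> A \<union> xs' \<and> e v = inv_into (A \<union> xs) g (e' v)" if "v \<in> free_vars \<phi>" for v
        using Neg.prems(9)[of v] that bij by (auto simp: bij_betw_def)
    qed (use Neg.prems card sat' in simp_all)
    then show False using Neg.prems(11) by simp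
  qed
next
  case (Conj \<phi> \<psi>)
  have "sat (structure_of B' S') e' \<phi>"
    by (rule Conj.IH(1)[OF Conj.prems(1)]) (use Conj.prems in auto)
  moreover have "sat (structure_of B' S') e' \<psi>"
    by (rule Conj.IH(2)[OF Conj.prems(1)]) (use Conj.prems in auto)
  ultimately show ?case by simp
next
  case (Ex x \<phi>)
  obtain a where a: "a \<in> B" "sat (structure_of B S) (e(x := a)) \<phi>" using Ex.prems(11) by auto
  have "card xs < k" using Ex.prems(8) by simp
  from partial_iso_extend[OF Ex.prems(1) this Ex.prems(5,2) assms(1) a(1)]
  obtain ys ys' g' where g': "partial_iso ar A B S B' S' ys ys' g'" "\<And>x. x \<in> A \<union> xs \<Longrightarrow> g' x = g x"
    "xs \<subseteq> ys" "card ys \<le> Suc (card xs)" "a \<in> A \<union> ys" by blast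
  have "sat (structure_of B' S') (e'(x := g' a)) \<phi>"
  proof (rule Ex.IH[OF g'(1) Ex.prems(2-7)])
    show "(e(x := a)) v \<in> A \<union> ys \<and> (e'(x := g' a)) v = g' ((e(x := a)) v)" if "v \<in> free_vars \<phi>" for v
    proof (cases "v = x")
      case False
      then have "e v \<in> A \<union> xs" "e' v = g (e v)" using Ex.prems(9)[of v] that by auto
      then show ?thesis using False g'(2)[of "e v"] g'(3) by auto
    qed (use g' in simp)
    show "sat (structure_of B S) (e(x := a)) \<phi>" by (rule a)
  qed (use Ex.prems g' in simp_all)
  moreover have "g' a \<in> B'"
  proof -
    have "g' a \<in> A \<union> ys'" using partial_iso_bij[OF g'(1)] g'(5) by (auto simp: bij_betw_def)
    then show ?thesis using g'(1) Ex.prems(7) by (auto simp: partial_iso_def)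
  qed
  ultimately show ?case by auto
qed

text \<open>The game starts with no chosen points: equality of the traces says that the identity is
  a partial isomorphism on \<open>A\<close>.\<close>

lemma extendable_models_iff:
  assumes grp: "perm_group A H" and S: "S \<in> Inv ar H B" "S' \<in> Inv ar H B'"
    and ext: "extendable ar A H (quantifier_rank \<phi>) B S" "extendable ar A H (quantifier_rank \<phi>) B' S'"
    and sub: "A \<subseteq> B" "A \<subseteq> B'" and eq: "S \<inter> atoms ar A = S' \<inter> atoms ar A"
    and ne: "B \<noteq> {}" "B' \<noteq> {}" and \<phi>: "sentence ar \<phi>"
  shows "structure_of B S \<Turnstile> \<phi> \<longleftrightarrow> structure_of B' S' \<Turnstile> \<phi>"
proof -
  have *: "structure_of C' U' \<Turnstile> \<phi>"
    if "structure_of C U \<Turnstile> \<phi>" "U \<in> Inv ar H C" "U' \<in> Inv ar H C'"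
      "extendable ar A H (quantifier_rank \<phi>) C U" "extendable ar A H (quantifier_rank \<phi>) C' U'"
      "A \<subseteq> C" "A \<subseteq> C'" "U \<inter> atoms ar A = U' \<inter> atoms ar A" and neC: "C \<noteq> {}" for C U C' U'
  proof -
    \<comment> \<open>A nonempty universe has an assignment, so \<open>models\<close> on the side of
      \<open>C\<close> is not vacuous.\<close>
    obtain b where "b \<in> C" using neC by blast
    then have sat: "sat (structure_of C U) (\<lambda>_. b) \<phi>" using that(1) by (auto simp: models_def)
    have pi: "partial_iso ar A C U C' U' {} {} id"
      using that(8) by (auto simp: partial_iso_def)
    show ?thesis unfolding models_def
      using partial_iso_sat[OF grp pi that(2-7) _ _ _ sat] \<phi> by (auto simp: sentence_def)
  qed
  show ?thesis using *[OF _ S ext sub eq ne(1)] *[OF _ S(2,1) ext(2,1) sub(2,1) eq[symmetric] ne(2)] by blast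
qed

section \<open>Recovering the automorphism group from the trace on \<open>A\<close>\<close>

definition forced_group ::
    "nat \<Rightarrow> 'a set \<Rightarrow> ('a \<Rightarrow> 'a) set \<Rightarrow> ('r \<times> 'a list) set \<Rightarrow> ('a \<Rightarrow> 'a) set" where
  "forced_group k A H N = {h. h permutes A \<and> forced k A H h \<and> preserves h N}"

context perm_action
begin

text \<open>An atom not inside \<open>A\<close> has an entry outside, so its entries in
  \<open>A\<close> form a tuple shorter than \<open>k\<close>. There \<open>h\<close> agrees with
  some \<open>g\<close> in \<open>H\<close>, and outside \<open>A\<close> both are the identity;
  hence \<open>h\<close> acts on this atom as \<open>g\<close> does.\<close>

lemma forced_preserves:
  assumes h: "h permutes A" "forced k A H h" "preserves h (S \<inter> atoms ar A)"
    and S: "S \<in> Inv ar H B" and k: "\<And>R. ar R \<le> k"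
  shows "preserves h S"
  unfolding preserves_def
proof
  fix p
  consider "p \<notin> atoms ar B" | "p \<in> atoms ar A" | "p \<in> atoms ar B" "p \<notin> atoms ar A" by blast
  then show "act h p \<in> S \<longleftrightarrow> p \<in> S"
  proof cases
    case 1
    then have "act h p \<notin> atoms ar B" using act_mem_atoms[OF permutes_subset[OF h(1) sub]] by blast
    with 1 show ?thesis using S by (auto simp: Inv_def)
  next
    case 2
    then have "act h p \<in> atoms ar A" using h(1) by simp
    then show ?thesis using h(3) 2 unfolding preserves_def by blast
  next
    case 3
    let ?t = "filter (\<lambda>x. x \<in> A) (snd p)"
    have "\<exists>x\<in>set (snd p). x \<notin> A" using 3 by (auto simp: mem_atoms)
    then have "length ?t < length (snd p)" by (auto intro!: length_filter_less)
    also have "\<dots> \<le> k" using 3 k by (simp add: mem_atoms)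
    finally have "length ?t < k" .
    moreover have "set ?t \<subseteq> A" by auto
    ultimately obtain g where g: "g \<in> H" "map h ?t = map g ?t"
      using h(2) unfolding forced_def by blast
    have "h x = g x" if "x \<in> set (snd p)" for x
    proof (cases "x \<in> A")
      case True
      then show ?thesis using g(2) that by (auto simp: map_eq_conv)
    next
      case False
      then show ?thesis using h(1) fixes_outside[OF g(1)] by (simp add: permutes_def)
    qed
    then have "act h p = act g p" by (rule act_cong)
    then show ?thesis using S g(1) preservesD[of g S p] by (simp add: Inv_def)
  qed
qed

lemma forced_group_subset_auts:
  assumes "S \<in> Inv ar H B" "\<And>R. ar R \<le> k"
  shows "forced_group k A H (S \<inter> atoms ar A) \<subseteq> auts B S"
  using forced_preserves[OF _ _ _ assms] permutes_subset[OF _ sub]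
  unfolding forced_group_def auts_def by blast

lemma subset_forced_group: "N \<in> Inv ar H A \<Longrightarrow> H \<subseteq> forced_group k A H N"
  using perm_groupD(2)[OF grp] unfolding forced_group_def forced_def Inv_def by blast

text \<open>This needs no genericity of \<open>S\<close>; it therefore excludes outright, and not
  just asymptotically, the groups that no trace produces.\<close>

lemma forced_group_of_auts_eq:
  assumes "S \<in> Inv ar H B" "\<And>R. ar R \<le> k" "auts B S = H"
  shows "forced_group k A H (S \<inter> atoms ar A) = H"
  using forced_group_subset_auts[OF assms(1,2)] subset_forced_group[OF trace_Inv[OF assms(1)]] assms(3) by blast

lemma auts_subset_forced_group:
  assumes "\<And>f x. f \<in> auts B S \<Longrightarrow> x \<in> B - A \<Longrightarrow> f x = x"
    and "\<And>h. h permutes A \<Longrightarrow> preserves h S \<Longrightarrow> forced k A H h"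
  shows "auts B S \<subseteq> forced_group k A H (S \<inter> atoms ar A)"
proof
  fix f assume f: "f \<in> auts B S"
  have fA: "f permutes A"
    using f assms(1)[OF f] by (intro permutes_superset[of f B A]) (auto simp: auts_def)
  moreover have "preserves f S" using f by (simp add: auts_def)
  moreover from this have "preserves f (S \<inter> atoms ar A)" using fA by (auto simp: preserves_def)
  ultimately show "f \<in> forced_group k A H (S \<inter> atoms ar A)" using assms(2) by (simp add: forced_group_def)
qed

definition exceptional :: "nat \<Rightarrow> nat \<Rightarrow> ('r \<times> 'a list) set set" where
  "exceptional r k = {S \<in> Inv ar H B. \<exists>f\<in>auts B S. 1 \<le> card {x \<in> B - A. f x \<noteq> x}} \<union>
    {S \<in> Inv ar H B. \<exists>h. h permutes A \<and> \<not> forced r A H h \<and> preserves h S} \<union>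
    {S \<in> Inv ar H B. \<not> extendable ar A H k B S}"

lemma auts_eq_forced_group:
  assumes S: "S \<in> Inv ar H B" "S \<notin> exceptional r k" and r: "\<And>R. ar R \<le> r"
  shows "auts B S = forced_group r A H (S \<inter> atoms ar A)"
proof
  show "auts B S \<subseteq> forced_group r A H (S \<inter> atoms ar A)"
  proof (rule auts_subset_forced_group)
    fix f x assume "f \<in> auts B S" "x \<in> B - A"
    then have "card {x \<in> B - A. f x \<noteq> x} = 0" using S by (auto simp: exceptional_def)
    moreover have "finite {x \<in> B - A. f x \<noteq> x}" using fin by simp
    ultimately show "f x = x" using \<open>x \<in> B - A\<close> by (simp add: card_eq_0_iff) blast
  next
    show "forced r A H h" if "h permutes A" "preserves h S" for h
      using that S unfolding exceptional_def by blast
  qed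
qed (rule forced_group_subset_auts[OF S(1) r])

text \<open>Off the exceptional set the automorphism group and the truth of \<open>\<Phi>\<close>
  are functions of the trace, and the trace is uniform.\<close>

lemma card_auts_eq_approx:
  assumes r: "\<And>R. ar R \<le> r"
    and tr: "\<And>S. S \<in> Inv ar H B \<Longrightarrow> extendable ar A H k B S \<Longrightarrow> \<Phi> S \<longleftrightarrow> tr (S \<inter> atoms ar A)"
  shows "\<bar>real (card {S. S \<subseteq> atoms ar B \<and> auts B S = H \<and> \<Phi> S}) / 2 ^ card (orbits ar H B) -
      real (card {N \<in> Inv ar H A. forced_group r A H N = H \<and> tr N}) / 2 ^ card (orbits ar H A)\<bar>
    \<le> real (card (exceptional r k)) / 2 ^ card (orbits ar H B)"
proof -
  let ?Q = "{N \<in> Inv ar H A. forced_group r A H N = H \<and> tr N}"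
  let ?X = "{S. S \<subseteq> atoms ar B \<and> auts B S = H \<and> \<Phi> S}"
  let ?Y = "{S \<in> Inv ar H B. S \<inter> atoms ar A \<in> ?Q}"
  let ?E = "2 ^ card (orbits ar H B) :: real"
  have XI: "?X \<subseteq> Inv ar H B" by (auto simp: Inv_def auts_def)
  have iff: "S \<in> ?X \<longleftrightarrow> S \<in> ?Y" if "S \<in> Inv ar H B" "S \<notin> exceptional r k" for S
  proof -
    have "extendable ar A H k B S" using that by (auto simp: exceptional_def)
    then show ?thesis
      using auts_eq_forced_group[OF that r] tr[OF that(1)] trace_Inv[OF that(1)] that(1)
      by (auto simp: Inv_def)
  qed
  have finE: "finite (exceptional r k)" using finite_Inv by (auto simp: exceptional_def)
  have finX: "finite ?X" "finite ?Y" using finite_subset[OF XI finite_Inv] finite_Inv by auto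
  have "?X \<subseteq> ?Y \<union> exceptional r k" using iff XI by blast
  then have "card ?X \<le> card (?Y \<union> exceptional r k)" using finE finX by (intro card_mono) auto
  also have "\<dots> \<le> card ?Y + card (exceptional r k)" by (rule card_Un_le)
  finally have 1: "card ?X \<le> card ?Y + card (exceptional r k)" .
  have "?Y \<subseteq> ?X \<union> exceptional r k" using iff by blast
  then have "card ?Y \<le> card (?X \<union> exceptional r k)" using finE finX by (intro card_mono) auto
  also have "\<dots> \<le> card ?X + card (exceptional r k)" by (rule card_Un_le)
  finally have "card ?Y \<le> card ?X + card (exceptional r k)" .
  with 1 have "\<bar>real (card ?X) - real (card ?Y)\<bar> \<le> real (card (exceptional r k))" by linarith
  then have "\<bar>real (card ?X) - real (card ?Y)\<bar> / ?E \<le> real (card (exceptional r k)) / ?E"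
    by (rule divide_right_mono) simp
  moreover have "\<bar>real (card ?X) - real (card ?Y)\<bar> / ?E = \<bar>real (card ?X) / ?E - real (card ?Y) / ?E\<bar>"
    by (simp add: diff_divide_distrib[symmetric])
  moreover have "real (card ?Y) / ?E = real (card ?Q) / 2 ^ card (orbits ar H A)"
    by (subst card_Inv_with_trace) auto
  ultimately show ?thesis by metis
qed

end

section \<open>Asymptotics\<close>

lemma tendsto_0_if_norm_le:
  fixes f g :: "'x \<Rightarrow> real"
  assumes "\<forall>\<^sub>F x in F. norm (f x) \<le> g x" "(g \<longlongrightarrow> 0) F"
  shows "(f \<longlongrightarrow> 0) F"
  by (rule tendsto_0_le[OF assms(2), of _ 1]) (use assms(1) in \<open>auto elim: eventually_mono\<close>)

text \<open>Writing \<open>x = y ^ k\<close> reduces the claim to \<open>n * y ^ n\<close> tending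
  to 0.\<close>

lemma power_times_geometric_tendsto_0:
  fixes x :: real
  assumes "0 < x" "x < 1"
  shows "(\<lambda>n. real n ^ k * x ^ n) \<longlonglongrightarrow> 0"
proof (cases "k = 0")
  case True
  then show ?thesis using LIMSEQ_power_zero[of x] assms by simp
next
  case False
  define y where "y = root k x"
  have y: "y ^ k = x" "0 < y" "y < 1" using assms False by (auto simp: y_def)
  have "(\<lambda>n. (real n * y ^ n) ^ k) \<longlonglongrightarrow> 0 ^ k"
    by (intro tendsto_power powser_times_n_limit_0) (use y in simp)
  moreover have "(real n * y ^ n) ^ k = real n ^ k * x ^ n" for n
    unfolding power_mult_distrib y(1)[symmetric] power_mult[symmetric] by (simp add: mult.commute)
  ultimately show ?thesis using False by (simp add: zero_power)
qed

lemma Suc_power_times_geometric_tendsto_0: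
  fixes x :: real
  assumes "0 < x" "x < 1"
  shows "(\<lambda>n. (real n + 1) ^ k * x ^ (n - c)) \<longlonglongrightarrow> 0"
proof -
  have "(\<lambda>n. real (Suc n) ^ k * x ^ Suc n) \<longlonglongrightarrow> 0"
    using LIMSEQ_Suc[OF power_times_geometric_tendsto_0[OF assms]] .
  then have "(\<lambda>n. real (Suc n) ^ k * x ^ Suc n * (1 / x ^ Suc c)) \<longlonglongrightarrow> 0 * (1 / x ^ Suc c)"
    by (rule tendsto_mult_right)
  then have lim: "(\<lambda>n. real (Suc n) ^ k * x ^ Suc n * (1 / x ^ Suc c)) \<longlonglongrightarrow> 0"
    by (simp only: mult_zero_left)
  have "real (Suc n) ^ k * x ^ Suc n * (1 / x ^ Suc c) = (real n + 1) ^ k * x ^ (n - c)" if "n \<ge> c" for n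
  proof -
    have "x ^ Suc n = x ^ Suc c * x ^ (n - c)" using that by (simp flip: power_add)
    then show ?thesis using assms by (simp add: add.commute)
  qed
  then show ?thesis
    by (intro tendsto_cong[THEN iffD1, OF _ lim] eventually_sequentiallyI[of c])
qed

section \<open>Growth and comparison of weights\<close>

lemma binomial_over_power_tendsto:
  "(\<lambda>n. real (n choose a) / real n ^ a) \<longlonglongrightarrow> 1 / fact a"
proof -
  have "(\<lambda>n. (real n - real i) / real n) \<longlonglongrightarrow> 1" for i :: nat by real_asymp
  then have "(\<lambda>n. (\<Prod>i = 0..<a. (real n - real i) / real n) / fact a) \<longlonglongrightarrow> (\<Prod>i = 0..<a. 1) / fact a"
    by (intro tendsto_divide tendsto_prod) auto
  moreover have "(\<Prod>i = 0..<a. (real n - real i) / real n) / fact a = real (n choose a) / real n ^ a" for n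
    by (simp add: binomial_gbinomial gbinomial_prod_rev prod_dividef)
  ultimately show ?thesis by simp
qed

lemma poly_at_least_linear:
  fixes D :: "real poly"
  assumes "degree D > 0" "lead_coeff D > 0"
  shows "\<exists>c>0. \<forall>\<^sub>F n in sequentially. c * real n \<le> poly D (real n)"
proof -
  obtain d q where D: "D = pCons d q" by (cases D)
  have q: "lead_coeff q > 0" using assms D by (auto split: if_splits)
  then obtain N where N: "\<And>x. x \<ge> N \<Longrightarrow> poly q x \<ge> lead_coeff q" using poly_pinfty_gt_lc by blast
  define c where "c = lead_coeff q"
  have "\<forall>\<^sub>F n in sequentially. max N (2 * \<bar>d\<bar> / c) \<le> real n"
    using filterlim_real_sequentially unfolding filterlim_at_top by blast
  then have "\<forall>\<^sub>F n in sequentially. c / 2 * real n \<le> poly D (real n)"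
  proof eventually_elim
    case (elim n)
    have "c * real n \<le> poly q (real n) * real n"
      using N[of "real n"] elim by (intro mult_right_mono) (auto simp: c_def)
    moreover have "2 * \<bar>d\<bar> \<le> c * real n" using elim q by (simp add: c_def field_simps)
    ultimately have "c / 2 * real n \<le> d + poly q (real n) * real n" by (simp add: abs_if split: if_splits)
    then show ?case by (simp add: D mult.commute)
  qed
  then show ?thesis using q by (intro exI[of _ "c / 2"]) (simp add: c_def)
qed

text \<open>The difference of the exponents is eventually at least \<open>c * n\<close> for some
  positive \<open>c\<close>, and the resulting geometric factor absorbs every power of
  \<open>n\<close>.\<close>

lemma weight_ratio_tendsto_0:
  fixes p q :: "real poly" and E F :: "nat \<Rightarrow> nat"
  assumes "degree (q - p) > 0" "lead_coeff (q - p) > 0"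
    and E: "\<forall>\<^sub>F n in sequentially. real (E n) = poly p (real n)"
    and F: "\<forall>\<^sub>F n in sequentially. real (F n) = poly q (real n)"
  shows "(\<lambda>n. (real n ^ a * 2 ^ E n) / (real n ^ b * 2 ^ F n)) \<longlonglongrightarrow> 0"
proof -
  obtain c where c: "c > 0" "\<forall>\<^sub>F n in sequentially. c * real n \<le> poly (q - p) (real n)"
    using poly_at_least_linear[OF assms(1,2)] by blast
  define x where "x = 2 powr - c"
  have x: "0 < x" "x < 1" using c by (auto simp: x_def powr_less_one)
  have "\<forall>\<^sub>F n in sequentially. norm ((real n ^ a * 2 ^ E n) / (real n ^ b * 2 ^ F n)) \<le> real n ^ a * x ^ n"
    using c(2) E F eventually_gt_at_top[of 0]
  proof eventually_elim
    case (elim n)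
    have "c * real n \<le> real (F n) - real (E n)" using elim by simp
    then have "2 powr (real (E n) - real (F n)) \<le> 2 powr (- c * real n)" by simp
    also have "\<dots> = x ^ n" by (simp add: x_def powr_powr flip: powr_realpow[OF x(1)[unfolded x_def]])
    finally have "2 ^ E n / 2 ^ F n \<le> x ^ n" by (simp add: powr_diff powr_realpow)
    moreover have "real n ^ a / real n ^ b \<le> real n ^ a"
      using elim by (simp add: divide_le_eq mult_le_cancel_left1 one_le_power)
    ultimately have "(real n ^ a / real n ^ b) * (2 ^ E n / 2 ^ F n) \<le> real n ^ a * x ^ n"
      by (intro mult_mono) auto
    then show ?case by simp
  qed
  then show ?thesis by (rule tendsto_0_if_norm_le[OF _ power_times_geometric_tendsto_0[OF x]])
qed

text \<open>If \<open>p - q\<close> is not constant, the sign of its leading coefficient decides and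
  one quotient decays geometrically. If it is constant, so is the quotient of the powers of 2, and a
  power of \<open>n\<close> decides.\<close>

lemma weights_comparable:
  fixes p q :: "real poly" and E F :: "nat \<Rightarrow> nat"
  assumes E: "\<forall>\<^sub>F n in sequentially. real (E n) = poly p (real n)"
    and F: "\<forall>\<^sub>F n in sequentially. real (F n) = poly q (real n)"
  shows "(\<exists>c\<in>\<rat>. (\<lambda>n. (real n ^ a * 2 ^ E n) / (real n ^ b * 2 ^ F n)) \<longlonglongrightarrow> c) \<or>
    (\<lambda>n. (real n ^ b * 2 ^ F n) / (real n ^ a * 2 ^ E n)) \<longlonglongrightarrow> 0"
proof -
  have "degree (q - p) = degree (p - q)" using degree_minus[of "p - q"] by simp
  moreover have "lead_coeff (q - p) = - lead_coeff (p - q)" using lead_coeff_minus[of "p - q"] by simp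
  moreover have "lead_coeff (p - q) \<noteq> 0" if "degree (p - q) > 0"
    unfolding leading_coeff_0_iff using that by auto
  ultimately consider "degree (q - p) > 0" "lead_coeff (q - p) > 0" | "degree (p - q) > 0" "lead_coeff (p - q) > 0"
    | "degree (p - q) = 0" by linarith
  then show ?thesis
  proof cases
    case 1
    then show ?thesis using weight_ratio_tendsto_0[OF 1 E F] Rats_0 by blast
  next
    case 2
    then show ?thesis using weight_ratio_tendsto_0[OF 2 F E] by blast
  next
    case 3
    then obtain d where d: "p - q = [:d:]" by (rule degree_eq_zeroE)
    have "\<forall>\<^sub>F n in sequentially. real (E n) = real (F n) + d"
      using E F
    proof eventually_elim
      case (elim n)
      have "poly (p - q) (real n) = d" unfolding d by simp
      then show ?case using elim by simp
    qed
    then obtain N where N: "\<And>n. n \<ge> N \<Longrightarrow> real (E n) = real (F n) + d"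
      by (auto simp: eventually_sequentially)
    \<comment> \<open>The constant quotient is read off at one large argument, where the exponents
      are natural numbers; so it is rational although \<open>d\<close> is only known to be
      real.\<close>
    define c :: real where "c = 2 ^ E N / 2 ^ F N"
    have c: "c \<in> \<rat>" "c > 0" by (auto simp: c_def)
    have quot: "2 ^ E n / 2 ^ F n = c" if "n \<ge> N" for n
    proof -
      have "E n + F N = E N + F n" using N[OF that] N[OF order.refl] by linarith
      then have "(2::real) ^ E n * 2 ^ F N = 2 ^ E N * 2 ^ F n" by (simp flip: power_add)
      then show ?thesis by (simp add: c_def field_simps)
    qed
    show ?thesis
    proof (cases "a \<le> b")
      case True
      have "(\<lambda>n. real n ^ a / real n ^ b) \<longlonglongrightarrow> (if a = b then 1 else 0)"
      proof (cases "a = b")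
        case True
        have "\<forall>\<^sub>F n in sequentially. real n ^ a / real n ^ b = 1"
          using eventually_gt_at_top[of 0] by eventually_elim (simp add: True)
        then show ?thesis using True by (simp add: tendsto_eventually)
      next
        case False
        have "(\<lambda>n. inverse (real n ^ (b - a))) \<longlonglongrightarrow> 0"
          using False True by (intro tendsto_inverse_0_at_top filterlim_pow_at_top filterlim_real_sequentially) auto
        moreover have "\<forall>\<^sub>F n in sequentially. inverse (real n ^ (b - a)) = real n ^ a / real n ^ b"
          using eventually_gt_at_top[of 0]
          by eventually_elim (use True in \<open>simp add: power_diff divide_simps\<close>)
        ultimately show ?thesis using False by (simp add: tendsto_cong)
      qed
      then have "(\<lambda>n. real n ^ a / real n ^ b * c) \<longlonglongrightarrow> (if a = b then 1 else 0) * c"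
        by (rule tendsto_mult_right)
      moreover have "\<forall>\<^sub>F n in sequentially. real n ^ a / real n ^ b * c = (real n ^ a * 2 ^ E n) / (real n ^ b * 2 ^ F n)"
        using eventually_ge_at_top[of N] by eventually_elim (simp flip: quot)
      ultimately have "(\<lambda>n. (real n ^ a * 2 ^ E n) / (real n ^ b * 2 ^ F n)) \<longlonglongrightarrow> (if a = b then 1 else 0) * c"
        by (rule Lim_transform_eventually)
      moreover have "(if a = b then 1 else 0) * c \<in> \<rat>" using c by simp
      ultimately show ?thesis by blast
    next
      case False
      have "(\<lambda>n. inverse (real n ^ (a - b)) * inverse c) \<longlonglongrightarrow> 0 * inverse c"
        using False by (intro tendsto_mult_right tendsto_inverse_0_at_top filterlim_pow_at_top filterlim_real_sequentially) auto
      moreover have "\<forall>\<^sub>F n in sequentially. inverse (real n ^ (a - b)) * inverse c = (real n ^ b * 2 ^ F n) / (real n ^ a * 2 ^ E n)"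
        using eventually_ge_at_top[of "max N 1"]
      proof eventually_elim
        case (elim n)
        have "real n ^ a = real n ^ (a - b) * real n ^ b" using False by (simp flip: power_add)
        moreover have "2 ^ E n = c * 2 ^ F n" using quot[of n] elim by (simp add: field_simps)
        ultimately show ?case using elim c(2) by (simp add: divide_simps)
      qed
      ultimately have "(\<lambda>n. (real n ^ b * 2 ^ F n) / (real n ^ a * 2 ^ E n)) \<longlonglongrightarrow> 0 * inverse c"
        by (rule Lim_transform_eventually)
      then show ?thesis by simp
    qed
  qed
qed

text \<open>Comparability makes the weights a finite total preorder. A new weight without a rational
  limit against the current maximum beats it, and multiplying quotients sends all the others to
  0.\<close>

lemma dominating_weight:
  fixes w :: "'i \<Rightarrow> nat \<Rightarrow> real"
  assumes "finite J" "J \<noteq> {}"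
    and pos: "\<And>i. i \<in> J \<Longrightarrow> \<forall>\<^sub>F n in sequentially. w i n > 0"
    and comp: "\<And>i j. i \<in> J \<Longrightarrow> j \<in> J \<Longrightarrow>
      (\<exists>c\<in>\<rat>. (\<lambda>n. w i n / w j n) \<longlonglongrightarrow> c) \<or> (\<lambda>n. w j n / w i n) \<longlonglongrightarrow> 0"
  shows "\<exists>j\<in>J. \<forall>i\<in>J. \<exists>c\<in>\<rat>. (\<lambda>n. w i n / w j n) \<longlonglongrightarrow> c"
  using assms
proof (induction J rule: finite_ne_induct)
  case (singleton i)
  have "\<forall>\<^sub>F n in sequentially. w i n / w i n = 1"
    using singleton(1)[of i] by (auto elim: eventually_mono)
  then have "(\<lambda>n. w i n / w i n) \<longlonglongrightarrow> 1" by (rule tendsto_eventually)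
  then show ?case using Rats_1 by blast
next
  case (insert k J)
  have "\<exists>j\<in>J. \<forall>i\<in>J. \<exists>c\<in>\<rat>. (\<lambda>n. w i n / w j n) \<longlonglongrightarrow> c"
    by (rule insert.IH; rule insert.prems; simp)
  then obtain j where j: "j \<in> J" "\<And>i. i \<in> J \<Longrightarrow> \<exists>c\<in>\<rat>. (\<lambda>n. w i n / w j n) \<longlonglongrightarrow> c"
    by blast
  show ?case
  proof (cases "\<exists>c\<in>\<rat>. (\<lambda>n. w k n / w j n) \<longlonglongrightarrow> c")
    case True
    then show ?thesis using j by blast
  next
    case False
    then have jk: "(\<lambda>n. w j n / w k n) \<longlonglongrightarrow> 0" using insert.prems(2)[of k j] j(1) by simp
    have "\<exists>c\<in>\<rat>. (\<lambda>n. w i n / w k n) \<longlonglongrightarrow> c" if i: "i \<in> insert k J" for i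
    proof (cases "i = k")
      case True
      have "\<forall>\<^sub>F n in sequentially. w k n / w k n = 1"
        using insert.prems(1)[of k] by (auto elim: eventually_mono)
      then have "(\<lambda>n. w k n / w k n) \<longlonglongrightarrow> 1" by (rule tendsto_eventually)
      then show ?thesis unfolding True using Rats_1 by blast
    next
      case False
      then obtain c where c: "(\<lambda>n. w i n / w j n) \<longlonglongrightarrow> c" using j(2)[of i] i by blast
      have "(\<lambda>n. (w i n / w j n) * (w j n / w k n)) \<longlonglongrightarrow> c * 0" by (rule tendsto_mult[OF c jk])
      moreover have "\<forall>\<^sub>F n in sequentially. (w i n / w j n) * (w j n / w k n) = w i n / w k n"
        using insert.prems(1)[of j] j(1) by (auto elim!: eventually_mono)
      ultimately have "(\<lambda>n. w i n / w k n) \<longlonglongrightarrow> c * 0" by (rule Lim_transform_eventually)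
      then show ?thesis using Rats_0 by auto
    qed
    then show ?thesis by blast
  qed
qed

section \<open>Vanishing error terms\<close>

lemma perm_action_atLeastAtMost:
  "a \<le> n \<Longrightarrow> perm_group {1..a} H \<Longrightarrow> perm_action {1..a} {1..n::nat} H"
  by unfold_locales auto

text \<open>Each of the three union bounds is a power of \<open>n + 1\<close> times a geometric
  term; \<open>2 \<le> ar R\<close> makes \<open>(n - a) ^ (ar R - 1)\<close> at least
  linear.\<close>

lemma exceptional_negligible:
  fixes ar :: "'r::finite \<Rightarrow> nat"
  assumes grp: "perm_group {1..a} H" and R: "2 \<le> ar R"
  shows "(\<lambda>n. real (card (perm_action.exceptional ar {1..a} {1..n::nat} H (ar R) k)) /
    2 ^ card (orbits ar H {1..n})) \<longlonglongrightarrow> 0"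
proof -
  define x :: real where "x = 1 / sqrt 2"
  have x: "0 < x" "x < 1" by (auto simp: x_def)
  define L where "L = (\<Sum>R\<in>UNIV. Suc (a + k) ^ ar R)"
  \<comment> \<open>\<open>Suc L\<close> in place of \<open>L\<close> keeps the base strictly
    positive without a lower bound on \<open>L\<close>.\<close>
  define y :: real where "y = 1 - 1 / 2 ^ Suc L"
  have y: "0 < y" "y < 1" using one_less_power[of "2::real" "Suc L"] by (auto simp: y_def field_simps)
  have yL: "0 \<le> 1 - 1 / (2::real) ^ L" "1 - 1 / (2::real) ^ L \<le> y" by (auto simp: y_def field_simps)
  define u where "u = (\<lambda>n. (real n)\<^sup>2 * x ^ ((n - a) ^ (ar R - 1)))"
  \<comment> \<open>In the exponent \<open>2 * a + 3\<close>, the summand \<open>2 * a\<close> codes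
    the permutation on \<open>A\<close>, one comes from summing over the number of moved points, and
    two come from \<open>u\<close>.\<close>
  define G where "G = (\<lambda>n. (real n + 1) ^ (2 * a + 3) * x ^ (n - a) + fact a * ((real n + 1) ^ 0 * x ^ (n - a))
    + 2 ^ L * ((real n + 1) ^ k * y ^ (n - (a + k))))"
  have "G \<longlonglongrightarrow> 0 + fact a * 0 + 2 ^ L * 0" unfolding G_def
    by (intro tendsto_add tendsto_mult_left Suc_power_times_geometric_tendsto_0 x y)
  then have G: "G \<longlonglongrightarrow> 0" by simp
  have ule: "u n \<le> (real n + 1) ^ 2 * x ^ (n - a)" for n
  proof -
    have "n - a \<le> (n - a) ^ (ar R - 1)"
      using R by (cases "n - a = 0") (simp_all add: self_le_power)
    then have "x ^ ((n - a) ^ (ar R - 1)) \<le> x ^ (n - a)" using x by (intro power_decreasing) auto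
    then show ?thesis unfolding u_def using x by (intro mult_mono power_mono) auto
  qed
  have "\<forall>\<^sub>F n in sequentially. (real n + 1) ^ 2 * x ^ (n - a) < 1"
    by (rule order_tendstoD(2)[OF Suc_power_times_geometric_tendsto_0[OF x]]) simp
  then have "\<forall>\<^sub>F n in sequentially. norm (real (card (perm_action.exceptional ar {1..a} {1..n} H (ar R) k)) /
    2 ^ card (orbits ar H {1..n})) \<le> G n"
    using eventually_ge_at_top[of a]
  proof eventually_elim
    case (elim n)
    interpret perm_action ar "{1..a}" "{1..n}" H using perm_action_atLeastAtMost elim(2) grp .
    have card: "card ({1..n} - {1..a}) = n - a" by (subst card_Diff_subset) (use elim in auto)
    have u1: "u n \<le> 1" using ule[of n] elim by linarith
    let ?E = "2 ^ card (orbits ar H {1..n}) :: real"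
    let ?A1 = "{S \<in> Inv ar H {1..n}. \<exists>f\<in>auts {1..n} S. 1 \<le> card {x \<in> {1..n} - {1..a}. f x \<noteq> x}}"
    let ?A2 = "{S \<in> Inv ar H {1..n}. \<exists>h. h permutes {1..a} \<and> \<not> forced (ar R) {1..a} H h \<and> preserves h S}"
    let ?A3 = "{S \<in> Inv ar H {1..n}. \<not> extendable ar {1..a} H k {1..n} S}"
    have "real (card ?A1) \<le> ?E * (real n ^ (2 * a) * (real n + 1) * u n ^ 1)"
      using card_Inv_moving[of R "u n" 1] R u1 card by (simp add: u_def x_def)
    also have "\<dots> \<le> ?E * ((real n + 1) ^ (2 * a) * (real n + 1) * ((real n + 1) ^ 2 * x ^ (n - a)))"
      using ule[of n] x by (intro mult_left_mono mult_mono power_mono) (auto simp: u_def)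
    finally have 1: "real (card ?A1) \<le> ?E * ((real n + 1) ^ (2 * a + 3) * x ^ (n - a))"
      by (simp add: power_add eval_nat_numeral mult_ac)
    have 2: "real (card ?A2) \<le> ?E * (fact a * x ^ (n - a))"
      using card_Inv_unforced[of R] card by (simp add: x_def)
    have "real (card ?A3) \<le> ?E * (real (Suc n ^ k) * 2 ^ L * (1 - 1 / 2 ^ L) ^ (n - a - k))"
      using card_Inv_not_extendable[of L k] card by (simp add: L_def)
    also have "\<dots> \<le> ?E * (real (Suc n ^ k) * 2 ^ L * y ^ (n - a - k))"
      using yL by (intro mult_left_mono power_mono) auto
    finally have 3: "real (card ?A3) \<le> ?E * (2 ^ L * ((real n + 1) ^ k * y ^ (n - (a + k))))"
      by (simp add: mult_ac add_ac)
    have "card (exceptional (ar R) k) \<le> card ?A1 + card ?A2 + card ?A3"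
      unfolding exceptional_def by (meson add_le_mono card_Un_le le_refl le_trans)
    then have "real (card (exceptional (ar R) k)) \<le> real (card ?A1) + real (card ?A2) + real (card ?A3)"
      by linarith
    also have "\<dots> \<le> ?E * G n" using 1 2 3 unfolding G_def by (simp add: distrib_left)
    finally show ?case by (simp add: divide_le_eq mult.commute)
  qed
  then show ?thesis by (rule tendsto_0_if_norm_le[OF _ G])
qed

lemma auts_eq_proportion_tendsto:
  fixes ar :: "'r::finite \<Rightarrow> nat"
  assumes grp: "perm_group {1..a} H" and R: "2 \<le> ar R" "\<And>R'. ar R' \<le> ar R"
    and tr: "\<And>n S. a \<le> n \<Longrightarrow> 1 \<le> n \<Longrightarrow> S \<in> Inv ar H {1..n} \<Longrightarrow> extendable ar {1..a} H k {1..n} S \<Longrightarrow>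
      \<Phi> n S \<longleftrightarrow> tr (S \<inter> atoms ar {1..a})"
  shows "(\<lambda>n. real (card {S. S \<subseteq> atoms ar {1..n::nat} \<and> auts {1..n} S = H \<and> \<Phi> n S}) /
      2 ^ card (orbits ar H {1..n})) \<longlonglongrightarrow>
    real (card {N \<in> Inv ar H {1..a}. forced_group (ar R) {1..a} H N = H \<and> tr N}) / 2 ^ card (orbits ar H {1..a})"
proof (rule LIM_zero_cancel, rule tendsto_0_if_norm_le[OF _ exceptional_negligible[OF grp, of ar R k]])
  show "\<forall>\<^sub>F n in sequentially. norm (real (card {S. S \<subseteq> atoms ar {1..n::nat} \<and> auts {1..n} S = H \<and> \<Phi> n S}) /
      2 ^ card (orbits ar H {1..n}) -
    real (card {N \<in> Inv ar H {1..a}. forced_group (ar R) {1..a} H N = H \<and> tr N}) / 2 ^ card (orbits ar H {1..a}))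
    \<le> real (card (perm_action.exceptional ar {1..a} {1..n} H (ar R) k)) / 2 ^ card (orbits ar H {1..n})"
    using eventually_ge_at_top[of "max a 1"]
  proof eventually_elim
    case (elim n)
    interpret perm_action ar "{1..a}" "{1..n}" H by (rule perm_action_atLeastAtMost[OF _ grp]) (use elim in simp)
    show ?case unfolding real_norm_def by (rule card_auts_eq_approx) (use R tr elim in auto)
  qed
qed (use R in simp)

text \<open>For \<open>n \<ge> a\<close> the number of points moved by \<open>h\<close> does not
  depend on \<open>n\<close>, so each Burnside summand is a power of a linear polynomial.\<close>

lemma card_orbits_poly:
  fixes ar :: "'r::finite \<Rightarrow> nat"
  assumes grp: "perm_group {1..a} H"
  shows "\<exists>p. \<forall>n\<ge>a. real (card (orbits ar H {1..n::nat})) = poly p (real n)"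
proof -
  define c where "c = (\<lambda>h :: nat \<Rightarrow> nat. card {x \<in> {1..a}. h x \<noteq> x})"
  define p where "p = smult (1 / real (card H)) (\<Sum>h\<in>H. \<Sum>R\<in>UNIV. [:- real (c h), 1:] ^ ar R)"
  have "real (card (orbits ar H {1..n})) = poly p (real n)" if n: "a \<le> n" for n
  proof -
    interpret perm_action ar "{1..a}" "{1..n}" H using perm_action_atLeastAtMost n grp .
    have H: "card H > 0" using finH perm_groupD(1)[OF grp] card_gt_0_iff by blast
    have fixed: "real (card {x \<in> {1..n}. h x = x}) = real n - real (c h)" if h: "h \<in> H" for h
    proof -
      have "{x \<in> {1..n}. h x = x} = {1..n} - {x \<in> {1..a}. h x \<noteq> x}"
        using fixes_outside[OF h] n by auto
      moreover have "card ({1..n} - {x \<in> {1..a}. h x \<noteq> x}) = n - c h"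
        using n by (subst card_Diff_subset) (auto simp: c_def)
      moreover have "c h \<le> n"
      proof -
        have "{x \<in> {1..a}. h x \<noteq> x} \<subseteq> {1..n}" using n by auto
        then have "c h \<le> card {1..n}" unfolding c_def by (rule card_mono[rotated]) simp
        then show ?thesis by simp
      qed
      ultimately show ?thesis by simp
    qed
    have "real (card (orbits ar H {1..n})) * real (card H) =
        (\<Sum>h\<in>H. \<Sum>R\<in>UNIV. real (card {x \<in> {1..n}. h x = x}) ^ ar R)"
      using arg_cong[OF card_orbits_burnside, of real] by simp
    also have "\<dots> = (\<Sum>h\<in>H. \<Sum>R\<in>UNIV. (real n - real (c h)) ^ ar R)" using fixed by simp
    finally show ?thesis using H by (simp add: p_def poly_sum field_simps)
  qed
  then show ?thesis by blast
qed

lemma power_diff_bound: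
  fixes n a m :: nat
  assumes "a \<le> n" "1 \<le> n" "m \<le> r"
  shows "n ^ m \<le> (n - a) ^ m + m * a * n ^ (r - 1)"
proof -
  have "n ^ m \<le> (n - a) ^ m + m * a * n ^ (m - 1)"
  proof (induction m)
    case (Suc m)
    have "n ^ Suc m = (n - a) * n ^ m + a * n ^ m" using assms by (simp flip: distrib_right)
    also have "(n - a) * n ^ m \<le> (n - a) * ((n - a) ^ m + m * a * n ^ (m - 1))"
      using Suc by (rule mult_le_mono2)
    also have "\<dots> \<le> (n - a) ^ Suc m + n * (m * a * n ^ (m - 1))" by (simp add: distrib_left)
    also have "n * (m * a * n ^ (m - 1)) = m * a * n ^ m" by (cases m) simp_all
    finally show ?case by (simp add: distrib_right)
  qed simp
  also have "m * a * n ^ (m - 1) \<le> m * a * n ^ (r - 1)"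
    using assms by (intro mult_le_mono2 power_increasing) auto
  finally show ?thesis by simp
qed

text \<open>Every element of \<open>H\<close> fixes at least \<open>n - a\<close> points, so
  invariance under \<open>H\<close> loses only \<open>O(n ^ (r - 1))\<close> binary choices compared
  with all structures.\<close>

lemma card_orbits_lower:
  fixes ar :: "'r::finite \<Rightarrow> nat"
  assumes grp: "perm_group {1..a} H" and n: "a \<le> n" "1 \<le> n" and r: "\<And>R. ar R \<le> r"
  shows "card (atoms ar {1..n::nat}) \<le> card (orbits ar H {1..n}) + (\<Sum>R\<in>UNIV. ar R * a) * n ^ (r - 1)"
proof -
  interpret perm_action ar "{1..a}" "{1..n}" H using perm_action_atLeastAtMost n(1) grp .
  have H: "card H > 0" using finH perm_groupD(1)[OF grp] card_gt_0_iff by blast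
  have "n - a \<le> card {x \<in> {1..n}. h x = x}" if h: "h \<in> H" for h
  proof -
    have "card {a<..n} \<le> card {x \<in> {1..n}. h x = x}"
      using fixes_outside[OF h] by (intro card_mono) auto
    then show ?thesis by simp
  qed
  then have "(\<Sum>h\<in>H. \<Sum>R\<in>UNIV. (n - a) ^ ar R) \<le> card (orbits ar H {1..n}) * card H"
    unfolding card_orbits_burnside by (intro sum_mono power_mono) auto
  then have 1: "(\<Sum>R\<in>UNIV. (n - a) ^ ar R) \<le> card (orbits ar H {1..n})"
    using H by (simp add: mult.commute)
  have "card (atoms ar {1..n}) = (\<Sum>R\<in>UNIV. n ^ ar R)" by (simp add: card_atoms)
  also have "\<dots> \<le> (\<Sum>R\<in>UNIV. (n - a) ^ ar R + ar R * a * n ^ (r - 1))"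
    using r n by (intro sum_mono power_diff_bound) auto
  finally show ?thesis using 1 by (simp add: sum.distrib sum_distrib_right)
qed

text \<open>Averaging: composing with an element that moves \<open>x\<close> injects the elements
  fixing \<open>x\<close> into those moving it, so every moved point is moved by at least half of
  \<open>H\<close>.\<close>

lemma exists_moving_half:
  assumes grp: "perm_group B H" and fin: "finite B"
  shows "\<exists>h\<in>H. card (moved H) \<le> 2 * card {x. h x \<noteq> x}"
proof (rule ccontr)
  assume "\<not> ?thesis"
  then have less: "2 * card {x. h x \<noteq> x} < card (moved H)" if "h \<in> H" for h using that by force
  have finH: "finite H" using perm_group_finite[OF grp fin] .
  have finM: "finite (moved H)" using perm_group_moved_subset[OF grp] fin finite_subset by blast
  have half: "card H \<le> 2 * card {h \<in> H. h x \<noteq> x}" if x: "x \<in> moved H" for x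
  proof -
    obtain g where g: "g \<in> H" "g x \<noteq> x" using x by (auto simp: moved_def)
    have "inj g" using perm_groupD(2)[OF grp g(1)] permutes_inj by blast
    have "card {h \<in> H. h x = x} \<le> card {h \<in> H. h x \<noteq> x}"
    proof (rule card_inj_on_le[where f = "\<lambda>h. g \<circ> h"])
      show "inj_on (\<lambda>h. g \<circ> h) {h \<in> H. h x = x}"
      proof (rule inj_onI, rule ext)
        fix h h' y assume "g \<circ> h = g \<circ> h'"
        then have "g (h y) = g (h' y)" by (metis comp_apply)
        then show "h y = h' y" using \<open>inj g\<close> by (simp add: inj_eq)
      qed
      show "(\<lambda>h. g \<circ> h) ` {h \<in> H. h x = x} \<subseteq> {h \<in> H. h x \<noteq> x}"
        using g perm_groupD(4)[OF grp] by auto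
    qed (use finH in simp)
    moreover have "card H = card {h \<in> H. h x = x} + card {h \<in> H. h x \<noteq> x}"
      using finH by (subst card_Un_disjoint[symmetric]) (auto intro!: arg_cong[where f = card])
    ultimately show ?thesis by simp
  qed
  have "card (moved H) * card H = (\<Sum>x\<in>moved H. card H)" by simp
  also have "\<dots> \<le> (\<Sum>x\<in>moved H. 2 * card {h \<in> H. h x \<noteq> x})" using half by (rule sum_mono)
  also have "\<dots> = 2 * (\<Sum>x\<in>moved H. \<Sum>h\<in>{h \<in> H. h x \<noteq> x}. 1)" by (simp add: sum_distrib_left)
  also have "(\<Sum>x\<in>moved H. \<Sum>h\<in>{h \<in> H. h x \<noteq> x}. 1) = (\<Sum>h\<in>H. \<Sum>x\<in>{x \<in> moved H. h x \<noteq> x}. 1)"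
    by (rule sum.swap_restrict[OF finM finH])
  also have "\<dots> = (\<Sum>h\<in>H. card {x. h x \<noteq> x})"
    by (intro sum.cong) (auto simp: moved_def intro!: arg_cong[where f = card])
  also have "2 * \<dots> = (\<Sum>h\<in>H. 2 * card {x. h x \<noteq> x})" by (simp add: sum_distrib_left)
  also have "\<dots> < (\<Sum>h\<in>H. card (moved H))"
    using less finH perm_groupD(1)[OF grp] by (intro sum_strict_mono) auto
  finally show False by (simp add: mult.commute)
qed

text \<open>The structures are counted among all structures, that is with \<open>A\<close> empty and
  the trivial group, but compared with those invariant under \<open>H\<close>; this comparison loses
  at most \<open>2 ^ (K * d n)\<close>. The support bound is \<open>2 * k\<close> because a single
  automorphism accounts for half of the moved points.\<close>

lemma large_support_negligible:
  fixes ar :: "'r::finite \<Rightarrow> nat"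
  assumes gH: "perm_group {1..a} H" and R: "2 \<le> ar R" "\<And>R'. ar R' \<le> ar R"
  shows "\<exists>T. (\<lambda>n. real (card {S. S \<subseteq> atoms ar {1..n::nat} \<and> T < card (moved (auts {1..n} S))}) /
    2 ^ card (orbits ar H {1..n})) \<longlonglongrightarrow> 0"
proof -
  define K where "K = (\<Sum>R\<in>UNIV. ar R * a)"
  \<comment> \<open>An automorphism moving \<open>k\<close> points costs
    \<open>x ^ (k * d n) = (1 / 2) ^ ((K + 1) * d n)\<close>. This cancels the loss
    \<open>2 ^ (K * d n)\<close> and leaves \<open>(1 / 2) ^ d n\<close>.\<close>
  define k where "k = 2 * K + 2"
  define x :: real where "x = 1 / sqrt 2"
  have x: "0 < x" "x < 1" by (auto simp: x_def)
  have x2: "x ^ 2 = 1 / 2" by (simp add: x_def power_divide)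
  define d where "d = (\<lambda>n::nat. n ^ (ar R - 1))"
  have dn: "n \<le> d n" for n using R by (cases "n = 0") (simp_all add: d_def self_le_power)
  define u where "u = (\<lambda>n. (real n)\<^sup>2 * x ^ d n)"
  have ule: "u n \<le> (real n + 1) ^ 2 * x ^ (n - 0)" for n
    unfolding u_def using x dn[of n] by (intro mult_mono power_mono) (auto intro!: power_decreasing)
  have G: "(\<lambda>n. (real n + 1) ^ (2 * k + 1) * (1 / 2) ^ (n - 0)) \<longlonglongrightarrow> (0::real)"
    by (rule Suc_power_times_geometric_tendsto_0) auto
  have "\<forall>\<^sub>F n in sequentially. (real n + 1) ^ 2 * x ^ (n - 0) < 1"
    by (rule order_tendstoD(2)[OF Suc_power_times_geometric_tendsto_0[OF x]]) simp
  then have "\<forall>\<^sub>F n in sequentially. norm (real (card {S. S \<subseteq> atoms ar {1..n::nat} \<and> 2 * k < card (moved (auts {1..n} S))}) /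
    2 ^ card (orbits ar H {1..n})) \<le> (real n + 1) ^ (2 * k + 1) * (1 / 2) ^ (n - 0)"
    using eventually_ge_at_top[of "max a 1"]
  proof eventually_elim
    case (elim n)
    interpret perm_action ar "{}" "{1..n}" "{id}"
      by unfold_locales (auto simp: perm_group_trivial)
    let ?X = "{S. S \<subseteq> atoms ar {1..n} \<and> 2 * k < card (moved (auts {1..n} S))}"
    have u1: "u n \<le> 1" using ule[of n] elim by linarith
    have "Inv ar {id} {1..n} = Pow (atoms ar {1..n})" by (auto simp: Inv_def)
    then have "(2::nat) ^ card (orbits ar {id} {1..n}) = 2 ^ card (atoms ar {1..n})"
      using card_Inv card_atoms(1)[of "{1..n}" ar] by (simp add: card_Pow)
    then have tot: "card (orbits ar {id} {1..n}) = card (atoms ar {1..n})" by simp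
    have "?X \<subseteq> {S \<in> Inv ar {id} {1..n}. \<exists>f\<in>auts {1..n} S. k \<le> card {x \<in> {1..n} - {}. f x \<noteq> x}}"
    proof clarify
      fix S assume S: "S \<subseteq> atoms ar {1..n}" "2 * k < card (moved (auts {1..n} S))"
      obtain f where f: "f \<in> auts {1..n} S" "card (moved (auts {1..n} S)) \<le> 2 * card {x. f x \<noteq> x}"
        using exists_moving_half[OF perm_group_auts] by blast
      have "{x \<in> {1..n} - {}. f x \<noteq> x} = {x. f x \<noteq> x}"
        using f(1) by (auto simp: auts_def permutes_def)
      then show "S \<in> Inv ar {id} {1..n} \<and> (\<exists>f\<in>auts {1..n} S. k \<le> card {x \<in> {1..n} - {}. f x \<noteq> x})"
        using S f by (intro conjI bexI[of _ f]) (auto simp: Inv_def)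
    qed
    then have "card ?X \<le> card {S \<in> Inv ar {id} {1..n}. \<exists>f\<in>auts {1..n} S. k \<le> card {x \<in> {1..n} - {}. f x \<noteq> x}}"
      using finite_Inv by (intro card_mono) auto
    then have "real (card ?X) \<le> real (card {S \<in> Inv ar {id} {1..n}. \<exists>f\<in>auts {1..n} S. k \<le> card {x \<in> {1..n} - {}. f x \<noteq> x}})"
      by simp
    also have "\<dots> \<le> 2 ^ card (atoms ar {1..n}) * ((real n + 1) * u n ^ k)"
      using card_Inv_moving[of R "u n" k] R u1 by (simp add: u_def x_def d_def tot[unfolded One_nat_def])
    also have "\<dots> \<le> 2 ^ (card (orbits ar H {1..n}) + K * d n) * ((real n + 1) * u n ^ k)"
      using card_orbits_lower[OF gH, of n ar "ar R"] R elim x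
      by (intro mult_right_mono power_increasing) (auto simp: K_def d_def u_def)
    also have "\<dots> = 2 ^ card (orbits ar H {1..n}) * ((real n + 1) * (real n) ^ (2 * k) * (2 ^ (K * d n) * x ^ (k * d n)))"
      by (simp add: u_def power_add power_mult_distrib power_mult[symmetric] mult_ac)
    also have "2 ^ (K * d n) * x ^ (k * d n) = (1 / 2) ^ d n"
    proof -
      have "x ^ (k * d n) = (x ^ 2) ^ ((K + 1) * d n)" by (simp add: k_def power_mult[symmetric] algebra_simps)
      also have "\<dots> = (1 / 2) ^ (K * d n) * (1 / 2) ^ d n" unfolding x2 by (simp add: power_add[symmetric] algebra_simps)
      finally show ?thesis by (simp add: power_divide)
    qed
    also have "2 ^ card (orbits ar H {1..n}) * ((real n + 1) * (real n) ^ (2 * k) * (1 / 2) ^ d n)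
      \<le> 2 ^ card (orbits ar H {1..n}) * ((real n + 1) * (real n + 1) ^ (2 * k) * (1 / 2) ^ n)"
      using dn[of n] by (intro mult_left_mono mult_mono power_mono power_decreasing) auto
    finally have "real (card ?X) \<le> 2 ^ card (orbits ar H {1..n}) * ((real n + 1) ^ (2 * k + 1) * (1 / 2) ^ n)"
      by simp
    then show ?case by (simp add: divide_le_eq mult.commute)
  qed
  from tendsto_0_if_norm_le[OF this G] show ?thesis by blast
qed

section \<open>Decomposing a class by the support\<close>

definition conj_perm :: "('a \<Rightarrow> 'a) \<Rightarrow> ('a \<Rightarrow> 'a) \<Rightarrow> 'a \<Rightarrow> 'a" where
  "conj_perm \<sigma> f = \<sigma> \<circ> f \<circ> inv \<sigma>"

definition conj_invariant :: "(('a \<Rightarrow> 'a) set \<Rightarrow> bool) \<Rightarrow> bool" where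
  "conj_invariant P \<longleftrightarrow> (\<forall>B H \<sigma>. finite B \<and> perm_group B H \<and> \<sigma> permutes B \<longrightarrow> P (conj_perm \<sigma> ` H) = P H)"

lemma inj_act: "\<sigma> permutes B \<Longrightarrow> inj (act \<sigma>)"
  by (rule inj_on_inverseI[where g = "act (inv \<sigma>)"]) (rule act_inv(1))

lemma act_mem_image: "\<sigma> permutes B \<Longrightarrow> act \<sigma> p \<in> act \<sigma> ` S \<longleftrightarrow> p \<in> S"
  by (rule inj_image_mem_iff[OF inj_act])

lemma conj_perm_permutes: "\<sigma> permutes B \<Longrightarrow> f permutes B \<Longrightarrow> conj_perm \<sigma> f permutes B"
  unfolding conj_perm_def by (intro permutes_compose permutes_inv)

lemma conj_perm_inv: "\<sigma> permutes B \<Longrightarrow> conj_perm (inv \<sigma>) (conj_perm \<sigma> f) = f"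
  "\<sigma> permutes B \<Longrightarrow> conj_perm \<sigma> (conj_perm (inv \<sigma>) f) = f"
  by (simp_all add: conj_perm_def fun_eq_iff permutes_inverses permutes_inv_inv)

lemma preserves_conj_perm:
  assumes \<sigma>: "\<sigma> permutes B" and f: "preserves f S"
  shows "preserves (conj_perm \<sigma> f) (act \<sigma> ` S)"
  unfolding preserves_def
proof
  fix p
  have "act (conj_perm \<sigma> f) p \<in> act \<sigma> ` S \<longleftrightarrow> act f (act (inv \<sigma>) p) \<in> S"
    by (simp add: conj_perm_def act_comp act_mem_image[OF \<sigma>])
  also have "\<dots> \<longleftrightarrow> act (inv \<sigma>) p \<in> S" using f by (rule preservesD)
  also have "\<dots> \<longleftrightarrow> act \<sigma> (act (inv \<sigma>) p) \<in> act \<sigma> ` S" by (simp only: act_mem_image[OF \<sigma>])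
  finally show "act (conj_perm \<sigma> f) p \<in> act \<sigma> ` S \<longleftrightarrow> p \<in> act \<sigma> ` S"
    by (simp only: act_inv(2)[OF \<sigma>])
qed

lemma act_inv_image: "\<sigma> permutes B \<Longrightarrow> act (inv \<sigma>) ` act \<sigma> ` S = S"
  by (simp add: image_image act_inv)

lemma auts_act:
  assumes \<sigma>: "\<sigma> permutes B"
  shows "auts B (act \<sigma> ` S) = conj_perm \<sigma> ` auts B S"
proof
  show "conj_perm \<sigma> ` auts B S \<subseteq> auts B (act \<sigma> ` S)"
    using preserves_conj_perm[OF \<sigma>] conj_perm_permutes[OF \<sigma>] by (auto simp: auts_def)
  show "auts B (act \<sigma> ` S) \<subseteq> conj_perm \<sigma> ` auts B S"
  proof
    fix f assume f: "f \<in> auts B (act \<sigma> ` S)"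
    have "conj_perm (inv \<sigma>) f \<in> auts B S"
      using f preserves_conj_perm[OF permutes_inv[OF \<sigma>], of f "act \<sigma> ` S"]
        conj_perm_permutes[OF permutes_inv[OF \<sigma>]]
      by (simp add: auts_def act_inv_image[OF \<sigma>])
    then show "f \<in> conj_perm \<sigma> ` auts B S" using conj_perm_inv(2)[OF \<sigma>, of f] by (metis imageI)
  qed
qed

lemma moved_conj_perm:
  assumes \<sigma>: "\<sigma> permutes B"
  shows "moved (conj_perm \<sigma> ` H) = \<sigma> ` moved H"
proof -
  have "x \<in> moved (conj_perm \<sigma> ` H) \<longleftrightarrow> inv \<sigma> x \<in> moved H" for x
    using permutes_inverses[OF \<sigma>] by (auto simp: moved_def conj_perm_def) metis+
  then show ?thesis using permutes_inverses[OF \<sigma>] by (auto simp: image_iff) metis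
qed

lemma exists_permutation_image:
  assumes "finite B" "A \<subseteq> B" "A' \<subseteq> B" "card A = card A'"
  shows "\<exists>\<sigma>. \<sigma> permutes B \<and> \<sigma> ` A = A'"
proof -
  have fin: "finite A" "finite A'" using assms finite_subset by blast+
  obtain f where f: "bij_betw f A A'" using finite_same_card_bij[OF fin assms(4)] by blast
  have "card (B - A) = card (B - A')" using assms fin by (simp add: card_Diff_subset)
  then obtain g where g: "bij_betw g (B - A) (B - A')"
    using finite_same_card_bij[of "B - A" "B - A'"] assms(1) by blast
  define \<sigma> where "\<sigma> = (\<lambda>x. if x \<in> A then f x else if x \<in> B then g x else x)"
  have 1: "bij_betw \<sigma> A A'" using f by (subst bij_betw_cong[of _ _ f]) (auto simp: \<sigma>_def)
  have 2: "bij_betw \<sigma> (B - A) (B - A')" using g by (subst bij_betw_cong[of _ _ g]) (auto simp: \<sigma>_def)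
  have "bij_betw \<sigma> (A \<union> (B - A)) (A' \<union> (B - A'))" by (rule bij_betw_combine[OF 1 2]) auto
  moreover have "A \<union> (B - A) = B" "A' \<union> (B - A') = B" using assms by auto
  ultimately have "\<sigma> permutes B" using assms(2) by (intro bij_imp_permutes) (auto simp: \<sigma>_def)
  then show ?thesis using 1 by (auto simp: bij_betw_def)
qed

lemma sat_act:
  assumes \<sigma>: "\<sigma> permutes B"
  shows "sat (structure_of B (act \<sigma> ` S)) (\<sigma> \<circ> e) \<phi> \<longleftrightarrow> sat (structure_of B S) e \<phi>"
proof (induction \<phi> arbitrary: e)
  case (Eq x y)
  then show ?case using permutes_inj[OF \<sigma>] by (simp add: inj_eq)
next
  case (Rel R xs)
  have "(R, map (\<sigma> \<circ> e) xs) = act \<sigma> (R, map e xs)" by (simp add: act_def)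
  then show ?case
    using act_mem_image[OF \<sigma>, of "(R, map e xs)" S] by (simp only: sat.simps structure_of_simps)
next
  case (Ex x \<phi>)
  have "(\<exists>a\<in>B. sat (structure_of B (act \<sigma> ` S)) ((\<sigma> \<circ> e)(x := a)) \<phi>) \<longleftrightarrow>
      (\<exists>a\<in>B. sat (structure_of B (act \<sigma> ` S)) ((\<sigma> \<circ> e)(x := \<sigma> a)) \<phi>)"
    using permutes_image[OF \<sigma>] by (metis (no_types, lifting) imageE imageI)
  moreover have "(\<sigma> \<circ> e)(x := \<sigma> a) = \<sigma> \<circ> e(x := a)" for a by auto
  ultimately show ?case by (simp only: sat.simps structure_of_simps Ex.IH)
qed simp_all

lemma models_act:
  assumes \<sigma>: "\<sigma> permutes B" and "structure_of B S \<Turnstile> \<phi>"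
  shows "structure_of B (act \<sigma> ` S) \<Turnstile> \<phi>"
  unfolding models_def
proof (intro allI impI)
  fix e :: "nat \<Rightarrow> 'a" assume "range e \<subseteq> universe (structure_of B (act \<sigma> ` S))"
  then have "range (inv \<sigma> \<circ> e) \<subseteq> B" using permutes_in_image[OF permutes_inv[OF \<sigma>]] by auto
  then have "sat (structure_of B S) (inv \<sigma> \<circ> e) \<phi>" using assms(2) by (simp add: models_def)
  then have "sat (structure_of B (act \<sigma> ` S)) (\<sigma> \<circ> (inv \<sigma> \<circ> e)) \<phi>" by (simp only: sat_act[OF \<sigma>])
  moreover have "\<sigma> \<circ> (inv \<sigma> \<circ> e) = e" using permutes_inverses[OF \<sigma>] by auto
  ultimately show "sat (structure_of B (act \<sigma> ` S)) e \<phi>" by simp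
qed

text \<open>Relabelling by a permutation that carries \<open>A\<close> to \<open>A'\<close> is
  injective on structures; exchanging \<open>A\<close> and \<open>A'\<close> yields
  equality.\<close>

lemma card_moved_transport:
  fixes ar :: "'r::finite \<Rightarrow> nat"
  assumes "finite B" "A \<subseteq> B" "A' \<subseteq> B" "card A = card A'" and P: "conj_invariant P"
    and \<Psi>: "\<And>\<sigma> S. \<sigma> permutes B \<Longrightarrow> \<Psi> S \<Longrightarrow> \<Psi> (act \<sigma> ` S)"
  shows "card {S. S \<subseteq> atoms ar B \<and> P (auts B S) \<and> \<Psi> S \<and> moved (auts B S) = A} \<le>
    card {S. S \<subseteq> atoms ar B \<and> P (auts B S) \<and> \<Psi> S \<and> moved (auts B S) = A'}"
proof -
  obtain \<sigma> where \<sigma>: "\<sigma> permutes B" "\<sigma> ` A = A'" using exists_permutation_image[OF assms(1-4)] by blast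
  show ?thesis
  proof (rule card_inj_on_le[where f = "\<lambda>S. act \<sigma> ` S"])
    show "inj_on (\<lambda>S. act \<sigma> ` S) {S. S \<subseteq> atoms ar B \<and> P (auts B S) \<and> \<Psi> S \<and> moved (auts B S) = A}"
      by (rule inj_onI) (metis act_inv_image[OF \<sigma>(1)])
    show "finite {S. S \<subseteq> atoms ar B \<and> P (auts B S) \<and> \<Psi> S \<and> moved (auts B S) = A'}"
      by (rule finite_subset[of _ "Pow (atoms ar B)"]) (auto simp: card_atoms(1) assms(1))
    have "P (auts B (act \<sigma> ` S)) = P (auts B S)" for S :: "('r \<times> 'a list) set"
      using P assms(1) \<sigma>(1) perm_group_auts[of B S] unfolding conj_invariant_def auts_act[OF \<sigma>(1)] by blast
    moreover have "act \<sigma> ` S \<subseteq> atoms ar B" if "S \<subseteq> atoms ar B" for S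
      using that act_mem_atoms[OF \<sigma>(1)] by blast
    moreover have "moved (auts B (act \<sigma> ` S)) = A'" if "moved (auts B S) = A" for S :: "('r \<times> 'a list) set"
      using that \<sigma> by (simp add: auts_act[OF \<sigma>(1)] moved_conj_perm[OF \<sigma>(1)])
    ultimately show "(\<lambda>S. act \<sigma> ` S) ` {S. S \<subseteq> atoms ar B \<and> P (auts B S) \<and> \<Psi> S \<and> moved (auts B S) = A}
      \<subseteq> {S. S \<subseteq> atoms ar B \<and> P (auts B S) \<and> \<Psi> S \<and> moved (auts B S) = A'}"
      using \<Psi>[OF \<sigma>(1)] by blast
  qed
qed

definition groups_moving :: "nat \<Rightarrow> (nat \<Rightarrow> nat) set set" where
  "groups_moving a = {H. perm_group {1..a} H \<and> moved H = {1..a}}"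

lemma finite_groups_moving: "finite (groups_moving a)"
  by (rule finite_subset[of _ "Pow {h. h permutes {1..a}}"])
    (auto simp: groups_moving_def perm_group_def finite_permutations)

lemma auts_in_groups_moving: "moved (auts {1..n} S) = {1..a} \<Longrightarrow> auts {1..n} S \<in> groups_moving a"
  using perm_group_on_moved[OF perm_group_auts, of "{1..n}" S] by (simp add: groups_moving_def)

text \<open>Structures are sorted by their moved set, of which only the cardinality matters, and
  then by the group itself; \<open>n choose a\<close> counts the possible moved sets.\<close>

lemma card_class_decomposition:
  fixes ar :: "'r::finite \<Rightarrow> nat"
  assumes P: "conj_invariant P" and \<Psi>: "\<And>\<sigma> S. \<sigma> permutes {1..n} \<Longrightarrow> \<Psi> S \<Longrightarrow> \<Psi> (act \<sigma> ` S)"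
    and T: "T \<le> n"
  shows "card {S. S \<subseteq> atoms ar {1..n::nat} \<and> P (auts {1..n} S) \<and> \<Psi> S} =
    (\<Sum>(a, H)\<in>(SIGMA a:{..T}. {H \<in> groups_moving a. P H}).
        (n choose a) * card {S. S \<subseteq> atoms ar {1..n} \<and> auts {1..n} S = H \<and> \<Psi> S}) +
    card {S. S \<subseteq> atoms ar {1..n} \<and> P (auts {1..n} S) \<and> \<Psi> S \<and> T < card (moved (auts {1..n} S))}"
proof -
  let ?B = "{1..n}"
  let ?C = "{S. S \<subseteq> atoms ar ?B \<and> P (auts ?B S) \<and> \<Psi> S}"
  let ?m = "\<lambda>S. moved (auts ?B S)"
  let ?X = "\<lambda>A. {S \<in> ?C. ?m S = A}"
  let ?rest = "{S \<in> ?C. T < card (?m S)}"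
  have finC: "finite ?C"
    by (rule finite_subset[of _ "Pow (atoms ar ?B)"]) (auto simp: card_atoms(1))
  have mB: "?m S \<subseteq> ?B" for S :: "('r \<times> nat list) set" using perm_group_moved_subset[OF perm_group_auts] .
  have trans: "card (?X A) = card (?X A')" if "A \<subseteq> ?B" "A' \<subseteq> ?B" "card A = card A'" for A A'
  proof (rule antisym)
    have eq: "?X A = {S. S \<subseteq> atoms ar ?B \<and> P (auts ?B S) \<and> \<Psi> S \<and> ?m S = A}" for A by auto
    show "card (?X A) \<le> card (?X A')" "card (?X A') \<le> card (?X A)"
      unfolding eq using that by (intro card_moved_transport P \<Psi>; simp)+
  qed
  let ?small = "{S \<in> ?C. card (?m S) \<le> T}"
  have finS: "finite ?small" "finite ?rest" "finite (?X A)" for A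
    by (rule finite_subset[OF _ finC]; blast)+
  have "?C = ?small \<union> ?rest" by auto
  then have "card ?C = card (?small \<union> ?rest)" by (rule arg_cong)
  also have "\<dots> = card ?small + card ?rest" by (rule card_Un_disjoint[OF finS(1,2)]) auto
  finally have 1: "card ?C = card ?small + card ?rest" .
  have "card ?small = (\<Sum>S\<in>?small. 1)" by simp
  also have "\<dots> = (\<Sum>A\<in>{A. A \<subseteq> ?B \<and> card A \<le> T}. \<Sum>S\<in>{S \<in> ?small. ?m S = A}. 1)"
    by (rule sum.group[symmetric, OF finS(1)]) (use mB in auto)
  also have "\<dots> = (\<Sum>A\<in>{A. A \<subseteq> ?B \<and> card A \<le> T}. card (?X A))"
    by (intro sum.cong) (auto intro!: arg_cong[where f = card])
  also have "\<dots> = (\<Sum>a\<in>{..T}. \<Sum>A\<in>{A \<in> {A. A \<subseteq> ?B \<and> card A \<le> T}. card A = a}. card (?X A))"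
    by (intro sum.group[symmetric]) auto
  \<comment> \<open>\<open>T \<le> n\<close> makes the representative \<open>{1..a}\<close> fit into
    the universe.\<close>
  also have "\<dots> = (\<Sum>a\<in>{..T}. \<Sum>A\<in>{A. A \<subseteq> ?B \<and> card A = a}. card (?X {1..a}))"
    using T by (intro sum.cong trans) auto
  also have "\<dots> = (\<Sum>a\<in>{..T}. (n choose a) * card (?X {1..a}))" by (simp add: n_subsets)
  also have "\<dots> = (\<Sum>a\<in>{..T}. \<Sum>H\<in>{H \<in> groups_moving a. P H}.
      (n choose a) * card {S. S \<subseteq> atoms ar ?B \<and> auts ?B S = H \<and> \<Psi> S})"
  proof (rule sum.cong[OF refl])
    fix a
    have "card (?X {1..a}) = (\<Sum>S\<in>?X {1..a}. 1)" by simp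
    also have "\<dots> = (\<Sum>H\<in>{H \<in> groups_moving a. P H}. \<Sum>S\<in>{S \<in> ?X {1..a}. auts ?B S = H}. 1)"
      by (rule sum.group[symmetric, OF finS(3)]) (use finite_groups_moving auts_in_groups_moving in auto)
    also have "\<dots> = (\<Sum>H\<in>{H \<in> groups_moving a. P H}. card {S. S \<subseteq> atoms ar ?B \<and> auts ?B S = H \<and> \<Psi> S})"
    proof (rule sum.cong[OF refl])
      fix H assume "H \<in> {H \<in> groups_moving a. P H}"
      then have "{S \<in> ?X {1..a}. auts ?B S = H} = {S. S \<subseteq> atoms ar ?B \<and> auts ?B S = H \<and> \<Psi> S}"
        by (auto simp: groups_moving_def)
      then show "(\<Sum>S\<in>{S \<in> ?X {1..a}. auts ?B S = H}. 1) = card {S. S \<subseteq> atoms ar ?B \<and> auts ?B S = H \<and> \<Psi> S}"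
        by simp
    qed
    finally show "(n choose a) * card (?X {1..a}) = (\<Sum>H\<in>{H \<in> groups_moving a. P H}.
      (n choose a) * card {S. S \<subseteq> atoms ar ?B \<and> auts ?B S = H \<and> \<Psi> S})" by (simp add: sum_distrib_left)
  qed
  also have "\<dots> = (\<Sum>(a, H)\<in>(SIGMA a:{..T}. {H \<in> groups_moving a. P H}).
        (n choose a) * card {S. S \<subseteq> atoms ar ?B \<and> auts ?B S = H \<and> \<Psi> S})"
    using finite_groups_moving by (intro sum.Sigma) auto
  finally have "card ?small = (\<Sum>(a, H)\<in>(SIGMA a:{..T}. {H \<in> groups_moving a. P H}).
        (n choose a) * card {S. S \<subseteq> atoms ar ?B \<and> auts ?B S = H \<and> \<Psi> S})" .
  moreover have "?rest = {S. S \<subseteq> atoms ar ?B \<and> P (auts ?B S) \<and> \<Psi> S \<and> T < card (?m S)}" by auto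
  ultimately show ?thesis using 1 by simp
qed

section \<open>Limits for conjugation-invariant classes\<close>

definition class_size ::
    "('r \<Rightarrow> nat) \<Rightarrow> ((nat \<Rightarrow> nat) set \<Rightarrow> bool) \<Rightarrow> (nat \<Rightarrow> ('r \<times> nat list) set \<Rightarrow> bool) \<Rightarrow> nat \<Rightarrow> nat" where
  "class_size ar P \<Psi> n = card {S. S \<subseteq> atoms ar {1..n} \<and> P (auts {1..n} S) \<and> \<Psi> n S}"

text \<open>Divided by \<open>card (Inv ar H {1..a})\<close>, this is the probability that a uniform
  trace yields exactly \<open>H\<close> and satisfies \<open>tr\<close>.\<close>

definition forced_count ::
    "('r \<Rightarrow> nat) \<Rightarrow> nat \<Rightarrow> (('r \<times> nat list) set \<Rightarrow> bool) \<Rightarrow> nat \<times> (nat \<Rightarrow> nat) set \<Rightarrow> nat" where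
  "forced_count ar r tr = (\<lambda>(a, H). card {N \<in> Inv ar H {1..a}. forced_group r {1..a} H N = H \<and> tr N})"

text \<open>\<open>n ^ a\<close> replaces the number \<open>n choose a\<close> of moved sets, up to
  the asymptotic factor \<open>fact a\<close>.\<close>

definition weight :: "('r \<Rightarrow> nat) \<Rightarrow> nat \<times> (nat \<Rightarrow> nat) set \<Rightarrow> nat \<Rightarrow> real" where
  "weight ar = (\<lambda>(a, H) n. real n ^ a * 2 ^ card (orbits ar H {1..n}))"

lemma weight_pos: "0 < n \<Longrightarrow> 0 < weight ar i n"
  by (cases i) (simp add: weight_def)

lemma weight_nonneg: "0 \<le> weight ar i n"
  by (cases i) (simp add: weight_def)

lemma weight_comparable:
  fixes ar :: "'r::finite \<Rightarrow> nat"
  assumes "perm_group {1..a} H" "perm_group {1..b} K"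
  shows "(\<exists>c\<in>\<rat>. (\<lambda>n. weight ar (a, H) n / weight ar (b, K) n) \<longlonglongrightarrow> c) \<or>
    (\<lambda>n. weight ar (b, K) n / weight ar (a, H) n) \<longlonglongrightarrow> 0"
proof -
  obtain p where "\<forall>n\<ge>a. real (card (orbits ar H {1..n})) = poly p (real n)"
    using card_orbits_poly[OF assms(1), of ar] by blast
  then have p: "\<forall>\<^sub>F n in sequentially. real (card (orbits ar H {1..n})) = poly p (real n)"
    unfolding eventually_sequentially by blast
  obtain q where "\<forall>n\<ge>b. real (card (orbits ar K {1..n})) = poly q (real n)"
    using card_orbits_poly[OF assms(2), of ar] by blast
  then have q: "\<forall>\<^sub>F n in sequentially. real (card (orbits ar K {1..n})) = poly q (real n)"
    unfolding eventually_sequentially by blast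
  show ?thesis using weights_comparable[OF p q] unfolding weight_def prod.case .
qed

lemma forced_count_le:
  fixes ar :: "'r::finite \<Rightarrow> nat"
  assumes "perm_group {1..a} H"
  shows "forced_count ar r tr (a, H) \<le> 2 ^ card (orbits ar H {1..a})"
proof -
  interpret perm_action ar "{1..a}" "{1..a}" H by (rule perm_action_atLeastAtMost[OF order.refl assms])
  have "forced_count ar r tr (a, H) \<le> card (Inv ar H {1..a})"
    unfolding forced_count_def prod.case by (rule card_mono[OF finite_Inv]) auto
  then show ?thesis unfolding card_Inv .
qed

text \<open>After division by the dominating weight \<open>weight ar j\<close>, the size of the class is
  asymptotically a combination of finitely many weight quotients; only the integers
  \<open>forced_count ar r tr i\<close>, which are bounded, depend on the property \<open>\<Psi>\<close>.\<close>

lemma class_size_over_weight_tendsto: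
  fixes ar :: "'r::finite \<Rightarrow> nat"
  assumes P: "conj_invariant P" and R: "2 \<le> ar R" "\<And>R'. ar R' \<le> ar R"
    and H0: "perm_group {1..a0} H0"
    and T: "(\<lambda>n. real (card {S. S \<subseteq> atoms ar {1..n::nat} \<and> T < card (moved (auts {1..n} S))}) /
      2 ^ card (orbits ar H0 {1..n})) \<longlonglongrightarrow> 0"
    and J: "J = (SIGMA a:{..T}. {H \<in> groups_moving a. P H})"
    and J': "J' = {i \<in> J. 0 < forced_count ar (ar R) (\<lambda>_. True) i}"
    and lam: "\<And>i. i \<in> insert (a0, H0) J' \<Longrightarrow> (\<lambda>n. weight ar i n / weight ar j n) \<longlonglongrightarrow> \<mu> i"
    and \<Psi>: "\<And>n \<sigma> S. \<sigma> permutes {1..n} \<Longrightarrow> \<Psi> n S \<Longrightarrow> \<Psi> n (act \<sigma> ` S)"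
    and tr: "\<And>a H n S. perm_group {1..a} H \<Longrightarrow> a \<le> n \<Longrightarrow> 1 \<le> n \<Longrightarrow> S \<in> Inv ar H {1..n} \<Longrightarrow>
      extendable ar {1..a} H k {1..n} S \<Longrightarrow> \<Psi> n S \<longleftrightarrow> tr (a, H) (S \<inter> atoms ar {1..a})"
  shows "(\<lambda>n. class_size ar P \<Psi> n / weight ar j n) \<longlonglongrightarrow>
    (\<Sum>i\<in>J'. 1 / fact (fst i) * (forced_count ar (ar R) (tr i) i / 2 ^ card (orbits ar (snd i) {1..fst i})) * \<mu> i)"
proof -
  let ?N = "\<lambda>i n. card {S. S \<subseteq> atoms ar {1..n} \<and> auts {1..n} S = snd i \<and> \<Psi> n S}"
  let ?rest = "\<lambda>n. card {S. S \<subseteq> atoms ar {1..n} \<and> P (auts {1..n} S) \<and> \<Psi> n S \<and> T < card (moved (auts {1..n} S))}"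
  let ?big = "\<lambda>n. card {S. S \<subseteq> atoms ar {1..n} \<and> T < card (moved (auts {1..n} S))}"
  let ?E = "\<lambda>i n. 2 ^ card (orbits ar (snd i) {1..n}) :: real"
  have finJ: "finite J" unfolding J using finite_groups_moving by (intro finite_SigmaI) auto
  have grpJ: "perm_group {1..fst i} (snd i)" if "i \<in> J" for i
    using that by (auto simp: J groups_moving_def)
  \<comment> \<open>Exact vanishing is essential: a proportion tending to 0 would not suffice, as
    the weight of \<open>i\<close> need not be bounded by that of \<open>j\<close>.\<close>
  have zero: "?N i n = 0" if i: "i \<in> J" "i \<notin> J'" and n: "fst i \<le> n" for i n
  proof -
    interpret perm_action ar "{1..fst i}" "{1..n}" "snd i"
      using perm_action_atLeastAtMost[OF n grpJ[OF i(1)]] .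
    have none: "{N \<in> Inv ar (snd i) {1..fst i}. forced_group (ar R) {1..fst i} (snd i) N = snd i} = {}"
    proof -
      have "finite {N \<in> Inv ar (snd i) {1..fst i}. forced_group (ar R) {1..fst i} (snd i) N = snd i}"
        by (rule finite_subset[OF _ perm_action.finite_Inv[OF perm_action_A]]) blast
      moreover have "card {N \<in> Inv ar (snd i) {1..fst i}. forced_group (ar R) {1..fst i} (snd i) N = snd i} = 0"
        using i by (simp add: J' forced_count_def case_prod_beta)
      ultimately show ?thesis by (simp only: card_0_eq)
    qed
    have "auts {1..n} S \<noteq> snd i" if S: "S \<subseteq> atoms ar {1..n}" for S
    proof
      assume eq: "auts {1..n} S = snd i"
      then have "S \<in> Inv ar (snd i) {1..n}" using S by (auto simp: Inv_def auts_def)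
      then show False using forced_group_of_auts_eq[OF _ R(2) eq] trace_Inv none by blast
    qed
    then have "{S. S \<subseteq> atoms ar {1..n} \<and> auts {1..n} S = snd i \<and> \<Psi> n S} = {}" by blast
    then show ?thesis by (simp only: card.empty)
  qed
  have finS: "finite {S. S \<subseteq> atoms ar {1..n} \<and> Q S}" for Q and n :: nat
    by (rule finite_subset[of _ "Pow (atoms ar {1..n})"]) (auto simp: card_atoms(1))
  have summand: "(\<lambda>n. (real (n choose fst i) / real n ^ fst i) * (?N i n / ?E i n) * (weight ar i n / weight ar j n)) \<longlonglongrightarrow>
    1 / fact (fst i) * (forced_count ar (ar R) (tr i) i / ?E i (fst i)) * \<mu> i" if i: "i \<in> J'" for i
  proof (intro tendsto_mult)
    show "(\<lambda>n. real (n choose fst i) / real n ^ fst i) \<longlonglongrightarrow> 1 / fact (fst i)"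
      by (rule binomial_over_power_tendsto)
    have "i \<in> J" using i J' by simp
    note grp = grpJ[OF this]
    have "(\<lambda>n. ?N i n / ?E i n) \<longlonglongrightarrow>
      real (card {N \<in> Inv ar (snd i) {1..fst i}. forced_group (ar R) {1..fst i} (snd i) N = snd i \<and> tr i N}) / ?E i (fst i)"
    proof (rule auts_eq_proportion_tendsto[where ar = ar and R = R and k = k, OF grp R])
      show "\<Psi> n S = tr i (S \<inter> atoms ar {1..fst i})"
        if "fst i \<le> n" "1 \<le> n" "S \<in> Inv ar (snd i) {1..n}" "extendable ar {1..fst i} (snd i) k {1..n} S" for n S
        using tr[OF grp that] by simp
    qed
    then show "(\<lambda>n. ?N i n / ?E i n) \<longlonglongrightarrow> forced_count ar (ar R) (tr i) i / ?E i (fst i)"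
      by (simp add: forced_count_def case_prod_beta)
  qed (use lam i in simp)
  have "(\<lambda>n. ?big n / ?E (a0, H0) n * (weight ar (a0, H0) n / weight ar j n)) \<longlonglongrightarrow> 0 * \<mu> (a0, H0)"
    using T lam[of "(a0, H0)"] by (intro tendsto_mult) simp_all
  then have big: "(\<lambda>n. ?big n / ?E (a0, H0) n * (weight ar (a0, H0) n / weight ar j n)) \<longlonglongrightarrow> 0" by simp
  \<comment> \<open>Large supports are negligible against the structures invariant under
    \<open>H0\<close>, hence against the weight of \<open>(a0, H0)\<close>, whose quotient by the
    weight of \<open>j\<close> converges.\<close>
  have rest: "(\<lambda>n. ?rest n / weight ar j n) \<longlonglongrightarrow> 0"
  proof (rule tendsto_0_if_norm_le[OF _ big])
    show "\<forall>\<^sub>F n in sequentially. norm (?rest n / weight ar j n) \<le> ?big n / ?E (a0, H0) n * (weight ar (a0, H0) n / weight ar j n)"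
      using eventually_gt_at_top[of 0]
    proof eventually_elim
      case (elim n)
      have "?rest n \<le> ?big n" by (rule card_mono[OF finS]) auto
      then have "real (?rest n) \<le> real (?big n) * 1" by simp
      also have "\<dots> \<le> real (?big n) * real n ^ a0" using elim by (intro mult_left_mono one_le_power) auto
      finally have "?rest n / weight ar j n \<le> ?big n * real n ^ a0 / weight ar j n"
        using weight_pos[OF elim, of ar j] by (intro divide_right_mono) auto
      also have "\<dots> = ?big n / ?E (a0, H0) n * (weight ar (a0, H0) n / weight ar j n)"
        by (simp add: weight_def[of ar] )
      finally show ?case using weight_pos[OF elim, of ar j] by simp
    qed
  qed
  have "(\<lambda>n. (\<Sum>i\<in>J'. (real (n choose fst i) / real n ^ fst i) * (?N i n / ?E i n) * (weight ar i n / weight ar j n)) +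
      ?rest n / weight ar j n) \<longlonglongrightarrow>
    (\<Sum>i\<in>J'. 1 / fact (fst i) * (forced_count ar (ar R) (tr i) i / ?E i (fst i)) * \<mu> i) + 0"
    by (intro tendsto_add tendsto_sum summand rest)
  moreover have "\<forall>\<^sub>F n in sequentially. (\<Sum>i\<in>J'. (real (n choose fst i) / real n ^ fst i) * (?N i n / ?E i n) * (weight ar i n / weight ar j n)) +
      ?rest n / weight ar j n = class_size ar P \<Psi> n / weight ar j n"
    using eventually_ge_at_top[of "max T 1"]
  proof eventually_elim
    case (elim n)
    have "class_size ar P \<Psi> n = (\<Sum>(a, H)\<in>J. (n choose a) * card {S. S \<subseteq> atoms ar {1..n} \<and> auts {1..n} S = H \<and> \<Psi> n S}) + ?rest n"
      unfolding class_size_def J by (rule card_class_decomposition[where \<Psi> = "\<Psi> n", OF P \<Psi>]) (use elim in simp_all)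
    also have "(\<Sum>(a, H)\<in>J. (n choose a) * card {S. S \<subseteq> atoms ar {1..n} \<and> auts {1..n} S = H \<and> \<Psi> n S})
      = (\<Sum>i\<in>J. (n choose fst i) * ?N i n)" by (simp add: case_prod_beta)
    also have "\<dots> = (\<Sum>i\<in>J'. (n choose fst i) * ?N i n)"
    proof (rule sum.mono_neutral_right[OF finJ])
      show "\<forall>i\<in>J - J'. (n choose fst i) * ?N i n = 0"
      proof
        fix i assume i: "i \<in> J - J'"
        then have "fst i \<le> n" using elim by (auto simp: J)
        then have "?N i n = 0" using zero i by blast
        then show "(n choose fst i) * ?N i n = 0" by (simp only: mult_0_right)
      qed
    qed (auto simp: J')
    finally have "real (class_size ar P \<Psi> n) = (\<Sum>i\<in>J'. real (n choose fst i) * real (?N i n)) + real (?rest n)"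
      by (simp only: of_nat_add of_nat_sum of_nat_mult)
    moreover have "real (n choose fst i) * real (?N i n) / weight ar j n =
        (real (n choose fst i) / real n ^ fst i) * (?N i n / ?E i n) * (weight ar i n / weight ar j n)" for i
      using elim by (simp add: weight_def[of ar] case_prod_beta)
    ultimately show ?case by (simp only: add_divide_distrib sum_divide_distrib)
  qed
  ultimately show ?thesis by (simp add: tendsto_cong)
qed

theorem class_limits:
  fixes ar :: "'r::finite \<Rightarrow> nat"
  assumes P: "conj_invariant P" and R: "2 \<le> ar R" "\<And>R'. ar R' \<le> ar R"
  shows "\<exists>A :: real set. finite A \<and> A \<subseteq> \<rat> \<and> (\<forall>\<phi>. sentence ar \<phi> \<longrightarrow>
    (\<exists>l\<in>A. (\<lambda>n. class_size ar P (\<lambda>n S. structure_of {1..n} S \<Turnstile> \<phi>) n / class_size ar P (\<lambda>_ _. True) n) \<longlonglongrightarrow> l))"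
proof (cases "\<exists>n S. 1 \<le> n \<and> S \<subseteq> atoms ar {1..n} \<and> P (auts {1..n} S)")
  case False
  \<comment> \<open>An empty class has all proportions 0 by the convention for division by
    0.\<close>
  then have "class_size ar P \<Psi> n = 0" if "1 \<le> n" for \<Psi> n
    using that by (auto simp: class_size_def card_eq_0_iff)
  then have "\<forall>\<^sub>F n in sequentially. class_size ar P \<Psi> n / class_size ar P \<Psi>' n = (0::real)" for \<Psi> \<Psi>'
    by (intro eventually_sequentiallyI[of 1]) simp
  then have "(\<lambda>n. class_size ar P \<Psi> n / class_size ar P \<Psi>' n :: real) \<longlonglongrightarrow> 0" for \<Psi> \<Psi>'
    by (rule tendsto_eventually)
  then show ?thesis by (intro exI[of _ "{0}"]) simp
next
  case True
  \<comment> \<open>One member of the class, relabelled so that its moved set is an initial segment,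
    provides a group \<open>H0\<close> that is known to occur and against which large supports are
    negligible.\<close>
  then obtain n0 S0 where S0: "S0 \<subseteq> atoms ar {1..n0}" "P (auts {1..n0} S0)" by blast
  define a0 where "a0 = card (moved (auts {1..n0} S0))"
  have m: "moved (auts {1..n0} S0) \<subseteq> {1..n0}" by (rule perm_group_moved_subset[OF perm_group_auts])
  then have a0n: "a0 \<le> n0" unfolding a0_def using card_mono[of "{1..n0}"] by fastforce
  then obtain \<sigma> where \<sigma>: "\<sigma> permutes {1..n0}" "\<sigma> ` moved (auts {1..n0} S0) = {1..a0}"
    using exists_permutation_image[OF _ m, of "{1..a0}"] by (auto simp: a0_def)
  define S1 where "S1 = act \<sigma> ` S0"
  define H0 where "H0 = auts {1..n0} S1"
  have S1: "S1 \<subseteq> atoms ar {1..n0}" using S0(1) act_mem_atoms[OF \<sigma>(1)] unfolding S1_def by blast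
  have H0_eq: "H0 = conj_perm \<sigma> ` auts {1..n0} S0" unfolding H0_def S1_def by (rule auts_act[OF \<sigma>(1)])
  have PH0: "P H0"
    using P S0(2) \<sigma>(1) perm_group_auts[of "{1..n0}" S0] unfolding H0_eq conj_invariant_def by blast
  have H0: "H0 \<in> groups_moving a0"
    unfolding H0_def proof (rule auts_in_groups_moving)
    show "moved (auts {1..n0} S1) = {1..a0}"
      unfolding S1_def auts_act[OF \<sigma>(1)] moved_conj_perm[OF \<sigma>(1)] by (rule \<sigma>(2))
  qed
  then have grp0: "perm_group {1..a0} H0" by (simp add: groups_moving_def)
  obtain T' where T': "(\<lambda>n. real (card {S. S \<subseteq> atoms ar {1..n::nat} \<and> T' < card (moved (auts {1..n} S))}) /
    2 ^ card (orbits ar H0 {1..n})) \<longlonglongrightarrow> 0"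
    using large_support_negligible[where ar = ar and R = R, OF grp0 R] by blast
  \<comment> \<open>Raised to at least \<open>a0\<close> so that \<open>(a0, H0)\<close> is among
    the groups kept.\<close>
  define T where "T = max T' a0"
  have T: "(\<lambda>n. real (card {S. S \<subseteq> atoms ar {1..n::nat} \<and> T < card (moved (auts {1..n} S))}) /
    2 ^ card (orbits ar H0 {1..n})) \<longlonglongrightarrow> 0"
  proof (rule tendsto_0_if_norm_le[OF always_eventually T'], rule allI)
    fix n :: nat
    have "finite {S. S \<subseteq> atoms ar {1..n} \<and> T' < card (moved (auts {1..n} S))}"
      by (rule finite_subset[of _ "Pow (atoms ar {1..n})"]) (auto simp: card_atoms(1))
    then have "card {S. S \<subseteq> atoms ar {1..n} \<and> T < card (moved (auts {1..n} S))}
      \<le> card {S. S \<subseteq> atoms ar {1..n} \<and> T' < card (moved (auts {1..n} S))}"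
      by (rule card_mono) (auto simp: T_def)
    then show "norm (real (card {S. S \<subseteq> atoms ar {1..n::nat} \<and> T < card (moved (auts {1..n} S))}) /
    2 ^ card (orbits ar H0 {1..n})) \<le> real (card {S. S \<subseteq> atoms ar {1..n::nat} \<and> T' < card (moved (auts {1..n} S))}) /
    2 ^ card (orbits ar H0 {1..n})"
      by (simp add: divide_right_mono)
  qed
  define J where "J = (SIGMA a:{..T}. {H \<in> groups_moving a. P H})"
  define J' where "J' = {i \<in> J. 0 < forced_count ar (ar R) (\<lambda>_. True) i}"
  have finJ: "finite J" unfolding J_def using finite_groups_moving by (intro finite_SigmaI) auto
  then have finJ': "finite J'" by (simp add: J'_def)
  have grpJ: "perm_group {1..fst i} (snd i)" if "i \<in> J'" for i
    using that by (auto simp: J_def J'_def groups_moving_def)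
  \<comment> \<open>The trace of the relabelled member is itself a witness.\<close>
  have i0: "(a0, H0) \<in> J'"
  proof -
    interpret perm_action ar "{1..a0}" "{1..n0}" H0 by (rule perm_action_atLeastAtMost[OF a0n grp0])
    have inv: "S1 \<in> Inv ar H0 {1..n0}" using S1 by (auto simp: Inv_def H0_def auts_def)
    have "S1 \<inter> atoms ar {1..a0} \<in> {N \<in> Inv ar H0 {1..a0}. forced_group (ar R) {1..a0} H0 N = H0}"
      using forced_group_of_auts_eq[OF inv R(2)] trace_Inv[OF inv] by (simp add: H0_def)
    moreover have "finite (Inv ar H0 {1..a0})" by (rule perm_action.finite_Inv[OF perm_action_A])
    ultimately have "0 < forced_count ar (ar R) (\<lambda>_. True) (a0, H0)"
      by (auto simp: forced_count_def card_gt_0_iff)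
    then show ?thesis using H0 PH0 by (simp add: J'_def J_def T_def)
  qed
  have "\<exists>j\<in>J'. \<forall>i\<in>J'. \<exists>c\<in>\<rat>. (\<lambda>n. weight ar i n / weight ar j n) \<longlonglongrightarrow> c"
  proof (rule dominating_weight[OF finJ'])
    show "\<forall>\<^sub>F n in sequentially. 0 < weight ar i n" for i
      using eventually_gt_at_top[of 0] by eventually_elim (rule weight_pos)
    show "(\<exists>c\<in>\<rat>. (\<lambda>n. weight ar i n / weight ar j n) \<longlonglongrightarrow> c) \<or> (\<lambda>n. weight ar j n / weight ar i n) \<longlonglongrightarrow> 0"
      if "i \<in> J'" "j \<in> J'" for i j
      using weight_comparable[OF grpJ[OF that(1)] grpJ[OF that(2)], of ar] by simp
  qed (use i0 in blast)
  then obtain j where j: "j \<in> J'" "\<forall>i\<in>J'. \<exists>c. c \<in> \<rat> \<and> (\<lambda>n. weight ar i n / weight ar j n) \<longlonglongrightarrow> c" by blast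
  then obtain \<mu> where lam: "\<And>i. i \<in> J' \<Longrightarrow> \<mu> i \<in> \<rat>"
    "\<And>i. i \<in> J' \<Longrightarrow> (\<lambda>n. weight ar i n / weight ar j n) \<longlonglongrightarrow> \<mu> i"
    using bchoice[OF j(2)] by blast
  define V where "V = (\<lambda>m. \<Sum>i\<in>J'. 1 / fact (fst i) * (real (m i) / 2 ^ card (orbits ar (snd i) {1..fst i})) * \<mu> i)"
  have ins: "insert (a0, H0) J' = J'" using i0 by blast
  have lim: "(\<lambda>n. class_size ar P \<Psi> n / weight ar j n) \<longlonglongrightarrow> V (\<lambda>i. forced_count ar (ar R) (tr i) i)"
    if "\<And>n \<sigma> S. \<sigma> permutes {1..n} \<Longrightarrow> \<Psi> n S \<Longrightarrow> \<Psi> n (act \<sigma> ` S)"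
      "\<And>a H n S. perm_group {1..a} H \<Longrightarrow> a \<le> n \<Longrightarrow> 1 \<le> n \<Longrightarrow> S \<in> Inv ar H {1..n} \<Longrightarrow>
      extendable ar {1..a} H k {1..n} S \<Longrightarrow> \<Psi> n S \<longleftrightarrow> tr (a, H) (S \<inter> atoms ar {1..a})" for \<Psi> tr k
    unfolding V_def
    by (rule class_size_over_weight_tendsto[where ar = ar and R = R, OF P R grp0 T J_def J'_def, unfolded ins, OF lam(2)])
      (use that in blast)+
  define V1 where "V1 = V (\<lambda>i. forced_count ar (ar R) (\<lambda>_. True) i)"
  have lim1: "(\<lambda>n. class_size ar P (\<lambda>_ _. True) n / weight ar j n) \<longlonglongrightarrow> V1"
    unfolding V1_def by (rule lim[of "\<lambda>_ _. True" _ "\<lambda>_ _. True"]) auto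
  have nonneg: "0 \<le> \<mu> i" if "i \<in> J'" for i
    by (rule LIMSEQ_le_const[OF lam(2)[OF that]], rule exI[of _ 1])
      (simp add: weight_nonneg)
  \<comment> \<open>Together with the positive count of \<open>j\<close> this keeps the limit of the
    denominator away from 0.\<close>
  have "\<mu> j = 1"
  proof (rule LIMSEQ_unique[OF lam(2)[OF j(1)]], rule tendsto_eventually)
    show "\<forall>\<^sub>F n in sequentially. weight ar j n / weight ar j n = 1"
      using eventually_gt_at_top[of 0] by eventually_elim (simp add: weight_pos less_imp_neq[symmetric])
  qed
  then have "0 < V1" unfolding V1_def V_def using j(1) finJ' nonneg
    by (intro sum_pos2[of _ j]) (auto simp: J'_def)
  \<comment> \<open>Only the integers \<open>m i\<close> depend on the sentence, and each of them is
    bounded; so the finitely many values of \<open>V\<close> on \<open>M\<close> serve all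
    sentences.\<close>
  define M where "M = PiE J' (\<lambda>i. {..(2::nat) ^ card (orbits ar (snd i) {1..fst i})})"
  have finM: "finite M" unfolding M_def by (rule finite_PiE[OF finJ']) simp
  have Vrat: "V m \<in> \<rat>" for m
  proof -
    have "fact k \<in> (\<rat> :: real set)" for k :: nat by (metis Rats_of_nat of_nat_fact)
    then show ?thesis unfolding V_def using lam(1)
      by (intro Rats_sum Rats_mult Rats_divide Rats_power) auto
  qed
  have VM: "V (\<lambda>i. forced_count ar (ar R) (tr i) i) \<in> V ` M" for tr
  proof (rule image_eqI)
    show "V (\<lambda>i. forced_count ar (ar R) (tr i) i) = V (restrict (\<lambda>i. forced_count ar (ar R) (tr i) i) J')"
      unfolding V_def by (rule sum.cong) auto
    show "restrict (\<lambda>i. forced_count ar (ar R) (tr i) i) J' \<in> M"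
      unfolding M_def using forced_count_le[OF grpJ, of _ ar] by auto
  qed
  show ?thesis
  proof (intro exI[of _ "(\<lambda>v. v / V1) ` V ` M"] conjI allI impI)
    show "finite ((\<lambda>v. v / V1) ` V ` M)" using finM by simp
    show "(\<lambda>v. v / V1) ` V ` M \<subseteq> \<rat>" using Vrat by (auto simp: V1_def)
    fix \<phi> :: "'r formula" assume \<phi>: "sentence ar \<phi>"
    \<comment> \<open>Asking for one extendable structure with trace \<open>N\<close> is enough: by
      back and forth all of them agree on \<open>\<phi>\<close>, even over different
      universes.\<close>
    define tr where "tr = (\<lambda>(a :: nat, H) N. \<exists>n S. a \<le> n \<and> 1 \<le> n \<and> S \<in> Inv ar H {1..n} \<and>
      extendable ar {1..a} H (quantifier_rank \<phi>) {1..n} S \<and> S \<inter> atoms ar {1..a} = N \<and> structure_of {1..n} S \<Turnstile> \<phi>)"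
    have tr: "structure_of {1..n} S \<Turnstile> \<phi> \<longleftrightarrow> tr (a, H) (S \<inter> atoms ar {1..a})"
      if h: "perm_group {1..a} H" "a \<le> n" "1 \<le> n" "S \<in> Inv ar H {1..n}"
        "extendable ar {1..a} H (quantifier_rank \<phi>) {1..n} S" for a n :: nat and H S
    proof
      assume "structure_of {1..n} S \<Turnstile> \<phi>"
      then show "tr (a, H) (S \<inter> atoms ar {1..a})" using h unfolding tr_def prod.case by blast
    next
      assume "tr (a, H) (S \<inter> atoms ar {1..a})"
      then obtain n' S' where *: "a \<le> n'" "1 \<le> n'" "S' \<in> Inv ar H {1..n'}"
        "extendable ar {1..a} H (quantifier_rank \<phi>) {1..n'} S'" "S' \<inter> atoms ar {1..a} = S \<inter> atoms ar {1..a}"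
        "structure_of {1..n'} S' \<Turnstile> \<phi>" unfolding tr_def prod.case by blast
      have "structure_of {1..n'} S' \<Turnstile> \<phi> \<longleftrightarrow> structure_of {1..n} S \<Turnstile> \<phi>"
        by (rule extendable_models_iff[OF h(1) *(3) h(4) *(4) h(5) _ _ *(5) _ _ \<phi>]) (use *(1,2) h(2,3) in auto)
      then show "structure_of {1..n} S \<Turnstile> \<phi>" using *(6) by simp
    qed
    have "(\<lambda>n. class_size ar P (\<lambda>n S. structure_of {1..n} S \<Turnstile> \<phi>) n / weight ar j n) \<longlonglongrightarrow>
      V (\<lambda>i. forced_count ar (ar R) (tr i) i)"
      by (rule lim[where k = "quantifier_rank \<phi>"]) (use models_act tr in blast)+
    then have "(\<lambda>n. (class_size ar P (\<lambda>n S. structure_of {1..n} S \<Turnstile> \<phi>) n / weight ar j n) /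
        (class_size ar P (\<lambda>_ _. True) n / weight ar j n)) \<longlonglongrightarrow> V (\<lambda>i. forced_count ar (ar R) (tr i) i) / V1"
      using lim1 \<open>0 < V1\<close> by (intro tendsto_divide) auto
    moreover have "\<forall>\<^sub>F n in sequentially. (class_size ar P (\<lambda>n S. structure_of {1..n} S \<Turnstile> \<phi>) n / weight ar j n) /
        (class_size ar P (\<lambda>_ _. True) n / weight ar j n) =
        class_size ar P (\<lambda>n S. structure_of {1..n} S \<Turnstile> \<phi>) n / class_size ar P (\<lambda>_ _. True) n"
      using eventually_gt_at_top[of 0]
    proof eventually_elim
      case (elim n)
      show ?case using weight_pos[OF elim, of ar j] by simp
    qed
    ultimately have "(\<lambda>n. class_size ar P (\<lambda>n S. structure_of {1..n} S \<Turnstile> \<phi>) n / class_size ar P (\<lambda>_ _. True) n)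
      \<longlonglongrightarrow> V (\<lambda>i. forced_count ar (ar R) (tr i) i) / V1" by (rule Lim_transform_eventually)
    then show "\<exists>l\<in>(\<lambda>v. v / V1) ` V ` M.
      (\<lambda>n. class_size ar P (\<lambda>n S. structure_of {1..n} S \<Turnstile> \<phi>) n / class_size ar P (\<lambda>_ _. True) n) \<longlonglongrightarrow> l"
      using VM[of tr] by blast
  qed
qed

section \<open>Automorphism groups and supports\<close>

lemma bij_betw_structure_of:
  "bij_betw (structure_of {1..n}) (Pow (atoms ar {1..n})) (Structures_on ar n)"
proof (rule bij_betwI[where g = "\<lambda>M. {(R, t). t \<in> interp M R}"])
  show "structure_of {1..n} \<in> Pow (atoms ar {1..n}) \<rightarrow> Structures_on ar n"
  proof
    fix S assume "S \<in> Pow (atoms ar {1..n})"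
    then have "length t = ar R \<and> set t \<subseteq> {1..n}" if "(R, t) \<in> S" for R t
      using that unfolding atoms_def by blast
    then show "structure_of {1..n} S \<in> Structures_on ar n"
      unfolding Structures_on_def structure_of_def by auto
  qed
  show "(\<lambda>M. {(R, t). t \<in> interp M R}) \<in> Structures_on ar n \<rightarrow> Pow (atoms ar {1..n})"
    unfolding Structures_on_def atoms_def by auto
  show "{(R, t). t \<in> interp (structure_of {1..n} S) R} = S" for S
    by (simp add: structure_of_def)
  show "structure_of {1..n} {(R, t). t \<in> interp M R} = M" if "M \<in> Structures_on ar n" for M
    using that by (simp add: structure_of_def Structures_on_def)
qed

lemma proportion_eq_class_size:
  assumes n: "1 \<le> n"
    and Q: "\<And>S. S \<subseteq> atoms ar {1..n} \<Longrightarrow> Q (structure_of {1..n} S) \<longleftrightarrow> P (auts {1..n} S)"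
  shows "proportion ar {M \<in> Structures ar. Q M} \<phi> n =
    class_size ar P (\<lambda>n S. structure_of {1..n} S \<Turnstile> \<phi>) n / class_size ar P (\<lambda>_ _. True) n"
proof -
  let ?C = "{M \<in> Structures ar. Q M}"
  have on: "Structures_on ar n = structure_of {1..n} ` Pow (atoms ar {1..n})"
    and inj: "inj_on (structure_of {1..n}) (Pow (atoms ar {1..n}))"
    using bij_betw_structure_of[of n ar] by (auto simp: bij_betw_def)
  have "Structures_on ar n \<subseteq> Structures ar" using n by (auto simp: Structures_def)
  then have "?C \<inter> Structures_on ar n = {M \<in> Structures_on ar n. Q M}" by blast
  also have "\<dots> = structure_of {1..n} ` {S. S \<subseteq> atoms ar {1..n} \<and> P (auts {1..n} S)}"
    unfolding on using Q by blast
  finally have C: "?C \<inter> Structures_on ar n = structure_of {1..n} ` {S. S \<subseteq> atoms ar {1..n} \<and> P (auts {1..n} S)}" .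
  have size: "card (structure_of {1..n} ` {S. S \<subseteq> atoms ar {1..n} \<and> P (auts {1..n} S) \<and> \<Psi> S}) =
      card {S. S \<subseteq> atoms ar {1..n} \<and> P (auts {1..n} S) \<and> \<Psi> S}" for \<Psi>
    by (rule card_image, rule inj_on_subset[OF inj]) blast
  have "{M \<in> ?C \<inter> Structures_on ar n. M \<Turnstile> \<phi>} =
      structure_of {1..n} ` {S. S \<subseteq> atoms ar {1..n} \<and> P (auts {1..n} S) \<and> structure_of {1..n} S \<Turnstile> \<phi>}"
    unfolding C by blast
  then have "card {M \<in> ?C \<inter> Structures_on ar n. M \<Turnstile> \<phi>} = class_size ar P (\<lambda>n S. structure_of {1..n} S \<Turnstile> \<phi>) n"
    using size by (simp only: class_size_def)
  moreover have "card (?C \<inter> Structures_on ar n) = class_size ar P (\<lambda>_ _. True) n"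
    unfolding C using size[of "\<lambda>_. True"] by (simp only: class_size_def simp_thms)
  ultimately show ?thesis by (simp only: proportion_def)
qed

lemma proportion_limits:
  fixes ar :: "'r::finite \<Rightarrow> nat"
  assumes r: "2 \<le> Max (range ar)" and P: "conj_invariant P"
    and Q: "\<And>n S. S \<subseteq> atoms ar {1..n} \<Longrightarrow> Q (structure_of {1..n} S) \<longleftrightarrow> P (auts {1..n} S)"
  shows "\<exists>A :: real set. finite A \<and> A \<subseteq> \<rat> \<and>
    (\<forall>p. sentence ar p \<longrightarrow> (\<exists>a\<in>A. proportion ar {M \<in> Structures ar. Q M} p \<longlonglongrightarrow> a))"
proof -
  have "Max (range ar) \<in> range ar" by (rule Max_in) auto
  then obtain R where R: "Max (range ar) = ar R" by (rule rangeE)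
  have max: "ar R' \<le> ar R" for R' unfolding R[symmetric] by (rule Max_ge) auto
  obtain A :: "real set" where A: "finite A" "A \<subseteq> \<rat>" "\<And>p. sentence ar p \<Longrightarrow> \<exists>a\<in>A.
      (\<lambda>n. class_size ar P (\<lambda>n S. structure_of {1..n} S \<Turnstile> p) n / class_size ar P (\<lambda>_ _. True) n) \<longlonglongrightarrow> a"
    using class_limits[where ar = ar and R = R, OF P _ max] r R by auto
  have "proportion ar {M \<in> Structures ar. Q M} p \<longlonglongrightarrow> a"
    if "(\<lambda>n. class_size ar P (\<lambda>n S. structure_of {1..n} S \<Turnstile> p) n / class_size ar P (\<lambda>_ _. True) n) \<longlonglongrightarrow> a" for p a
  \<comment> \<open>The value at \<open>n = 0\<close> is skipped because \<open>Structures\<close>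
    contains only nonempty universes.\<close>
  proof (rule Lim_transform_eventually[OF that], rule eventually_sequentiallyI[of 1])
    fix n :: nat assume "1 \<le> n"
    then show "class_size ar P (\<lambda>n S. structure_of {1..n} S \<Turnstile> p) n / class_size ar P (\<lambda>_ _. True) n =
      proportion ar {M \<in> Structures ar. Q M} p n"
      using proportion_eq_class_size[where P = P and Q = Q and ar = ar] Q by simp
  qed
  then show ?thesis using A by meson
qed

section \<open>Translation between extensional bijections and total permutations\<close>

lemma restrict_Bij: "f permutes B \<Longrightarrow> restrict f B \<in> Bij B"
  by (simp add: Bij_def permutes_imp_bij)

text \<open>Elements of \<open>Bij B\<close> are undefined outside \<open>B\<close>, those of
  \<open>auts B S\<close> are the identity there; restriction and extension by the identity
  translate between them.\<close>

lemma automorphisms_structure_of: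
  assumes S: "S \<subseteq> atoms ar B"
  shows "automorphisms ar (structure_of B S) = (\<lambda>f. restrict f B) ` auts B S"
proof
  show "(\<lambda>f. restrict f B) ` auts B S \<subseteq> automorphisms ar (structure_of B S)"
  proof (rule image_subsetI)
    fix f assume f: "f \<in> auts B S"
    have "(R, t) \<in> S \<longleftrightarrow> (R, map (restrict f B) t) \<in> S" if "set t \<subseteq> B" for R t
    proof -
      have "act f (R, t) = (R, map (restrict f B) t)" using that by (auto simp: act_def)
      then show ?thesis using f preservesD[of f S "(R, t)"] by (simp add: auts_def)
    qed
    then show "restrict f B \<in> automorphisms ar (structure_of B S)"
      using f restrict_Bij[of f B] by (auto simp: automorphisms_def auts_def)
  qed
  show "automorphisms ar (structure_of B S) \<subseteq> (\<lambda>f. restrict f B) ` auts B S"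
  proof
    fix g assume g: "g \<in> automorphisms ar (structure_of B S)"
    define f where "f = (\<lambda>x. if x \<in> B then g x else x)"
    have gB: "bij_betw g B B" "g \<in> extensional B"
      using g by (auto simp: automorphisms_def Bij_def)
    have "bij_betw f B B" using gB(1) by (subst bij_betw_cong[of _ _ g]) (auto simp: f_def)
    then have f: "f permutes B" by (rule bij_imp_permutes) (simp add: f_def)
    have "act f p \<in> S \<longleftrightarrow> p \<in> S" for p
    proof (cases "p \<in> atoms ar B")
      case True
      then have "act f p = (fst p, map g (snd p))" by (auto simp: f_def act_def mem_atoms)
      moreover have "snd p \<in> interp (structure_of B S) (fst p) \<longleftrightarrow>
          map g (snd p) \<in> interp (structure_of B S) (fst p)"
        using g True unfolding automorphisms_def mem_atoms structure_of_simps by blast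
      ultimately show ?thesis by (simp only: structure_of_simps prod.collapse)
    next
      case False
      then show ?thesis using S act_mem_atoms[OF f] by blast
    qed
    then have "f \<in> auts B S" using f unfolding auts_def preserves_def by blast
    moreover have "g = restrict f B" using gB(2) by (auto simp: f_def extensional_def)
    ultimately show "g \<in> (\<lambda>f. restrict f B) ` auts B S" by blast
  qed
qed

text \<open>Composition of total functions does not refer to a universe, so a property of this group
  can be one \<open>P\<close> for all \<open>n\<close>.\<close>

definition perm_monoid :: "('a \<Rightarrow> 'a) set \<Rightarrow> ('a \<Rightarrow> 'a) monoid" where
  "perm_monoid H = \<lparr>carrier = H, monoid.mult = (\<circ>), one = id\<rparr>"

lemma perm_monoid_simps [simp]:
  "carrier (perm_monoid H) = H" "x \<otimes>\<^bsub>perm_monoid H\<^esub> y = x \<circ> y" "\<one>\<^bsub>perm_monoid H\<^esub> = id"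
  by (simp_all add: perm_monoid_def)

lemma group_perm_monoid:
  assumes grp: "perm_group B H"
  shows "group (perm_monoid H)"
proof (rule groupI)
  show "\<exists>y\<in>carrier (perm_monoid H). y \<otimes>\<^bsub>perm_monoid H\<^esub> x = \<one>\<^bsub>perm_monoid H\<^esub>"
    if "x \<in> carrier (perm_monoid H)" for x
    using perm_groupD(2,3)[OF grp, of x] that permutes_inv_o(2)[of x B] by (intro bexI[of _ "inv x"]) auto
qed (use perm_groupD[OF grp] in \<open>auto simp: o_assoc\<close>)

lemma perm_monoid_auts_iso_Aut:
  fixes B :: "'a set"
  assumes S: "S \<subseteq> atoms ar B"
  shows "perm_monoid (auts B S) \<cong> Aut ar (structure_of B S)"
proof -
  have "restrict (f \<circ> g) B = compose B (restrict f B) (restrict g B)" if "g permutes B" for f g :: "'a \<Rightarrow> 'a"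
    using that by (auto simp: compose_def permutes_in_image)
  moreover have "restrict f B \<in> Bij B" if "f \<in> auts B S" for f
    using that restrict_Bij by (auto simp: auts_def)
  moreover have "inj_on (\<lambda>f. restrict f B) (auts B S)"
  proof (rule inj_onI, rule ext)
    fix f g x assume *: "f \<in> auts B S" "g \<in> auts B S" "restrict f B = restrict g B"
    show "f x = g x"
    proof (cases "x \<in> B")
      case True
      then show ?thesis using *(3) by (metis restrict_apply')
    next
      case False
      then show ?thesis using *(1,2) by (simp add: auts_def permutes_def)
    qed
  qed
  ultimately have "(\<lambda>f. restrict f B) \<in> iso (perm_monoid (auts B S)) (Aut ar (structure_of B S))"
    using automorphisms_structure_of[OF S]
    by (auto simp: iso_def hom_def Aut_def BijGroup_def bij_betw_def auts_def)
  then show ?thesis by (rule is_isoI)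
qed

lemma perm_group_conj_perm:
  assumes grp: "perm_group B H" and \<sigma>: "\<sigma> permutes B"
  shows "perm_group B (conj_perm \<sigma> ` H)"
proof -
  have comp: "conj_perm \<sigma> f \<circ> conj_perm \<sigma> g = conj_perm \<sigma> (f \<circ> g)" for f g
    by (simp add: conj_perm_def fun_eq_iff permutes_inverses[OF \<sigma>])
  have id: "conj_perm \<sigma> id = id"
    by (simp add: conj_perm_def fun_eq_iff permutes_inverses[OF \<sigma>])
  have "inv (conj_perm \<sigma> h) = conj_perm \<sigma> (inv h)" if "h \<in> H" for h
    using permutes_inv_o[OF perm_groupD(2)[OF grp that]]
    by (intro inv_unique_comp) (simp_all add: comp id)
  then show ?thesis
    using perm_groupD[OF grp] conj_perm_permutes[OF \<sigma>] id[symmetric]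
    by (auto simp: perm_group_def comp)
qed

lemma perm_monoid_conj_iso:
  assumes "\<sigma> permutes B"
  shows "perm_monoid H \<cong> perm_monoid (conj_perm \<sigma> ` H)"
proof -
  have "conj_perm \<sigma> (f \<circ> g) = conj_perm \<sigma> f \<circ> conj_perm \<sigma> g" for f g
    by (simp add: conj_perm_def fun_eq_iff permutes_inverses[OF assms])
  moreover have "inj_on (conj_perm \<sigma>) H"
    by (rule inj_on_inverseI[where g = "conj_perm (inv \<sigma>)"]) (rule conj_perm_inv(1)[OF assms])
  ultimately have "conj_perm \<sigma> \<in> iso (perm_monoid H) (perm_monoid (conj_perm \<sigma> ` H))"
    by (auto simp: iso_def hom_def bij_betw_def)
  then show ?thesis by (rule is_isoI)
qed

lemma embeds_in_iso:
  assumes K: "group K" and L: "group L" and iso: "K \<cong> L" and emb: "G \<lesssim>\<^sub>g K"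
  shows "G \<lesssim>\<^sub>g L"
proof -
  obtain h where h: "h \<in> iso K L" using iso by (auto simp: is_iso_def)
  obtain U where U: "subgroup U K" "G \<cong> K\<lparr>carrier := U\<rparr>" using emb by (auto simp: embeds_in_def)
  have hom: "group_hom K L h" using K L h by (simp add: group_hom_def group_hom_axioms_def iso_def)
  have "subgroup (h ` U) L" by (rule group_hom.subgroup_img_is_subgroup[OF hom U(1)])
  moreover have "h \<in> iso (K\<lparr>carrier := U\<rparr>) (L\<lparr>carrier := h ` U\<rparr>)"
    using h subgroup.subset[OF U(1)]
    by (auto simp: iso_def hom_def bij_betw_def subset_iff inj_on_def)
  then have "G \<cong> L\<lparr>carrier := h ` U\<rparr>" using iso_trans[OF U(2)] is_isoI by blast
  ultimately show ?thesis by (auto simp: embeds_in_def)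
qed

text \<open>A point fixed by \<open>f\<close> is fixed by the whole subgroup that \<open>f\<close>
  generates.\<close>

lemma Spt_singleton:
  assumes f: "f \<in> Bij B"
  shows "Spt B {f} = {a \<in> B. f a \<noteq> a}"
proof -
  have "g a = a" if "g \<in> generate (BijGroup B) {f}" "a \<in> B" "f a = a" for g a
    using that(1)
  proof (induction rule: generate.induct)
    case one
    then show ?case using that(2) by (simp add: BijGroup_def)
  next
    case (incl h)
    then show ?case using that(3) by simp
  next
    case (inv h)
    have "inj_on f B" using f by (simp add: Bij_def bij_betw_def)
    then show ?case using inv that f by (simp add: inv_BijGroup inv_into_f_eq)
  next
    case (eng h k)
    have "{f} \<subseteq> carrier (BijGroup B)" using f by (simp add: BijGroup_def)
    note in_carrier = group.generate_in_carrier[OF group_BijGroup this]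
    have "h \<in> Bij B" "k \<in> Bij B"
      using in_carrier[OF eng.hyps(1)] in_carrier[OF eng.hyps(2)] by (simp_all add: BijGroup_def)
    then show ?case using eng that(2) by (simp add: BijGroup_def compose_def)
  qed
  moreover have "f \<in> generate (BijGroup B) {f}" by (rule generate.incl) simp
  ultimately show ?thesis by (auto simp: Spt_def)
qed

lemma Spt_restrict: "f permutes B \<Longrightarrow> Spt B {restrict f B} = moved {f}"
  unfolding Spt_singleton[OF restrict_Bij] by (auto simp: moved_def permutes_def)

lemma spt_star_structure_of:
  assumes "S \<subseteq> atoms ar B"
  shows "spt_star ar (structure_of B S) = card (moved (auts B S))"
proof -
  have "moved {f} \<subseteq> B" if "f \<in> auts B S" for f
    using that by (auto simp: moved_def auts_def permutes_def)
  then have "Spt_star ar (structure_of B S) = moved (auts B S)"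
    unfolding Spt_star_def automorphisms_structure_of[OF assms]
    by (auto simp: Spt_restrict auts_def moved_def)
  then show ?thesis by (simp add: spt_star_def)
qed

lemma spt_structure_of:
  assumes "S \<subseteq> atoms ar B"
  shows "spt ar (structure_of B S) = Max ((\<lambda>f. card (moved {f})) ` auts B S)"
proof -
  have "{card (Spt (universe (structure_of B S)) {f}) | f. f \<in> automorphisms ar (structure_of B S)} =
    (\<lambda>f. card (Spt B {restrict f B})) ` auts B S"
    unfolding automorphisms_structure_of[OF assms] by auto
  also have "\<dots> = (\<lambda>f. card (moved {f})) ` auts B S"
    by (rule image_cong) (auto simp: auts_def Spt_restrict)
  finally show ?thesis by (simp add: spt_def)
qed

lemma card_moved_conj_perm: "\<sigma> permutes B \<Longrightarrow> card (moved (conj_perm \<sigma> ` H)) = card (moved H)"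
  using card_image[OF inj_on_subset[OF permutes_inj]] by (simp add: moved_conj_perm)

text \<open>Both properties depend on \<open>H\<close> only up to isomorphism, and conjugation is an
  isomorphism.\<close>

lemma conj_invariant_iso:
  assumes "group G"
  shows "conj_invariant (\<lambda>H :: ('a \<Rightarrow> 'a) set. G \<cong> perm_monoid H)" "conj_invariant (\<lambda>H :: ('a \<Rightarrow> 'a) set. G \<lesssim>\<^sub>g perm_monoid H)"
proof -
  have *: "perm_monoid H \<cong> perm_monoid (conj_perm \<sigma> ` H)" "perm_monoid (conj_perm \<sigma> ` H) \<cong> perm_monoid H"
    "group (perm_monoid H)" "group (perm_monoid (conj_perm \<sigma> ` H))"
    if "perm_group B H" "\<sigma> permutes B" for B :: "'a set" and H \<sigma>
  proof -
    show 1: "perm_monoid H \<cong> perm_monoid (conj_perm \<sigma> ` H)" by (rule perm_monoid_conj_iso[OF that(2)])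
    show 2: "group (perm_monoid H)" by (rule group_perm_monoid[OF that(1)])
    show 3: "perm_monoid (conj_perm \<sigma> ` H) \<cong> perm_monoid H" by (rule group.iso_sym[OF 2 1])
    show "group (perm_monoid (conj_perm \<sigma> ` H))"
      by (rule group_perm_monoid[OF perm_group_conj_perm[OF that]])
  qed
  show "conj_invariant (\<lambda>H :: ('a \<Rightarrow> 'a) set. G \<cong> perm_monoid H)"
    unfolding conj_invariant_def
  proof (intro allI impI, elim conjE, rule iffI)
    fix B :: "'a set" and H \<sigma> assume H: "perm_group B H" "\<sigma> permutes B"
    show "G \<cong> perm_monoid H" if "G \<cong> perm_monoid (conj_perm \<sigma> ` H)"
      by (rule iso_trans[OF that *(2)[OF H]])
    show "G \<cong> perm_monoid (conj_perm \<sigma> ` H)" if "G \<cong> perm_monoid H"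
      by (rule iso_trans[OF that *(1)[OF H]])
  qed
  show "conj_invariant (\<lambda>H :: ('a \<Rightarrow> 'a) set. G \<lesssim>\<^sub>g perm_monoid H)"
    unfolding conj_invariant_def
  proof (intro allI impI, elim conjE, rule iffI)
    fix B :: "'a set" and H \<sigma> assume H: "perm_group B H" "\<sigma> permutes B"
    show "G \<lesssim>\<^sub>g perm_monoid H" if "G \<lesssim>\<^sub>g perm_monoid (conj_perm \<sigma> ` H)"
      by (rule embeds_in_iso[OF *(4)[OF H] *(3)[OF H] *(2)[OF H] that])
    show "G \<lesssim>\<^sub>g perm_monoid (conj_perm \<sigma> ` H)" if "G \<lesssim>\<^sub>g perm_monoid H"
      by (rule embeds_in_iso[OF *(3)[OF H] *(4)[OF H] *(1)[OF H] that])
  qed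
qed

theorem theorem1p2:
  fixes ar :: "'r::finite \<Rightarrow> nat"
  assumes "2 \<le> Max (range ar)"
  shows
    "(\<forall>G :: ('g, 'c) monoid_scheme. group G \<and> finite (carrier G) \<longrightarrow>
        limit_law ar {M \<in> Structures ar. G \<cong> Aut ar M} \<and>
        limit_law ar {M \<in> Structures ar. G \<lesssim>\<^sub>g Aut ar M}) \<and>
     (\<forall>m::nat. 2 \<le> m \<longrightarrow>
        limit_law ar {M \<in> Structures ar. spt_star ar M = m} \<and>
        limit_law ar {M \<in> Structures ar. m \<le> spt ar M} \<and>
        limit_law ar {M \<in> Structures ar. m \<le> spt_star ar M}) \<and>
     (\<forall>G :: ('g, 'c) monoid_scheme. group G \<and> finite (carrier G) \<longrightarrow>
        (\<forall>C \<in> {{M \<in> Structures ar. G \<cong> Aut ar M},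
               {M \<in> Structures ar. G \<lesssim>\<^sub>g Aut ar M}}.
          \<exists>A :: real set. finite A \<and> A \<subseteq> \<rat> \<and>
            (\<forall>p. sentence ar p \<longrightarrow> (\<exists>a\<in>A. proportion ar C p \<longlonglongrightarrow> a)))) \<and>
     (\<forall>m::nat. 2 \<le> m \<longrightarrow>
        (\<forall>C \<in> {{M \<in> Structures ar. spt_star ar M = m},
               {M \<in> Structures ar. m \<le> spt ar M},
               {M \<in> Structures ar. m \<le> spt_star ar M}}.
          \<exists>A :: real set. finite A \<and> A \<subseteq> \<rat> \<and>
            (\<forall>p. sentence ar p \<longrightarrow> (\<exists>a\<in>A. proportion ar C p \<longlonglongrightarrow> a))))"
proof -
  let ?lim = "\<lambda>C. \<exists>A :: real set. finite A \<and> A \<subseteq> \<rat> \<and>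
            (\<forall>p. sentence ar p \<longrightarrow> (\<exists>a\<in>A. proportion ar C p \<longlonglongrightarrow> a))"
  have law: "limit_law ar C" if "?lim C" for C
    using that unfolding limit_law_def convergent_def by blast
  note lim = proportion_limits[OF assms]
  have iso: "?lim {M \<in> Structures ar. G \<cong> Aut ar M}" and emb: "?lim {M \<in> Structures ar. G \<lesssim>\<^sub>g Aut ar M}"
    if G: "group G" for G :: "('g, 'c) monoid_scheme"
  proof -
    have 1: "perm_monoid (auts {1..n} S) \<cong> Aut ar (structure_of {1..n} S)"
      "Aut ar (structure_of {1..n} S) \<cong> perm_monoid (auts {1..n} S)"
      if "S \<subseteq> atoms ar {1..n}" for n and S :: "('r \<times> nat list) set"
    proof -
      show "perm_monoid (auts {1..n} S) \<cong> Aut ar (structure_of {1..n} S)"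
        by (rule perm_monoid_auts_iso_Aut[OF that])
      then show "Aut ar (structure_of {1..n} S) \<cong> perm_monoid (auts {1..n} S)"
        by (rule group.iso_sym[OF group_perm_monoid[OF perm_group_auts]])
    qed
    show "?lim {M \<in> Structures ar. G \<cong> Aut ar M}"
      by (rule lim[OF conj_invariant_iso(1)[OF G]]) (rule iffI; erule iso_trans, erule 1)
    show "?lim {M \<in> Structures ar. G \<lesssim>\<^sub>g Aut ar M}"
      by (rule lim[OF conj_invariant_iso(2)[OF G]])
        (metis 1 embeds_in_iso[OF group_perm_monoid[OF perm_group_auts] group_Aut]
          embeds_in_iso[OF group_Aut group_perm_monoid[OF perm_group_auts]])
  qed
  \<comment> \<open>An arbitrary predicate \<open>X\<close> covers the conditions \<open>= m\<close>
    and \<open>\<ge> m\<close> at once.\<close>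
  have star: "?lim {M \<in> Structures ar. X (spt_star ar M)}" for X
  proof (rule lim[where P = "\<lambda>H. X (card (moved H))"])
    show "conj_invariant (\<lambda>H :: (nat \<Rightarrow> nat) set. X (card (moved H)))"
      unfolding conj_invariant_def using card_moved_conj_perm by metis
  qed (simp only: spt_star_structure_of)
  have spt: "?lim {M \<in> Structures ar. m \<le> spt ar M}" for m
  proof (rule lim[where P = "\<lambda>H. m \<le> Max ((\<lambda>f. card (moved {f})) ` H)"])
    have "(\<lambda>f. card (moved {f})) ` conj_perm \<sigma> ` H = (\<lambda>f. card (moved {f})) ` H"
      if "\<sigma> permutes B" for B H and \<sigma> :: "nat \<Rightarrow> nat"
      using card_moved_conj_perm[OF that, of "{_}"] by (simp add: image_image)
    then show "conj_invariant (\<lambda>H :: (nat \<Rightarrow> nat) set. m \<le> Max ((\<lambda>f. card (moved {f})) ` H))"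
      unfolding conj_invariant_def by metis
  qed (simp only: spt_structure_of)
  show ?thesis
    using iso emb star[of "\<lambda>x. x = _"] star[of "\<lambda>x. _ \<le> x"] spt by (auto intro!: law)
qed

end
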